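(* Every twisted Vandermonde amplituhedron $\mathcal{A}_{n,k,m}(Z)$ is homeomorphic to a closed ball, its interior (in $\mathrm{Gr}_{k,k+m}(\mathbb{R})$) is homeomorphic to an open ball, and its boundary is homeomorphic to a sphere. In particular, this holds for every amplituhedron $\mathcal{A}_{n,k,m}(Z)$ with $n-k-m\le 2$.
   Context: Let $n\ge 1$ and $k,m\ge 0$ be integers with $k+m\le n$. Flags: $\mathrm{Fl}_n(\mathbb{C})$ is the variety of complete flags $(V_1\subset\dots\subset V_{n-1})$ in $\mathbb{C}^n$, $\dim V_j=j$ (put $V_0=0$, $V_n=\mathbb{C}^n$); an invertible matrix represents the flag whose $j$-th subspace is the span of its first $j$ columns. $\mathrm{Fl}_n^{>0}$ is the set of flags represented by real matrices all of whose minors are positive, and $\mathrm{Fl}_n^{\ge0}$ is its closure. $\mathrm{Gr}_{k,n}(\mathbb{C})$ is the Grassmannian of $k$-dimensional subspaces of $\mathbb{C}^n$; $\mathrm{Gr}_{k,n}^{>0}$ (resp. $\mathrm{Gr}_{k,n}^{\ge 0}$) is the set of subspaces spanned by the columns of a real $n\times k$ matrix of rank $k$ whose $k\times k$ minors are all positive (resp. nonnegative). Twist map: each $V\in\mathrm{Fl}_n^{\ge 0}$ is represented by a unique real orthogonal matrix $g$ all of whose left-justified minors (row set $I$, column set $\{1,\dots,|I|\}$) are nonnegative; $\vartheta(V)$ is the flag represented by $\delta_ng^{-1}\delta_n$, with $\delta_n=\mathrm{Diag}(1,-1,\dots,(-1)^{n-1})$. It maps $\mathrm{Fl}_n^{>0}$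 to itself. Totally positive Vandermonde flags: $\mathcal{V}_n^{>0}\subseteq\mathrm{Fl}_n^{>0}$ is the set of flags represented by matrices $(\lambda_i^{j-1}x_i)_{1\le i,j\le n}$ with $\lambda_1>\dots>\lambda_n$ real and $x_1,\dots,x_n>0$. Amplituhedron: let $Z$ be a real $(k+m)\times n$ matrix whose $(k+m)\times(k+m)$ minors are all positive, viewed as a linear map $\mathbb{C}^n\to\mathbb{C}^{k+m}$. The map $\tilde Z(V)=\{Z(v):v\in V\}$ is defined on $\mathrm{Gr}_{k,n}^{\ge 0}$ with values in $\mathrm{Gr}_{k,k+m}(\mathbb{R})\subseteq\mathrm{Gr}_{k,k+m}(\mathbb{C})$, and the amplituhedron is $\mathcal{A}_{n,k,m}(Z)=\tilde Z(\mathrm{Gr}_{k,n}^{\ge0})$. It is a twisted Vandermonde amplituhedron if there is $V\in\mathcal{V}_n^{>0}$ such that the rows of $Z$ form a basis of the $(k+m)$-dimensional subspace of the flag $\vartheta(V)$ (given such a real basis, all maximal minors of $Z$ are positive, perhaps after negating a row). *)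

theory Defs
  imports
    "HOL-Analysis.Abstract_Euclidean_Space"
    "Jordan_Normal_Form.Gauss_Jordan_Elimination"
    "Jordan_Normal_Form.DL_Rank"
    "Jordan_Normal_Form.DL_Submatrix"
begin

text \<open>Row, column and coordinate indices start at 0 throughout.\<close>

section \<open>Linear algebra in complex space\<close>

abbreviation cmat :: "real mat \<Rightarrow> complex mat" where
  "cmat \<equiv> map_mat complex_of_real"

abbreviation cspace :: "nat \<Rightarrow> (complex, complex vec) module" where
  "cspace n \<equiv> module_vec TYPE(complex) n"

abbreviation cspan :: "nat \<Rightarrow> complex vec set \<Rightarrow> complex vec set" where
  "cspan n \<equiv> LinearCombinations.module.span class_ring (cspace n)"

abbreviation clin_dep :: "nat \<Rightarrow> complex vec set \<Rightarrow> bool" where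
  "clin_dep n \<equiv> LinearCombinations.module.lin_dep class_ring (cspace n)"

section \<open>The Grassmannian\<close>

definition Gr :: "nat \<Rightarrow> nat \<Rightarrow> complex vec set set" where
  "Gr k d = {W. VectorSpace.subspace class_ring W (cspace d) \<and>
                vectorspace.dim class_ring (cspace d\<lparr>carrier := W\<rparr>) = k}"

definition Gr_real :: "nat \<Rightarrow> nat \<Rightarrow> complex vec set set" where
  "Gr_real k d = {W \<in> Gr k d. \<exists>A \<in> carrier_mat d k. W = vec_space.col_space d (cmat A)}"

definition mat_topology :: "nat \<Rightarrow> nat \<Rightarrow> complex mat topology" where
  "mat_topology d k = pullback_topology (carrier_mat d k)
     (\<lambda>A. \<lambda>p \<in> {..<d} \<times> {..<k}. A $$ p)
     (product_topology (\<lambda>_. euclidean) ({..<d} \<times> {..<k}))"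

definition frames :: "nat \<Rightarrow> nat \<Rightarrow> complex mat set" where
  "frames k d = {A \<in> carrier_mat d k. vec_space.rank d A = k}"

definition frame_topology :: "nat \<Rightarrow> nat \<Rightarrow> complex mat topology" where
  "frame_topology k d = subtopology (mat_topology d k) (frames k d)"

text \<open>The usual topology: the quotient of the space of full-rank matrices by the column span
  map; see \<open>quotient_map_Gr\<close> below.\<close>

definition Gr_topology :: "nat \<Rightarrow> nat \<Rightarrow> complex vec set topology" where
  "Gr_topology k d = topology (\<lambda>U. U \<subseteq> Gr k d \<and>
     openin (frame_topology k d) {A \<in> frames k d. vec_space.col_space d A \<in> U})"

definition Gr_real_topology :: "nat \<Rightarrow> nat \<Rightarrow> complex vec set topology" where
  "Gr_real_topology k d = subtopology (Gr_topology k d) (Gr_real k d)"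

lemma topspace_mat_topology: "topspace (mat_topology d k) = carrier_mat d k"
  by (auto simp: mat_topology_def topspace_pullback_topology)

lemma topspace_frame_topology: "topspace (frame_topology k d) = frames k d"
  by (auto simp: frame_topology_def topspace_mat_topology frames_def)

lemma openin_Gr_topology:
  "openin (Gr_topology k d) U \<longleftrightarrow> U \<subseteq> Gr k d \<and>
     openin (frame_topology k d) {A \<in> frames k d. vec_space.col_space d A \<in> U}"
proof -
  let ?pre = "\<lambda>U. {A \<in> frames k d. vec_space.col_space d A \<in> U}"
  have "?pre (S \<inter> T) = ?pre S \<inter> ?pre T" for S T
    by auto
  moreover have "?pre (\<Union>\<K>) = \<Union>(?pre ` \<K>)" for \<K>
    by auto
  ultimately have "istopology (\<lambda>U. U \<subseteq> Gr k d \<and> openin (frame_topology k d) (?pre U))"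
    unfolding istopology_def by (auto intro!: openin_Union)
  then show ?thesis
    by (simp add: Gr_topology_def)
qed

lemma col_space_frames: "vec_space.col_space d ` frames k d = Gr k d"
proof (intro equalityI subsetI)
  interpret vec_space "TYPE(complex)" d .
  fix W assume "W \<in> col_space ` frames k d"
  then obtain A where A: "A \<in> carrier_mat d k" "rank A = k" "W = col_space A"
    by (auto simp: frames_def)
  then have "set (cols A) \<subseteq> carrier_vec d"
    using cols_dim by blast
  then show "W \<in> Gr k d"
    using A span_is_subspace unfolding Gr_def rank_def col_space_def by auto
next
  interpret vec_space "TYPE(complex)" d .
  fix W assume "W \<in> Gr k d"
  then have sub: "VectorSpace.subspace class_ring W V" and dim: "vectorspace.dim class_ring (vs W) = k"
    by (auto simp: Gr_def)
  interpret W: vectorspace class_ring "vs W"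
    using sub subspace_is_vs by blast
  have subm: "submodule class_ring W V"
    using sub by (simp add: VectorSpace.subspace_def)
  then have WV: "W \<subseteq> carrier_vec d"
    unfolding submodule_def by simp
  have "\<exists>B. finite B \<and> maximal B (\<lambda>S. S \<subseteq> W \<and> lin_indpt S)"
  proof (rule maximal_exists[where N = dim and B = "{}"])
    show "finite S \<and> card S \<le> dim" if "S \<subseteq> W \<and> lin_indpt S" for S
      using that WV li_le_dim[OF fin_dim, of S] by auto
  qed (auto simp: lin_dep_def)
  then obtain B where B: "finite B" "maximal B (\<lambda>S. S \<subseteq> W \<and> lin_indpt S)"
    by blast
  then have BW: "B \<subseteq> W" "lin_indpt B"
    by (auto simp: maximal_def)
  have "maximal B (\<lambda>S. S \<subseteq> carrier (vs W) \<and> W.lin_indpt S)"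
    using B(2) span_li_not_depend(2)[OF _ subm] unfolding maximal_def by auto
  then have "W.basis B"
    by (rule W.max_li_is_basis)
  then have card: "card B = k" and span: "span B = W"
    using dim W.dim_basis[OF B(1)] span_li_not_depend(1)[OF BW(1) subm]
    by (auto simp: W.basis_def)
  obtain bs where bs: "set bs = B" "length bs = k"
    using B(1) card by (metis distinct_card finite_distinct_list)
  define A where "A = mat_of_cols d bs"
  have cols: "cols A = bs"
    unfolding A_def using bs(1) BW(1) WV by (intro cols_mat_of_cols) blast
  then have "A \<in> frames k d" "col_space A = W"
    using span bs dim by (auto simp: frames_def rank_def col_space_def A_def)
  then show "W \<in> col_space ` frames k d"
    by blast
qed

lemma quotient_map_Gr:
  "quotient_map (frame_topology k d) (Gr_topology k d) (vec_space.col_space d)"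
  and topspace_Gr_topology: "topspace (Gr_topology k d) = Gr k d"
proof -
  have *: "{A \<in> frames k d. vec_space.col_space d A \<in> Gr k d} = frames k d"
    using col_space_frames by blast
  have "openin (Gr_topology k d) (Gr k d)"
    unfolding openin_Gr_topology * by (metis openin_topspace order_refl topspace_frame_topology)
  then show top: "topspace (Gr_topology k d) = Gr k d"
    by (meson openin_Gr_topology openin_subset openin_topspace subset_antisym)
  show "quotient_map (frame_topology k d) (Gr_topology k d) (vec_space.col_space d)"
    unfolding quotient_map_def top topspace_frame_topology
    by (auto simp: openin_Gr_topology col_space_frames)
qed

section \<open>The twist map and Vandermonde flags\<close>

text \<open>A complete flag is the function sending \<open>j\<close> to its \<open>j\<close>-th subspace; a flag represented by
  an invertible matrix is constantly the whole space from \<open>j = n\<close> on.\<close>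

definition flag_of :: "nat \<Rightarrow> complex mat \<Rightarrow> nat \<Rightarrow> complex vec set" where
  "flag_of n A = (\<lambda>j. cspan n (set (take j (cols A))))"

definition left_minors_nonneg :: "nat \<Rightarrow> real mat \<Rightarrow> bool" where
  "left_minors_nonneg n g \<longleftrightarrow>
     (\<forall>I \<subseteq> {..<n}. 0 \<le> Determinant.det (submatrix g I {..<card I}))"

definition sign_mat :: "nat \<Rightarrow> real mat" where
  "sign_mat n = mat_diag n (\<lambda>i. (-1) ^ i)"

text \<open>On a totally nonnegative flag \<open>V\<close>, the matrix \<open>g\<close> below exists and is unique; at other
  flags the value of \<open>twist\<close> is irrelevant. An orthogonal \<open>g\<close> is invertible, so
  \<open>mat_inverse g\<close> is not \<open>None\<close>. (The library predicate \<open>orthogonal_mat\<close> does not normalise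
  the columns, and so is not used.)\<close>

definition twist :: "nat \<Rightarrow> (nat \<Rightarrow> complex vec set) \<Rightarrow> nat \<Rightarrow> complex vec set" where
  "twist n V =
     (let g = (THE g. g \<in> carrier_mat n n \<and> transpose_mat g * g = 1\<^sub>m n \<and>
                      left_minors_nonneg n g \<and> flag_of n (cmat g) = V)
      in flag_of n (cmat (sign_mat n * the (mat_inverse g) * sign_mat n)))"

definition vandermonde_flags :: "nat \<Rightarrow> (nat \<Rightarrow> complex vec set) set" where
  "vandermonde_flags n =
     {flag_of n (cmat (mat n n (\<lambda>(i, j). l i ^ j * x i))) | l x :: nat \<Rightarrow> real.
        (\<forall>i j. i < j \<and> j < n \<longrightarrow> l j < l i) \<and> (\<forall>i < n. 0 < x i)}"

section \<open>Amplituhedra\<close>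

definition Gr_nonneg :: "nat \<Rightarrow> nat \<Rightarrow> complex vec set set" where
  "Gr_nonneg k n =
     {vec_space.col_space n (cmat A) | A. A \<in> carrier_mat n k \<and> vec_space.rank n A = k \<and>
        (\<forall>I \<subseteq> {..<n}. card I = k \<longrightarrow> 0 \<le> Determinant.det (submatrix A I UNIV))}"

definition maximal_minors_pos :: "nat \<Rightarrow> nat \<Rightarrow> real mat \<Rightarrow> bool" where
  "maximal_minors_pos d n Z \<longleftrightarrow>
     (\<forall>J \<subseteq> {..<n}. card J = d \<longrightarrow> 0 < Determinant.det (submatrix Z UNIV J))"

definition amplituhedron :: "nat \<Rightarrow> nat \<Rightarrow> real mat \<Rightarrow> complex vec set set" where
  "amplituhedron n k Z = (\<lambda>W. (\<lambda>v. cmat Z *\<^sub>v v) ` W) ` Gr_nonneg k n"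

definition twisted_vandermonde :: "nat \<Rightarrow> nat \<Rightarrow> real mat \<Rightarrow> bool" where
  "twisted_vandermonde n d Z \<longleftrightarrow>
     (\<exists>V \<in> vandermonde_flags n.
        distinct (rows (cmat Z)) \<and> \<not> clin_dep n (set (rows (cmat Z))) \<and>
        cspan n (set (rows (cmat Z))) = twist n V d)"

section \<open>Balls and spheres\<close>

definition closed_ball_top :: "nat \<Rightarrow> (nat \<Rightarrow> real) topology" where
  "closed_ball_top N = subtopology (Euclidean_space N) {x. (\<Sum>i<N. (x i)\<^sup>2) \<le> 1}"

definition open_ball_top :: "nat \<Rightarrow> (nat \<Rightarrow> real) topology" where
  "open_ball_top N = subtopology (Euclidean_space N) {x. (\<Sum>i<N. (x i)\<^sup>2) < 1}"

text \<open>The unit sphere in \<open>N\<close>-space, of dimension \<open>N - 1\<close>; it is empty for \<open>N = 0\<close>, and is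
  \<open>nsphere (N - 1)\<close> otherwise.\<close>

definition unit_sphere_top :: "nat \<Rightarrow> (nat \<Rightarrow> real) topology" where
  "unit_sphere_top N = subtopology (Euclidean_space N) {x. (\<Sum>i<N. (x i)\<^sup>2) = 1}"

definition ball_in :: "'a topology \<Rightarrow> nat \<Rightarrow> 'a set \<Rightarrow> bool" where
  "ball_in X N S \<longleftrightarrow>
     subtopology X S homeomorphic_space closed_ball_top N \<and>
     subtopology X (X interior_of S) homeomorphic_space open_ball_top N \<and>
     subtopology X (X frontier_of S) homeomorphic_space unit_sphere_top N"

end

(*
  The kernel of Z is spanned by eigenvectors of a Jacobi matrix J (symmetric tridiagonal with
  positive off-diagonal entries) for its n - k - m smallest eigenvalues: for a twisted Vandermonde
  amplituhedron J is multiplication by the variable in the basis of orthogonal polynomials of the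
  measure with masses x_i^2 at the points lambda_i, and in codimension at most two J can be written
  down.  The flow exp (t J) maps Gr_{k,n}^{>=0} into Gr_{k,n}^{>0} for t > 0, because the Pluecker
  coordinates satisfy a cooperative irreducible linear system, and it descends to Gr_{k,k+m} along
  Z.  In the affine chart around the image of the top k-dimensional eigenspace, which contains the
  amplituhedron, the flow is a diagonal linear contraction.  It maps the amplituhedron into its
  interior, so every orbit crosses the boundary exactly once, and the same is true for the unit
  ball; moving along the orbits carries one to the other.
*)
theory Submission
  imports Defs "HOL-Analysis.Function_Metric" "HOL-Computational_Algebra.Fundamental_Theorem_Algebra"
begin

section \<open>Bodies contracted by a diagonal flow\<close>

text \<open>Convexity is not at hand, so the flow itself replaces radial projection: with
  \<open>r = exp t\<close> the contraction becomes division by powers of \<open>r\<close>, and a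
  compact set carried into its interior has a Minkowski functional for this weighted scaling. The
  chart works because all maximal minors of the top k eigenvectors have one sign: Cauchy-Binet
  against a totally nonnegative subspace then has no cancellation, which puts the subspace inside
  the chart and also bounds its coordinates. Since the kernel of Z is spanned by the last
  eigenvectors, Z merely forgets the trailing chart coordinates. The twist enters because
  orthogonalising the Vandermonde columns is Gram-Schmidt on monomials, and inverting the resulting
  orthogonal matrix by transposition turns the polynomials evaluated at the points into
  eigenvectors. In small codimension, positive maximal minors of Z make the kernel totally positive
  after alternating signs. A Jacobi matrix with that eigenspace has it at the top automatically;
  conjugating its negative by the alternating signs moves it to the bottom.\<close>

lemma Euclidean_space_eq_top_of_set:
  "Euclidean_space N = top_of_set {x. \<forall>i\<ge>N. x i = 0}"
  by (simp add: Euclidean_space_def euclidean_product_topology)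

lemma tendsto_coordinatewise:
  fixes f :: "'a \<Rightarrow> 'b \<Rightarrow> 'c::topological_space"
  assumes "\<And>i. ((\<lambda>x. f x i) \<longlongrightarrow> l i) F"
  shows "(f \<longlongrightarrow> l) F"
proof -
  have "limitin (product_topology (\<lambda>_. euclidean) UNIV) f l F"
    using assms by (simp add: limitin_componentwise)
  then show ?thesis
    by (simp add: euclidean_product_topology)
qed

text \<open>The diagonal flow at time \<open>ln r\<close>. The multiplicative parameter makes
  \<open>gauge\<close> homogeneous of degree one; \<open>r > 1\<close> contracts.\<close>

definition dilation :: "(nat \<Rightarrow> real) \<Rightarrow> real \<Rightarrow> (nat \<Rightarrow> real) \<Rightarrow> nat \<Rightarrow> real" where
  "dilation \<mu> r x = (\<lambda>i. x i / r powr \<mu> i)"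

lemma dilation_1 [simp]: "dilation \<mu> 1 x = x"
  by (simp add: dilation_def)

lemma dilation_0 [simp]: "dilation \<mu> r (\<lambda>i. 0) = (\<lambda>i. 0)"
  by (simp add: dilation_def)

lemma dilation_dilation:
  "0 < r \<Longrightarrow> 0 < s \<Longrightarrow> dilation \<mu> r (dilation \<mu> s x) = dilation \<mu> (r * s) x"
  by (simp add: dilation_def powr_mult mult.commute)

lemma dilation_in_Euclidean_space:
  "x \<in> topspace (Euclidean_space N) \<Longrightarrow> dilation \<mu> r x \<in> topspace (Euclidean_space N)"
  by (simp add: topspace_Euclidean_space dilation_def)

lemma continuous_on_dilation:
  assumes "continuous_on S f" "continuous_on S g" "\<And>x. x \<in> S \<Longrightarrow> 0 < f x"
  shows "continuous_on S (\<lambda>x. dilation \<mu> (f x) (g x))"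
  unfolding dilation_def
  apply (intro continuous_on_coordinatewise_then_product continuous_on_divide continuous_on_powr
      assms continuous_on_const continuous_on_product_then_coordinatewise[OF assms(2)])
  using assms(3) by (fastforce)+

lemma continuous_map_dilation:
  assumes "0 < r"
  shows "continuous_map (Euclidean_space N) (Euclidean_space N) (dilation \<mu> r)"
proof -
  have "continuous_on {x. \<forall>i\<ge>N. x i = 0} (\<lambda>x. dilation \<mu> r x)"
    by (rule continuous_on_dilation) (auto intro: assms)
  then show ?thesis
    unfolding Euclidean_space_eq_top_of_set continuous_map_in_subtopology
    by (auto simp: dilation_def)
qed

text \<open>The abstract form of an amplituhedron in its chart: there is no convexity, and the
  position of the origin is a consequence. The exponents are positive at every index, including
  those from \<open>N\<close> on, so that coordinatewise arguments need no case split.\<close>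

locale contracted_body =
  fixes N :: nat and \<mu> :: "nat \<Rightarrow> real" and K :: "(nat \<Rightarrow> real) set"
  assumes exponent_pos: "\<And>i. 0 < \<mu> i"
    and compactin: "compactin (Euclidean_space N) K"
    and nonempty: "K \<noteq> {}"
    and contracted: "\<And>r x. x \<in> K \<Longrightarrow> 1 < r \<Longrightarrow> dilation \<mu> r x \<in> Euclidean_space N interior_of K"
begin

abbreviation "E \<equiv> Euclidean_space N"
abbreviation "I \<equiv> E interior_of K"

lemma subset: "K \<subseteq> topspace E"
  using compactin compactin_subset_topspace by blast

lemma compact: "compact K"
  using compactin unfolding Euclidean_space_eq_top_of_set compactin_subtopology by simp

lemma closed: "closed K"
  by (simp add: compact compact_imp_closed)

lemma closedin: "closedin E K"
  using closed subset by (simp add: closedin_Euclidean_space_iff)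

lemma openin_interior: "openin E I"
  by simp

lemma interior_subset: "I \<subseteq> K"
  by (rule interior_of_subset)

lemma dilation_tendsto_0: "((\<lambda>r. dilation \<mu> r x) \<longlongrightarrow> (\<lambda>i. 0)) at_top"
proof (rule tendsto_coordinatewise)
  fix i
  have "((\<lambda>r. x i * r powr (- \<mu> i)) \<longlongrightarrow> x i * 0) at_top"
    by (intro tendsto_mult tendsto_const tendsto_neg_powr filterlim_ident) (simp add: exponent_pos)
  then show "((\<lambda>r. dilation \<mu> r x i) \<longlongrightarrow> 0) at_top"
    by (simp add: dilation_def powr_minus divide_inverse)
qed

text \<open>The origin is the limit of every orbit, hence in the closed set \<open>K\<close>; being
  fixed by the flow, it is then moved into the interior by \<open>contracted\<close>.\<close>

lemma zero_in_interior: "(\<lambda>i. 0) \<in> I"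
proof -
  obtain x where x: "x \<in> K"
    using nonempty by blast
  have "\<forall>\<^sub>F r in at_top. dilation \<mu> r x \<in> K"
    using eventually_gt_at_top[of "1::real"]
    by eventually_elim (use contracted[OF x] interior_subset in blast)
  then have "(\<lambda>i. 0) \<in> K"
    using Lim_in_closed_set[OF closed _ _ dilation_tendsto_0] by simp
  from contracted[OF this, of 2] show ?thesis
    by simp
qed

lemma absorbing:
  assumes "x \<in> topspace E"
  obtains r where "0 < r" "dilation \<mu> r x \<in> K"
proof -
  obtain U where U: "open U" "I = topspace E \<inter> U"
    using openin_interior unfolding Euclidean_space_eq_top_of_set openin_open by auto
  then have "\<forall>\<^sub>F r in at_top. dilation \<mu> r x \<in> U"
    using zero_in_interior topological_tendstoD[OF dilation_tendsto_0] by blast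
  then have "\<forall>\<^sub>F r in at_top. 0 < r \<and> dilation \<mu> r x \<in> K"
    using eventually_gt_at_top[of 0]
    by eventually_elim (use U dilation_in_Euclidean_space[OF assms] interior_subset in blast)
  then show thesis
    using that eventually_happens' trivial_limit_at_top_linorder by blast
qed

text \<open>Minkowski functional of \<open>K\<close> with linear scaling replaced by the weighted
  dilation: \<open>K\<close> is the set where it is at most 1, the interior the set where it is
  below 1.\<close>

definition gauge :: "(nat \<Rightarrow> real) \<Rightarrow> real" where
  "gauge x = Inf {r. 0 < r \<and> dilation \<mu> r x \<in> K}"

lemma dilation_mono:
  assumes "0 < r" "dilation \<mu> r x \<in> K" "r < s"
  shows "dilation \<mu> s x \<in> I"
  using contracted[OF assms(2), of "s / r"] assms by (simp add: dilation_dilation)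

lemma bdd: "bdd_below {r. 0 < r \<and> dilation \<mu> r x \<in> K}"
  by (rule bdd_belowI[of _ 0]) auto

lemma gauge_le: "0 < r \<Longrightarrow> dilation \<mu> r x \<in> K \<Longrightarrow> gauge x \<le> r"
  unfolding gauge_def by (rule cInf_lower) (auto intro: bdd)

lemma gauge_lessD:
  assumes "x \<in> topspace E" "gauge x < r"
  shows "dilation \<mu> r x \<in> I"
proof -
  have "{r. 0 < r \<and> dilation \<mu> r x \<in> K} \<noteq> {}"
    using absorbing[OF assms(1)] by blast
  then obtain s where "0 < s" "dilation \<mu> s x \<in> K" "s < r"
    using cInf_lessD[of "{r. 0 < r \<and> dilation \<mu> r x \<in> K}" r] assms(2)
    unfolding gauge_def by auto
  then show ?thesis
    by (rule dilation_mono)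
qed

lemma gauge_nonneg: "x \<in> topspace E \<Longrightarrow> 0 \<le> gauge x"
proof -
  assume "x \<in> topspace E"
  then have "{r. 0 < r \<and> dilation \<mu> r x \<in> K} \<noteq> {}"
    using absorbing by blast
  then show ?thesis
    unfolding gauge_def by (rule cInf_greatest) simp
qed

text \<open>Strictness comes from openness: if the orbit is in the interior at parameter r, it is
  still in \<open>K\<close> at a slightly smaller parameter.\<close>

lemma gauge_less:
  assumes "x \<in> topspace E" "0 < r" "dilation \<mu> r x \<in> I"
  shows "gauge x < r"
proof -
  have "continuous_on {0<..} (\<lambda>s. dilation \<mu> s x)"
    by (rule continuous_on_dilation) (auto intro!: continuous_intros)
  then have "continuous_map (top_of_set {0<..}) E (\<lambda>s. dilation \<mu> s x)"
    using assms(1) unfolding Euclidean_space_eq_top_of_set continuous_map_in_subtopology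
    by (auto simp: dilation_def)
  then have "openin (top_of_set {0<..}) {s \<in> {0<..}. dilation \<mu> s x \<in> I}"
    using openin_continuous_map_preimage[OF _ openin_interior] by fastforce
  then have "open {s \<in> {0<..}. dilation \<mu> s x \<in> I}"
    by (simp add: openin_open_eq)
  then obtain e where e: "0 < e" "ball r e \<subseteq> {s \<in> {0<..}. dilation \<mu> s x \<in> I}"
    using assms open_contains_ball by blast
  have "r - e / 2 \<in> ball r e"
    using e by (simp add: dist_real_def)
  then have "r - e / 2 \<in> {s \<in> {0<..}. dilation \<mu> s x \<in> I}"
    using e(2) by blast
  then have "0 < r - e / 2" "dilation \<mu> (r - e / 2) x \<in> K"
    using interior_subset by auto
  from gauge_le[OF this] show ?thesis
    using e by simp
qed

text \<open>The infimum is attained because \<open>K\<close> is closed: let the parameter decrease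
  to r.\<close>

lemma gauge_leD:
  assumes "x \<in> topspace E" "0 < r" "gauge x \<le> r"
  shows "dilation \<mu> r x \<in> K"
proof (rule Lim_in_closed_set[OF closed])
  have "continuous_on {0<..} (\<lambda>s. dilation \<mu> s x)"
    by (rule continuous_on_dilation) (auto intro!: continuous_intros)
  then have "((\<lambda>s. dilation \<mu> s x) \<longlongrightarrow> dilation \<mu> r x) (at r)"
    using assms(2) by (simp add: continuous_on_eq_continuous_at isCont_def)
  then show "((\<lambda>s. dilation \<mu> s x) \<longlongrightarrow> dilation \<mu> r x) (at_right r)"
    by (rule tendsto_within_subset) auto
  show "\<forall>\<^sub>F s in at_right r. dilation \<mu> s x \<in> K"
    using eventually_at_right_less[of r]
    by eventually_elim (use gauge_lessD[OF assms(1)] assms(3) interior_subset in force)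
qed simp

lemma gauge_le_iff:
  "x \<in> topspace E \<Longrightarrow> 0 < r \<Longrightarrow> gauge x \<le> r \<longleftrightarrow> dilation \<mu> r x \<in> K"
  using gauge_leD gauge_le by blast

lemma gauge_less_iff:
  "x \<in> topspace E \<Longrightarrow> 0 < r \<Longrightarrow> gauge x < r \<longleftrightarrow> dilation \<mu> r x \<in> I"
  using gauge_less gauge_lessD by blast

lemma gauge_dilation:
  assumes "x \<in> topspace E" "0 < s"
  shows "gauge (dilation \<mu> s x) = gauge x / s"
proof -
  have "gauge (dilation \<mu> s x) < r \<longleftrightarrow> gauge x / s < r" for r
  proof (cases "0 < r")
    case True
    have "gauge (dilation \<mu> s x) < r \<longleftrightarrow> gauge x < r * s"
      using True assms by (simp add: gauge_less_iff dilation_in_Euclidean_space dilation_dilation)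
    then show ?thesis
      using assms by (simp add: divide_less_eq)
  next
    case False
    then show ?thesis
      using gauge_nonneg[OF dilation_in_Euclidean_space[OF assms(1)], of \<mu> s]
        divide_nonneg_pos[OF gauge_nonneg[OF assms(1)] assms(2)] by linarith
  qed
  \<comment> \<open>Two reals with the same strict upper bounds are equal; each is tested as a bound
    for the other.\<close>
  from this[of "gauge x / s"] this[of "gauge (dilation \<mu> s x)"] show ?thesis
    by linarith
qed

lemma gauge_zero: "gauge (\<lambda>i. 0) = 0"
proof -
  have "gauge (\<lambda>i. 0) \<le> r" if "0 < r" for r
    using that zero_in_interior interior_subset by (intro gauge_le) auto
  moreover have "0 \<le> gauge (\<lambda>i. 0)"
    by (rule gauge_nonneg) (simp add: topspace_Euclidean_space)
  ultimately show ?thesis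
    by (metis antisym field_le_epsilon add_0)
qed

lemma coordinates_bounded:
  "\<exists>R. \<forall>x\<in>K. \<forall>i. \<bar>x i\<bar> \<le> R"
proof -
  have "\<exists>R. \<forall>x\<in>K. \<bar>x i\<bar> \<le> R" for i
  proof -
    have "compact ((\<lambda>x. x i) ` K)"
      using continuous_on_subset[OF continuous_on_product_coordinates subset_UNIV]
      by (rule compact_continuous_image[OF _ compact])
    then show ?thesis
      by (auto dest!: compact_imp_bounded simp: bounded_real)
  qed
  then obtain R where R: "\<And>i x. x \<in> K \<Longrightarrow> \<bar>x i\<bar> \<le> R i"
    by metis
  have "\<bar>x i\<bar> \<le> (\<Sum>j<N. \<bar>R j\<bar>)" if "x \<in> K" for x i
  proof (cases "i < N")
    case True
    have "\<bar>x i\<bar> \<le> \<bar>R i\<bar>"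
      using R[OF that, of i] by linarith
    also have "\<dots> \<le> (\<Sum>j<N. \<bar>R j\<bar>)"
      using True by (intro member_le_sum) auto
    finally show ?thesis .
  next
    case False
    then have "x i = 0"
      using that subset by (auto simp: topspace_Euclidean_space)
    then show ?thesis
      by (simp add: sum_nonneg)
  qed
  then show ?thesis
    by blast
qed

text \<open>Gauge 0 would keep the whole orbit in the bounded set \<open>K\<close> as
  \<open>r\<close> tends to 0, although a nonzero coordinate blows up there.\<close>

lemma gauge_pos:
  assumes "x \<in> topspace E" "x \<noteq> (\<lambda>i. 0)"
  shows "0 < gauge x"
proof (rule ccontr)
  assume "\<not> 0 < gauge x"
  have in_K: "dilation \<mu> r x \<in> K" if "0 < r" for r
    by (rule gauge_leD[OF assms(1) that]) (use \<open>\<not> 0 < gauge x\<close> that in linarith)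
  obtain R where R: "\<And>x i. x \<in> K \<Longrightarrow> \<bar>x i\<bar> \<le> R"
    using coordinates_bounded by blast
  have "x i = 0" for i
  proof -
    have ev: "\<forall>\<^sub>F r in at_right 0. \<bar>x i\<bar> \<le> R * r powr \<mu> i"
      using eventually_at_right_less[of "0::real"]
    proof eventually_elim
      case (elim r)
      then have "\<bar>x i\<bar> / r powr \<mu> i \<le> R"
        using R[OF in_K[OF elim], of i] by (simp add: dilation_def abs_divide)
      then show ?case
        using elim by (simp add: pos_divide_le_eq)
    qed
    have "((\<lambda>r. r powr \<mu> i) \<longlongrightarrow> 0 powr \<mu> i) (at_right 0)"
    proof (rule tendsto_powr'[OF tendsto_ident_at tendsto_const])
      have "\<forall>\<^sub>F r :: real in at_right 0. 0 \<le> r"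
        using eventually_at_right_less[of "0::real"] by eventually_elim simp
      then show "(0::real) \<noteq> 0 \<or> 0 < \<mu> i \<and> (\<forall>\<^sub>F r :: real in at_right 0. 0 \<le> r)"
        using exponent_pos by simp
    qed
    then have "((\<lambda>r. R * r powr \<mu> i) \<longlongrightarrow> R * 0 powr \<mu> i) (at_right 0)"
      by (rule tendsto_mult_left)
    from tendsto_lowerbound[OF this ev] have "\<bar>x i\<bar> \<le> R * 0 powr \<mu> i"
      by simp
    then show ?thesis
      by simp
  qed
  then show False
    using assms(2) by auto
qed

text \<open>For positive levels, strict and weak sublevel sets are preimages of the interior and of
  \<open>K\<close> under one dilation; level 0 is the origin alone.\<close>

lemma continuous_map_gauge: "continuous_map E euclideanreal gauge"
proof -
  have "openin E {x \<in> topspace E. gauge x < a}" for a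
  proof (cases "0 < a")
    case True
    then have "{x \<in> topspace E. gauge x < a} = {x \<in> topspace E. dilation \<mu> a x \<in> I}"
      using gauge_less_iff by blast
    then show ?thesis
      using openin_continuous_map_preimage[OF continuous_map_dilation[OF True] openin_interior] by simp
  next
    case False
    have "\<not> gauge x < a" if "x \<in> topspace E" for x
      using gauge_nonneg[OF that] False by linarith
    then have "{x \<in> topspace E. gauge x < a} = {}"
      by blast
    then show ?thesis
      by (metis openin_empty)
  qed
  moreover have "closedin E {x \<in> topspace E. gauge x \<le> a}" for a
  proof (cases "0 < a")
    case True
    then have "{x \<in> topspace E. gauge x \<le> a} = {x \<in> topspace E. dilation \<mu> a x \<in> K}"
      using gauge_le_iff by blast
    then show ?thesis
      using closedin_continuous_map_preimage[OF continuous_map_dilation[OF True] closedin] by simp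
  next
    case False
    have "gauge x \<le> a \<longleftrightarrow> a = 0 \<and> x = (\<lambda>i. 0)" if "x \<in> topspace E" for x
      using gauge_nonneg[OF that] gauge_pos[OF that] gauge_zero False by force
    moreover have "(\<lambda>i. 0) \<in> topspace E"
      by (simp add: topspace_Euclidean_space)
    ultimately have "{x \<in> topspace E. gauge x \<le> a} = (if a = 0 then {\<lambda>i. 0} else {})"
      by auto
    moreover have "closedin E {\<lambda>i. 0}"
      by (simp add: closedin_Euclidean_space_iff topspace_Euclidean_space)
    ultimately show ?thesis
      by simp
  qed
  ultimately show ?thesis
    unfolding continuous_map_upper_lower_semicontinuous_lte by blast
qed

end

text \<open>Moving along the flow by the quotient of the two gauges carries \<open>K\<close> to \<open>L\<close>; exchanging
  the roles of \<open>K\<close> and \<open>L\<close> gives the inverse.\<close>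

locale two_contracted_bodies = K: contracted_body N \<mu> K + L: contracted_body N \<mu> L
  for N \<mu> K L
begin

definition straighten :: "(nat \<Rightarrow> real) \<Rightarrow> nat \<Rightarrow> real" where
  "straighten x = (if x = (\<lambda>i. 0) then x else dilation \<mu> (L.gauge x / K.gauge x) x)"

lemma straighten_space: "x \<in> topspace K.E \<Longrightarrow> straighten x \<in> topspace K.E"
  by (auto simp: straighten_def dilation_in_Euclidean_space)

lemma gauge_straighten:
  assumes "x \<in> topspace K.E"
  shows "L.gauge (straighten x) = K.gauge x"
proof (cases "x = (\<lambda>i. 0)")
  case True
  then show ?thesis by (simp add: straighten_def K.gauge_zero L.gauge_zero)
next
  case False
  then have "0 < L.gauge x" "0 < K.gauge x"
    using assms K.gauge_pos L.gauge_pos by auto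
  then show ?thesis
    using False assms by (simp add: straighten_def L.gauge_dilation)
qed

lemma straighten_eq_0_iff:
  assumes "x \<in> topspace K.E"
  shows "straighten x = (\<lambda>i. 0) \<longleftrightarrow> x = (\<lambda>i. 0)"
  using gauge_straighten[OF assms] K.gauge_pos[OF assms] L.gauge_zero
  by (metis less_irrefl straighten_def)

lemma continuous_map_straighten: "continuous_map K.E K.E straighten"
proof -
  let ?V = "{x :: nat \<Rightarrow> real. \<forall>i\<ge>N. x i = 0}"
  have V: "topspace K.E = ?V"
    by (simp add: topspace_Euclidean_space)
  have contK: "continuous_on ?V K.gauge" and contL: "continuous_on ?V L.gauge"
    using K.continuous_map_gauge L.continuous_map_gauge
    by (simp_all add: Euclidean_space_eq_top_of_set)
  obtain R where R: "\<And>x i. x \<in> L \<Longrightarrow> \<bar>x i\<bar> \<le> R"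
    using L.coordinates_bounded by blast
  have "continuous_on ?V straighten"
    unfolding continuous_on_def
  proof
    fix x assume x: "x \<in> ?V"
    show "(straighten \<longlongrightarrow> straighten x) (at x within ?V)"
    proof (cases "x = (\<lambda>i. 0)")
      case True
      show ?thesis
      proof (rule tendsto_coordinatewise)
        fix i
        \<comment> \<open>The quotient of gauges has no limit at the origin. Instead the point is
          first moved onto the boundary of \<open>L\<close>, where coordinates are bounded by
          \<open>R\<close>, and then scaled by a power of the gauge of \<open>K\<close>, which tends
          to 0.\<close>
        have bound: "\<bar>straighten y i\<bar> \<le> R * K.gauge y powr \<mu> i" if y: "y \<in> ?V" for y
        proof (cases "y = (\<lambda>i. 0)")
          case True
          then show ?thesis
            by (simp add: straighten_def K.gauge_zero)
        next
          case False
          then have pos: "0 < K.gauge y" "0 < L.gauge y"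
            using y K.gauge_pos L.gauge_pos V by auto
          define z where "z = dilation \<mu> (L.gauge y) y"
          have "z \<in> L"
            using y V pos L.gauge_leD[of y "L.gauge y"] by (simp add: z_def)
          then have "\<bar>z i\<bar> \<le> R"
            using R by blast
          moreover have "straighten y = dilation \<mu> (1 / K.gauge y) z"
            using False pos by (simp add: straighten_def z_def dilation_dilation)
          ultimately show ?thesis
            using pos by (simp add: dilation_def powr_divide abs_mult mult_right_mono)
        qed
        have "((\<lambda>y. R * K.gauge y powr \<mu> i) \<longlongrightarrow> R * K.gauge x powr \<mu> i) (at x within ?V)"
        proof (intro tendsto_mult tendsto_const tendsto_powr')
          show "(K.gauge \<longlongrightarrow> K.gauge x) (at x within ?V)"
            using contK x by (simp add: continuous_on_def)
          have "\<forall>\<^sub>F y in at x within ?V. 0 \<le> K.gauge y"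
            unfolding eventually_at_filter V[symmetric] by (simp add: K.gauge_nonneg)
          then show "K.gauge x \<noteq> 0 \<or> 0 < \<mu> i \<and> (\<forall>\<^sub>F y in at x within ?V. 0 \<le> K.gauge y)"
            using K.exponent_pos by blast
        qed
        then have "((\<lambda>y. R * K.gauge y powr \<mu> i) \<longlongrightarrow> 0) (at x within ?V)"
          by (simp add: True K.gauge_zero)
        then have "((\<lambda>y. straighten y i) \<longlongrightarrow> 0) (at x within ?V)"
          by (rule Lim_null_comparison[rotated]) (auto simp: eventually_at_filter bound)
        then show "((\<lambda>y. straighten y i) \<longlongrightarrow> straighten x i) (at x within ?V)"
          by (simp add: True straighten_def)
      qed
    next
      case False
      let ?W = "?V - {\<lambda>i. 0}"
      have pos: "0 < K.gauge y" "0 < L.gauge y" if "y \<in> ?W" for y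
        using that K.gauge_pos[of y] L.gauge_pos[of y] by (auto simp: V)
      have "continuous_on ?W (\<lambda>x. dilation \<mu> (L.gauge x / K.gauge x) x)"
      proof (rule continuous_on_dilation)
        show "continuous_on ?W (\<lambda>x. L.gauge x / K.gauge x)"
        proof (intro continuous_on_divide ballI)
          show "continuous_on ?W K.gauge" "continuous_on ?W L.gauge"
            by (rule continuous_on_subset[OF contK], blast) (rule continuous_on_subset[OF contL], blast)
          show "K.gauge y \<noteq> 0" if "y \<in> ?W" for y
            using pos[OF that] by simp
        qed
        show "continuous_on ?W (\<lambda>x. x)"
          by simp
        show "0 < L.gauge y / K.gauge y" if "y \<in> ?W" for y
          using pos[OF that] by simp
      qed
      then have "continuous_on ?W straighten"
        by (rule continuous_on_eq) (simp add: straighten_def)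
      then have "(straighten \<longlongrightarrow> straighten x) (at x within ?W)"
        using x False by (simp add: continuous_on_def)
      moreover have "at x within ?W = at x within ?V"
      proof -
        have "open (- {\<lambda>i::nat. 0::real})"
          by (simp add: open_Compl)
        moreover have "x \<in> - {\<lambda>i::nat. 0::real}"
          using False by simp
        ultimately show ?thesis
          by (intro at_within_nhd[of _ "- {\<lambda>i. 0}"]) auto
      qed
      ultimately show ?thesis
        by simp
    qed
  qed
  then show ?thesis
    using straighten_space unfolding Euclidean_space_eq_top_of_set continuous_map_in_subtopology
    by auto
qed

end

sublocale two_contracted_bodies \<subseteq> swap: two_contracted_bodies N \<mu> L K
  by unfold_locales

context two_contracted_bodies begin

lemma swap_straighten:
  assumes "x \<in> topspace K.E"
  shows "swap.straighten (straighten x) = x"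
proof (cases "x = (\<lambda>i. 0)")
  case True
  then show ?thesis by (simp add: straighten_def swap.straighten_def)
next
  case False
  then have "0 < L.gauge x" "0 < K.gauge x"
    using assms K.gauge_pos L.gauge_pos by auto
  then show ?thesis
    using False assms straighten_eq_0_iff[OF assms] gauge_straighten[OF assms]
    by (simp add: straighten_def swap.straighten_def K.gauge_dilation dilation_dilation)
qed

end

context two_contracted_bodies begin

lemma homeomorphic_map_straighten: "homeomorphic_map K.E K.E straighten"
  unfolding homeomorphic_map_maps homeomorphic_maps_def
  using continuous_map_straighten swap.continuous_map_straighten swap_straighten swap.swap_straighten
  by blast

lemma straighten_in_iff: "x \<in> topspace K.E \<Longrightarrow> straighten x \<in> L \<longleftrightarrow> x \<in> K"
  using K.gauge_le_iff[of x 1] L.gauge_le_iff[of "straighten x" 1] gauge_straighten straighten_space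
  by simp

lemma straighten_in_interior_iff:
  "x \<in> topspace K.E \<Longrightarrow> straighten x \<in> L.I \<longleftrightarrow> x \<in> K.I"
  using K.gauge_less_iff[of x 1] L.gauge_less_iff[of "straighten x" 1] gauge_straighten straighten_space
  by simp

end

section \<open>Comparison with the round ball\<close>

context contracted_body begin

text \<open>A weighted dilation with \<open>r > 1\<close> shrinks every nonzero coordinate, so the
  round ball is contracted for any choice of exponents and can serve as the second body.\<close>

lemma unit_ball:
  defines "B \<equiv> {x \<in> topspace E. (\<Sum>i<N. (x i)\<^sup>2) \<le> 1}"
    and "S \<equiv> {x \<in> topspace E. (\<Sum>i<N. (x i)\<^sup>2) < 1}"
  shows "contracted_body N \<mu> B" and "E interior_of B = S"
proof -
  let ?q = "\<lambda>x :: nat \<Rightarrow> real. \<Sum>i<N. (x i)\<^sup>2"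
  have cont: "continuous_on A ?q" for A
    by (intro continuous_intros continuous_on_subset[OF continuous_on_product_coordinates]) auto
  have "closed {x. ?q x \<le> 1}"
    by (intro closed_Collect_le cont continuous_on_const)
  moreover have "closed (topspace E)"
    using closedin_Euclidean_space_iff by blast
  ultimately have "closed B"
    unfolding B_def by (simp add: Collect_conj_eq closed_Int)
  moreover have "B \<subseteq> (\<Pi>\<^sub>E i\<in>UNIV. {-1..1})"
  proof
    fix x assume x: "x \<in> B"
    have "\<bar>x i\<bar> \<le> 1" for i
    proof (cases "i < N")
      case True
      then have "(x i)\<^sup>2 \<le> ?q x"
        by (intro member_le_sum) auto
      then show ?thesis
        using x abs_square_le_1[of "x i"] by (simp add: B_def)
    qed (use x in \<open>simp add: B_def topspace_Euclidean_space\<close>)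
    then show "x \<in> (\<Pi>\<^sub>E i\<in>UNIV. {-1..1})"
      by (auto simp: abs_le_iff minus_le_iff)
  qed
  moreover have "compact (\<Pi>\<^sub>E i\<in>(UNIV :: nat set). {-1..1::real})"
    using compactin_PiE[of "\<lambda>_::nat. euclideanreal" UNIV "\<lambda>_. {-1..1}"]
    by (simp add: euclidean_product_topology)
  ultimately have "compact B"
    using compact_Int_closed[of "\<Pi>\<^sub>E i\<in>(UNIV :: nat set). {-1..1::real}" B]
    by (simp add: inf.absorb2)
  then have compactin: "compactin E B"
    unfolding Euclidean_space_eq_top_of_set compactin_subtopology
    by (auto simp: B_def topspace_Euclidean_space)
  have "open {x. ?q x < 1}"
    by (intro open_Collect_less cont continuous_on_const)
  then have "openin E S"
    unfolding Euclidean_space_eq_top_of_set openin_open S_def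
    by (intro exI[of _ "{x. ?q x < 1}"]) (auto simp: topspace_Euclidean_space)
  then have sub: "S \<subseteq> E interior_of B"
    by (intro interior_of_maximal) (auto simp: S_def B_def)
  have less: "dilation \<mu> r x \<in> S" if x: "x \<in> B" and r: "1 < r" for r x
  proof -
    have pw: "1 < r powr \<mu> i" for i
      using r exponent_pos[of i] by simp
    have le: "(dilation \<mu> r x i)\<^sup>2 \<le> (x i)\<^sup>2"
      and lt: "x i \<noteq> 0 \<Longrightarrow> (dilation \<mu> r x i)\<^sup>2 < (x i)\<^sup>2" for i
    proof -
      have "1 < (r powr \<mu> i)\<^sup>2"
        using pw[of i] by (simp add: one_less_power)
      then show "(dilation \<mu> r x i)\<^sup>2 \<le> (x i)\<^sup>2"
        and "x i \<noteq> 0 \<Longrightarrow> (dilation \<mu> r x i)\<^sup>2 < (x i)\<^sup>2"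
        using mult_left_mono[of 1 "(r powr \<mu> i)\<^sup>2" "(x i)\<^sup>2"]
          mult_strict_left_mono[of 1 "(r powr \<mu> i)\<^sup>2" "(x i)\<^sup>2"]
        by (auto simp: dilation_def power_divide divide_le_eq divide_less_eq)
    qed
    have "?q (dilation \<mu> r x) < 1"
    proof (cases "\<exists>i<N. x i \<noteq> 0")
      case True
      then obtain i where "i < N" "x i \<noteq> 0"
        by blast
      then have "?q (dilation \<mu> r x) < ?q x"
        using le lt by (intro sum_strict_mono_ex1) auto
      then show ?thesis
        using x by (simp add: B_def)
    next
      case False
      then show ?thesis
        by (simp add: dilation_def)
    qed
    then show ?thesis
      using x by (simp add: S_def B_def dilation_in_Euclidean_space)
  qed
  have "(\<lambda>i. 0) \<in> B"
    by (simp add: B_def topspace_Euclidean_space)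
  then show body: "contracted_body N \<mu> B"
    using compactin exponent_pos less sub by unfold_locales auto
  interpret B: contracted_body N \<mu> B
    by (rule body)
  show "E interior_of B = S"
  proof
    show "E interior_of B \<subseteq> S"
    proof
      fix x assume x: "x \<in> E interior_of B"
      then have xE: "x \<in> topspace E"
        using interior_of_subset_topspace[of E B] by blast
      then have "B.gauge x < 1"
        using B.gauge_less_iff[of x 1] x by simp
      \<comment> \<open>An interior point is the image of a point of \<open>B\<close> under the
        dilation by \<open>1 / s > 1\<close>, hence has norm below 1.\<close>
      then obtain s where s: "B.gauge x < s" "s < 1"
        using dense by blast
      then have "0 < s"
        using B.gauge_nonneg[OF xE] by simp
      then have "dilation \<mu> s x \<in> B"
        using B.gauge_lessD[OF xE s(1)] B.interior_subset by blast
      from less[OF this, of "1 / s"] show "x \<in> S"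
        using s \<open>0 < s\<close> by (simp add: dilation_dilation)
    qed
  qed (rule sub)
qed

text \<open>\<open>straighten\<close> turns the gauge of \<open>K\<close> into that of the ball, so
  it matches the sets where the gauge is at most 1, below 1 and equal to 1.\<close>

theorem ball_in_Euclidean_space: "ball_in E N K"
proof -
  define B where "B = {x \<in> topspace E. (\<Sum>i<N. (x i)\<^sup>2) \<le> 1}"
  interpret two_contracted_bodies N \<mu> K B
    unfolding two_contracted_bodies_def B_def
    using unit_ball(1) contracted_body_axioms by blast
  have intB: "E interior_of B = {x \<in> topspace E. (\<Sum>i<N. (x i)\<^sup>2) < 1}"
    using unit_ball(2) by (simp add: B_def)
  have fr: "E frontier_of K = K - I"
    by (simp add: frontier_of_def closure_of_closedin[OF closedin])
  have 1: "homeomorphic_map (subtopology E S) (subtopology E T) straighten"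
    if "\<And>x. x \<in> topspace E \<Longrightarrow> straighten x \<in> T \<longleftrightarrow> x \<in> S" for S T
    by (rule homeomorphic_map_subtopologies_alt[OF homeomorphic_map_straighten])
      (use that in blast)
  show ?thesis
    unfolding ball_in_def closed_ball_top_def open_ball_top_def unit_sphere_top_def fr
  proof (intro conjI homeomorphic_map_imp_homeomorphic_space[OF 1])
    fix x assume x: "x \<in> topspace E"
    then have s: "straighten x \<in> topspace E"
      by (rule straighten_space)
    show "straighten x \<in> {x. (\<Sum>i<N. (x i)\<^sup>2) \<le> 1} \<longleftrightarrow> x \<in> K"
      using straighten_in_iff[OF x] s by (simp add: B_def)
    show "straighten x \<in> {x. (\<Sum>i<N. (x i)\<^sup>2) < 1} \<longleftrightarrow> x \<in> I"
      using straighten_in_interior_iff[OF x] s by (simp add: intB)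
    show "straighten x \<in> {x. (\<Sum>i<N. (x i)\<^sup>2) = 1} \<longleftrightarrow> x \<in> K - I"
      using straighten_in_interior_iff[OF x] straighten_in_iff[OF x] s
      by (auto simp: intB) (auto simp: B_def)
  qed
qed

end

section \<open>Minors indexed by tuples of rows\<close>

text \<open>The row tuple may be unsorted or repeat entries, so that a single row index can be
  replaced freely, as in the derivative of a minor. The columns are always the first
  \<open>k\<close>.\<close>

definition minor :: "nat \<Rightarrow> (nat \<Rightarrow> nat \<Rightarrow> 'a :: comm_ring_1) \<Rightarrow> (nat \<Rightarrow> nat) \<Rightarrow> 'a" where
  "minor k Y f = det (mat k k (\<lambda>(i, j). Y (f i) j))"

text \<open>Extensional functions, so that each \<open>k\<close>-subset is represented exactly once
  and equality of tuples is equality of sets.\<close>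

definition increasing :: "nat \<Rightarrow> nat \<Rightarrow> (nat \<Rightarrow> nat) set" where
  "increasing k n = {f \<in> {..<k} \<rightarrow>\<^sub>E {..<n}. strict_mono_on {..<k} f}"

lemma det_mat_leibniz:
  "det (mat k k (\<lambda>(i, j). A i j)) =
     (\<Sum>p | p permutes {..<k}. signof p * (\<Prod>i<k. A i (p i)))"
proof -
  have "(\<Prod>i = 0..<k. mat k k (\<lambda>(i, j). A i j) $$ (i, p i)) = (\<Prod>i<k. A i (p i))"
    if "p permutes {0..<k}" for p
    using permutes_in_image[OF that] by (auto intro!: prod.cong simp: atLeast0LessThan)
  then show ?thesis
    by (subst det_def'[where n = k]) (auto intro!: sum.cong simp: atLeast0LessThan)
qed

lemma minor_leibniz:
  "minor k Y f = (\<Sum>p | p permutes {..<k}. signof p * (\<Prod>i<k. Y (f i) (p i)))"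
  unfolding minor_def by (rule det_mat_leibniz)

lemma minor_cong:
  assumes "\<And>i j. i < k \<Longrightarrow> j < k \<Longrightarrow> Y (f i) j = Y' (f' i) j"
  shows "minor k Y f = minor k Y' f'"
  unfolding minor_def by (rule arg_cong[of _ _ det]) (auto simp: assms)

lemma minor_permute:
  assumes "p permutes {..<k}"
  shows "minor k Y (\<lambda>i. f (p i)) = signof p * minor k Y f"
proof -
  have p: "p permutes {0..<k}"
    using assms by (simp add: atLeast0LessThan)
  have "mat k k (\<lambda>(i, j). Y (f (p i)) j) =
        mat k k (\<lambda>(i, j). mat k k (\<lambda>(i, j). Y (f i) j) $$ (p i, j))"
    using permutes_in_image[OF p] by (intro eq_matI) auto
  then show ?thesis
    unfolding minor_def by (simp add: det_permute_rows[OF _ p])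
qed

lemma minor_not_inj:
  assumes "\<not> inj_on f {..<k}"
  shows "minor k Y f = 0"
proof -
  obtain i j where "i < k" "j < k" "i \<noteq> j" "f i = f j"
    using assms by (auto simp: inj_on_def)
  then show ?thesis
    unfolding minor_def by (intro det_identical_rows[of _ k i j]) (auto intro!: eq_vecI)
qed

lemma minor_mult:
  "minor k (\<lambda>a j. \<Sum>l<k. Y a l * G l j) f = minor k Y f * det (mat k k (\<lambda>(i, j). G i j))"
proof -
  have "mat k k (\<lambda>(i, j). \<Sum>l<k. Y (f i) l * G l j) =
        mat k k (\<lambda>(i, j). Y (f i) j) * mat k k (\<lambda>(i, j). G i j)"
    by (intro eq_matI) (auto simp: scalar_prod_def atLeast0LessThan)
  then show ?thesis
    unfolding minor_def by (simp add: det_mult[of _ k])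
qed

lemma minor_scale_columns:
  "minor k (\<lambda>a j. Y a j * c j) f = minor k Y f * (\<Prod>j<k. c j)"
proof -
  have "(\<Prod>i<k. c (p i)) = (\<Prod>j<k. c j)" if "p permutes {..<k}" for p
    using prod.permute[OF that, of c] by (simp add: o_def)
  then show ?thesis
    unfolding minor_leibniz sum_distrib_right by (intro sum.cong) (auto simp: prod.distrib)
qed

text \<open>Row index \<open>k\<close> stands for the extra row \<open>x\<close>. This reads single
  chart coordinates off as Pluecker coordinates.\<close>

lemma minor_replace_row_identity:
  assumes "i < k"
  shows "minor k (\<lambda>a j. if a < k then of_bool (a = j) else x j) (\<lambda>r. if r = i then k else r) = x i"
proof -
  let ?M = "mat k k (\<lambda>(r, j). if r = i then x j else of_bool (r = j))"
  have "minor k (\<lambda>a j. if a < k then of_bool (a = j) else x j) (\<lambda>r. if r = i then k else r) = det ?M"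
    unfolding minor_def by (rule arg_cong[of _ _ det]) (auto intro!: eq_matI)
  also have "\<dots> = (\<Sum>j<k. ?M $$ (i, j) * cofactor ?M i j)"
    by (rule laplace_expansion_row) (auto simp: assms)
  also have "\<dots> = (\<Sum>j<k. x j * of_bool (i = j))"
  proof (rule sum.cong[OF refl])
    fix j assume "j \<in> {..<k}"
    then have j: "j < k" by simp
    have "cofactor ?M i j = of_bool (i = j)"
    proof (cases "i = j")
      case True
      have "mat_delete ?M i i = 1\<^sub>m (k - 1)"
        using assms by (intro eq_matI) (auto simp: mat_delete_def)
      then show ?thesis
        using True by (simp add: cofactor_def)
    next
      case False
      define r where "r = (if j < i then j else j - 1)"
      have r: "r < k - 1" "(if r < i then r else Suc r) = j"
        using False j assms by (auto simp: r_def)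
      have "mat_delete ?M i j $$ (r, c) = 0" if "c < k - 1" for c
        using r False assms that by (auto simp: mat_delete_def split: if_splits)
      then have "det (mat_delete ?M i j) = 0"
        using r by (subst laplace_expansion_row[of _ "k - 1" r]) (auto simp: mat_delete_def)
      then show ?thesis
        using False by (simp add: cofactor_def)
    qed
    then show "?M $$ (i, j) * cofactor ?M i j = x j * of_bool (i = j)"
      using assms j by simp
  qed
  also have "\<dots> = x i"
    using assms by (simp add: of_bool_def if_distrib cong: if_cong)
  finally show ?thesis .
qed

text \<open>Summing over all tuples rather than over sets of rows costs a factor \<open>k!\<close> but needs no
  sorting.\<close>

theorem cauchy_binet:
  fixes A B :: "nat \<Rightarrow> nat \<Rightarrow> 'a :: {comm_ring_1, ring_char_0}"
  shows "(\<Sum>f \<in> {..<k} \<rightarrow>\<^sub>E {..<n}. minor k A f * minor k B f) =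
     fact k * det (mat k k (\<lambda>(i, j). \<Sum>l<n. A l i * B l j))"
proof -
  let ?F = "{..<k} \<rightarrow>\<^sub>E {..<n}" and ?S = "{p. p permutes {..<k}}"
  have expand: "det (mat k k (\<lambda>(i, j). \<Sum>l<n. A l i * B l j)) =
      (\<Sum>f\<in>?F. (\<Prod>i<k. A (f i) i) * minor k B f)"
  proof -
    have "(\<Prod>i<k. \<Sum>l<n. A l i * B l (p i)) = (\<Sum>f\<in>?F. (\<Prod>i<k. A (f i) i) * (\<Prod>i<k. B (f i) (p i)))" for p
      by (subst prod_sum_PiE) (auto simp: prod.distrib)
    then have "det (mat k k (\<lambda>(i, j). \<Sum>l<n. A l i * B l j)) =
        (\<Sum>p\<in>?S. \<Sum>f\<in>?F. signof p * ((\<Prod>i<k. A (f i) i) * (\<Prod>i<k. B (f i) (p i))))"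
      by (simp add: det_mat_leibniz sum_distrib_left)
    also have "\<dots> = (\<Sum>f\<in>?F. (\<Prod>i<k. A (f i) i) * minor k B f)"
      by (subst sum.swap) (simp add: minor_leibniz sum_distrib_left ac_simps)
    finally show ?thesis .
  qed
  have "(\<Sum>f\<in>?F. minor k A f * minor k B f) =
        (\<Sum>p\<in>?S. \<Sum>f\<in>?F. signof p * (\<Prod>i<k. A (f i) (p i)) * minor k B f)"
    by (subst sum.swap) (simp add: minor_leibniz[of k A] sum_distrib_right)
  \<comment> \<open>Every permutation contributes the same amount: composing the tuple with the
    inverse of \<open>p\<close> moves \<open>p\<close> out of the first factor, and the sign
    produced by the second minor cancels \<open>signof p\<close>.\<close>
  also have "\<dots> = (\<Sum>p\<in>?S. \<Sum>f\<in>?F. (\<Prod>i<k. A (f i) i) * minor k B f)"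
  proof (rule sum.cong[OF refl])
    fix p assume "p \<in> ?S"
    then have p: "p permutes {..<k}"
      by simp
    then have ip: "Hilbert_Choice.inv p permutes {..<k}"
      by (rule permutes_inv)
    have comp: "(\<lambda>f. restrict (\<lambda>i. f (q i)) {..<k}) \<in> ?F \<rightarrow> ?F" if "q permutes {..<k}" for q
      using permutes_in_image[OF that] by (auto simp: PiE_iff)
    show "(\<Sum>f\<in>?F. signof p * (\<Prod>i<k. A (f i) (p i)) * minor k B f) =
          (\<Sum>f\<in>?F. (\<Prod>i<k. A (f i) i) * minor k B f)"
    proof (rule sum.reindex_bij_witness[where
          i = "\<lambda>f. restrict (\<lambda>i. f (p i)) {..<k}" and j = "\<lambda>f. restrict (\<lambda>i. f (Hilbert_Choice.inv p i)) {..<k}"])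
      fix f assume f: "f \<in> ?F"
      show "restrict (\<lambda>i. f (Hilbert_Choice.inv p i)) {..<k} \<in> ?F" "restrict (\<lambda>i. f (p i)) {..<k} \<in> ?F"
        using funcset_mem[OF comp[OF ip] f] funcset_mem[OF comp[OF p] f] by blast+
      have lt: "p i < k \<longleftrightarrow> i < k" "Hilbert_Choice.inv p i < k \<longleftrightarrow> i < k" for i
        using permutes_in_image[OF p, of i] permutes_in_image[OF ip, of i] by auto
      show "restrict (\<lambda>i. restrict (\<lambda>i. f (Hilbert_Choice.inv p i)) {..<k} (p i)) {..<k} = f"
        "restrict (\<lambda>i. restrict (\<lambda>i. f (p i)) {..<k} (Hilbert_Choice.inv p i)) {..<k} = f"
        using f lt permutes_inverses[OF p] by (auto simp: fun_eq_iff PiE_iff extensional_def)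
      have "minor k B (restrict (\<lambda>i. f (Hilbert_Choice.inv p i)) {..<k}) = minor k B (\<lambda>i. f (Hilbert_Choice.inv p i))"
        by (rule minor_cong) auto
      also have "\<dots> = signof p * minor k B f"
        using minor_permute[OF ip, of B f] sign_inverse[of p] p
        by (simp add: permutation_permutes[of p] exI[of _ "{..<k}"] )
      moreover have "(\<Prod>i<k. A (restrict (\<lambda>i. f (Hilbert_Choice.inv p i)) {..<k} i) i) = (\<Prod>i<k. A (f i) (p i))"
      proof -
        have "(\<Prod>i<k. A (restrict (\<lambda>i. f (Hilbert_Choice.inv p i)) {..<k} i) i) = (\<Prod>i<k. A (f (Hilbert_Choice.inv p i)) i)"
          by (rule prod.cong) auto
        also have "\<dots> = (\<Prod>i<k. A (f (Hilbert_Choice.inv p (p i))) (p i))"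
          using prod.permute[OF p, of "\<lambda>i. A (f (Hilbert_Choice.inv p i)) i"] by (simp add: o_def)
        finally show ?thesis
          by (simp add: permutes_inverses[OF p])
      qed
      ultimately show "(\<Prod>i<k. A (restrict (\<lambda>i. f (Hilbert_Choice.inv p i)) {..<k} i) i) *
            minor k B (restrict (\<lambda>i. f (Hilbert_Choice.inv p i)) {..<k}) =
          signof p * (\<Prod>i<k. A (f i) (p i)) * minor k B f"
        by (simp add: ac_simps)
    qed
  qed
  also have "\<dots> = fact k * det (mat k k (\<lambda>(i, j). \<Sum>l<n. A l i * B l j))"
    by (simp add: expand card_permutations)
  finally show ?thesis .
qed

lemma finite_increasing: "finite (increasing k n)"
  unfolding increasing_def by (intro finite_subset[OF _ finite_PiE[of "{..<k}" "\<lambda>_. {..<n}"]]) auto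

lemma increasing_subset: "increasing k n \<subseteq> {..<k} \<rightarrow>\<^sub>E {..<n}"
  by (auto simp: increasing_def)

text \<open>One permutation serves all matrices at once, so in a product of two minors at the same
  tuple the sign appears squared.\<close>

lemma sort_tuple:
  assumes f: "f \<in> {..<k} \<rightarrow>\<^sub>E {..<n}" and inj: "inj_on f {..<k}"
  shows "\<exists>g p. g \<in> increasing k n \<and> p permutes {..<k} \<and> g ` {..<k} = f ` {..<k} \<and>
    (\<forall>Y :: nat \<Rightarrow> nat \<Rightarrow> 'a :: comm_ring_1. minor k Y f = signof p * minor k Y g)"
proof -
  let ?I = "f ` {..<k}"
  have card: "card ?I = k"
    using inj by (simp add: card_image)
  define xs where "xs = sorted_list_of_set ?I"
  have xs: "set xs = ?I" "length xs = k" "sorted_wrt (<) xs"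
    using card by (auto simp: xs_def length_sorted_list_of_set)
  define g where "g = restrict (\<lambda>i. xs ! i) {..<k}"
  have g_im: "g ` {..<k} = ?I"
    using xs by (auto simp: g_def set_conv_nth image_iff)
  have mono: "strict_mono_on {..<k} g"
    using xs by (auto simp: g_def strict_mono_on_def sorted_wrt_nth_less)
  have g: "g \<in> increasing k n"
  proof -
    have "g i < n" if "i < k" for i
    proof -
      have "g i \<in> ?I"
        using that g_im by blast
      then show ?thesis
        using f by (auto simp: PiE_iff)
    qed
    then show ?thesis
      using mono by (auto simp: increasing_def PiE_iff g_def)
  qed
  have ginj: "inj_on g {..<k}"
    using mono by (rule strict_mono_on_imp_inj_on)
  define p where "p i = (if i < k then inv_into {..<k} g (f i) else i)" for i
  have gp: "g (p i) = f i" "p i < k" if "i < k" for i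
  proof -
    have "f i \<in> g ` {..<k}"
      using that g_im by blast
    then show "g (p i) = f i" "p i < k"
      using that inv_into_into[of "f i" g "{..<k}"] by (auto simp: p_def f_inv_into_f)
  qed
  have "inj_on p {..<k}"
  proof (rule inj_onI)
    fix i j assume "i \<in> {..<k}" "j \<in> {..<k}" "p i = p j"
    then show "i = j"
      using gp(1)[of i] gp(1)[of j] inj by (auto simp: inj_on_def)
  qed
  then have "bij_betw p {..<k} {..<k}"
    using gp(2) endo_inj_surj[of "{..<k}" p] by (auto simp: bij_betw_def)
  then have p: "p permutes {..<k}"
    by (rule bij_imp_permutes) (auto simp: p_def)
  have "minor k Y f = signof p * minor k Y g" for Y :: "nat \<Rightarrow> nat \<Rightarrow> 'a"
    using minor_permute[OF p, of Y g] minor_cong[of k Y f Y "\<lambda>i. g (p i)"] gp by auto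
  then show ?thesis
    using g p g_im by blast
qed

lemma minor_mult_nonneg:
  fixes A B :: "nat \<Rightarrow> nat \<Rightarrow> real"
  assumes "\<And>g. g \<in> increasing k n \<Longrightarrow> 0 \<le> minor k A g * minor k B g"
    and f: "f \<in> {..<k} \<rightarrow>\<^sub>E {..<n}"
  shows "0 \<le> minor k A f * minor k B f"
proof (cases "inj_on f {..<k}")
  case True
  obtain g p where g: "g \<in> increasing k n" "p permutes {..<k}"
      "\<And>Y :: nat \<Rightarrow> nat \<Rightarrow> real. minor k Y f = signof p * minor k Y g"
    using sort_tuple[OF f True, where 'a = real] by blast
  have "minor k A f * minor k B f = minor k A g * minor k B g"
    by (simp add: g(3) sign_def)
  then show ?thesis
    using assms(1) g(1) by simp
qed (simp add: minor_not_inj)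

lemma nonzero_minor_increasing:
  fixes A :: "nat \<Rightarrow> nat \<Rightarrow> real"
  assumes f: "f \<in> {..<k} \<rightarrow>\<^sub>E {..<n}" and nz: "minor k A f \<noteq> 0"
  shows "\<exists>g\<in>increasing k n. minor k A g \<noteq> 0"
proof -
  have "inj_on f {..<k}"
    using minor_not_inj nz by blast
  then obtain g p where g: "g \<in> increasing k n" "p permutes {..<k}"
      "\<And>Y :: nat \<Rightarrow> nat \<Rightarrow> real. minor k Y f = signof p * minor k Y g"
    using sort_tuple[OF f, where 'a = real] by blast
  then have "minor k A g \<noteq> 0"
    using nz by auto
  then show ?thesis
    using g(1) by blast
qed

text \<open>Cauchy-Binet: a nonzero sum has a nonzero term.\<close>

lemma nonzero_gram_imp_nonzero_minor:
  fixes A B :: "nat \<Rightarrow> nat \<Rightarrow> real"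
  assumes "det (mat k k (\<lambda>(i, j). \<Sum>l<n. A l i * B l j)) \<noteq> 0"
  shows "\<exists>g\<in>increasing k n. minor k B g \<noteq> 0"
proof -
  have "(\<Sum>f \<in> {..<k} \<rightarrow>\<^sub>E {..<n}. minor k A f * minor k B f) \<noteq> 0"
    unfolding cauchy_binet using assms by simp
  then have "\<not> (\<forall>f \<in> {..<k} \<rightarrow>\<^sub>E {..<n}. minor k A f * minor k B f = 0)"
    by (rule contrapos_nn) (rule sum.neutral)
  then obtain f where "f \<in> {..<k} \<rightarrow>\<^sub>E {..<n}" "minor k B f \<noteq> 0"
    by auto
  then show ?thesis
    by (rule nonzero_minor_increasing)
qed

text \<open>Without cancellation the Cauchy-Binet sum dominates each of its terms. Read one way this
  bounds minors, read the other way it shows that a Gram determinant is nonzero.\<close>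

lemma cauchy_binet_ge:
  fixes A B :: "nat \<Rightarrow> nat \<Rightarrow> real"
  assumes "\<And>g. g \<in> increasing k n \<Longrightarrow> 0 \<le> minor k A g * minor k B g"
    and f: "f \<in> {..<k} \<rightarrow>\<^sub>E {..<n}"
  shows "minor k A f * minor k B f \<le> fact k * det (mat k k (\<lambda>(i, j). \<Sum>l<n. A l i * B l j))"
  unfolding cauchy_binet[symmetric]
proof (rule member_le_sum[OF f])
  show "0 \<le> minor k A h * minor k B h" if "h \<in> ({..<k} \<rightarrow>\<^sub>E {..<n}) - {f}" for h
    by (rule minor_mult_nonneg[of k n A B h, OF assms(1)]) (use that in auto)
  show "finite ({..<k} \<rightarrow>\<^sub>E {..<n})"
    by (simp add: finite_PiE)
qed

lemma tendsto_minor: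
  fixes Y :: "'b \<Rightarrow> nat \<Rightarrow> nat \<Rightarrow> 'a :: {real_normed_field}"
  assumes "\<And>i j. i < k \<Longrightarrow> j < k \<Longrightarrow> ((\<lambda>t. Y t (f i) j) \<longlongrightarrow> Z (f i) j) F"
  shows "((\<lambda>t. minor k (Y t) f) \<longlongrightarrow> minor k Z f) F"
  unfolding minor_leibniz
proof (rule tendsto_sum, rule tendsto_mult_left, rule tendsto_prod)
  fix p i assume "p \<in> {p. p permutes {..<k}}" "i \<in> {..<k}"
  then show "((\<lambda>t. Y t (f i) (p i)) \<longlongrightarrow> Z (f i) (p i)) F"
    using permutes_in_image[of p "{..<k}" i] by (intro assms) auto
qed

lemma det_nonzero_inverse:
  fixes A :: "nat \<Rightarrow> nat \<Rightarrow> 'a :: field"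
  assumes "det (mat k k (\<lambda>(i, j). A i j)) \<noteq> 0"
  shows "\<exists>B. (\<forall>i<k. \<forall>j<k. (\<Sum>l<k. A i l * B l j) = of_bool (i = j)) \<and>
             (\<forall>i<k. \<forall>j<k. (\<Sum>l<k. B i l * A l j) = of_bool (i = j))"
proof -
  let ?A = "mat k k (\<lambda>(i, j). A i j)"
  have "?A \<in> Units (ring_mat TYPE('a) k ())"
    using assms by (intro det_non_zero_imp_unit) auto
  then obtain B where B: "B \<in> carrier_mat k k" "?A * B = 1\<^sub>m k" "B * ?A = 1\<^sub>m k"
    by (auto simp: Units_def ring_mat_def)
  have "(\<Sum>l<k. A i l * B $$ (l, j)) = of_bool (i = j)" "(\<Sum>l<k. B $$ (i, l) * A l j) = of_bool (i = j)"
    if "i < k" "j < k" for i j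
    using arg_cong[OF B(2), of "\<lambda>M. M $$ (i, j)"] arg_cong[OF B(3), of "\<lambda>M. M $$ (i, j)"] that B(1)
    by (auto simp: scalar_prod_def atLeast0LessThan)
  then show ?thesis
    by (intro exI[of _ "\<lambda>i j. B $$ (i, j)"]) auto
qed

text \<open>Product rule row by row: the derivative of a row is a combination of rows of the same
  matrix, so each term is again a minor, with one row index exchanged.\<close>

lemma has_real_derivative_minor:
  fixes Y :: "real \<Rightarrow> nat \<Rightarrow> nat \<Rightarrow> real"
  assumes deriv: "\<And>a j. a < n \<Longrightarrow> ((\<lambda>t. Y t a j) has_real_derivative (\<Sum>b<n. M a b * Y t b j)) (at t)"
    and f: "\<And>i. i < k \<Longrightarrow> f i < n"
  shows "((\<lambda>t. minor k (Y t) f) has_real_derivative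
    (\<Sum>i<k. \<Sum>b<n. M (f i) b * minor k (Y t) (f(i := b)))) (at t)"
proof -
  let ?S = "{p. p permutes {..<k}}"
  have prod: "((\<lambda>t. \<Prod>i<k. Y t (f i) (p i)) has_real_derivative
      (\<Sum>i<k. \<Sum>b<n. M (f i) b * (\<Prod>r<k. Y t ((f(i := b)) r) (p r)))) (at t)" for p
  proof -
    have "((\<lambda>t. \<Prod>i<k. Y t (f i) (p i)) has_real_derivative
      (\<Sum>i<k. (\<Sum>b<n. M (f i) b * Y t b (p i)) * (\<Prod>r\<in>{..<k} - {i}. Y t (f r) (p r)))) (at t)"
      by (rule has_field_derivative_prod, rule deriv, rule f, simp)
    moreover have "(\<Sum>b<n. M (f i) b * Y t b (p i)) * (\<Prod>r\<in>{..<k} - {i}. Y t (f r) (p r)) =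
        (\<Sum>b<n. M (f i) b * (\<Prod>r<k. Y t ((f(i := b)) r) (p r)))" if "i < k" for i
    proof -
      have "(\<Prod>r<k. Y t ((f(i := b)) r) (p r)) =
          Y t b (p i) * (\<Prod>r\<in>{..<k} - {i}. Y t (f r) (p r))" for b
        using that by (subst prod.remove[of _ i]) (auto intro!: prod.cong)
      then show ?thesis
        by (simp add: sum_distrib_right mult.assoc)
    qed
    ultimately show ?thesis
      by simp
  qed
  have "((\<lambda>t. minor k (Y t) f) has_real_derivative
      (\<Sum>p\<in>?S. signof p * (\<Sum>i<k. \<Sum>b<n. M (f i) b * (\<Prod>r<k. Y t ((f(i := b)) r) (p r))))) (at t)"
    unfolding minor_leibniz by (rule DERIV_sum, rule DERIV_cmult, rule prod)
  also have "(\<Sum>p\<in>?S. signof p * (\<Sum>i<k. \<Sum>b<n. M (f i) b * (\<Prod>r<k. Y t ((f(i := b)) r) (p r)))) =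
      (\<Sum>i<k. \<Sum>b<n. M (f i) b * minor k (Y t) (f(i := b)))"
  proof -
    let ?X = "\<lambda>p i b. signof p * (\<Prod>r<k. Y t ((f(i := b)) r) (p r)) :: real"
    have "(\<Sum>p\<in>?S. signof p * (\<Sum>i<k. \<Sum>b<n. M (f i) b * (\<Prod>r<k. Y t ((f(i := b)) r) (p r)))) =
        (\<Sum>p\<in>?S. \<Sum>i<k. \<Sum>b<n. M (f i) b * ?X p i b)"
      by (simp only: sum_distrib_left mult.left_commute)
    also have "\<dots> = (\<Sum>i<k. \<Sum>p\<in>?S. \<Sum>b<n. M (f i) b * ?X p i b)"
      by (rule sum.swap)
    also have "\<dots> = (\<Sum>i<k. \<Sum>b<n. \<Sum>p\<in>?S. M (f i) b * ?X p i b)"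
      by (rule sum.cong[OF refl sum.swap])
    also have "\<dots> = (\<Sum>i<k. \<Sum>b<n. M (f i) b * minor k (Y t) (f(i := b)))"
      by (simp add: minor_leibniz sum_distrib_left del: fun_upd_apply)
    finally show ?thesis .
  qed
  finally show ?thesis .
qed

section \<open>Cooperative linear systems\<close>

text \<open>Nonnegative off-diagonal coefficients keep the orthant invariant in forward time; the
  diagonal may have any sign.\<close>

locale cooperative_system =
  fixes S :: "'s set" and L :: "'s \<Rightarrow> 's \<Rightarrow> real" and z :: "'s \<Rightarrow> real \<Rightarrow> real"
  assumes finite: "finite S"
    and off_diagonal: "\<And>f g. f \<in> S \<Longrightarrow> g \<in> S \<Longrightarrow> f \<noteq> g \<Longrightarrow> 0 \<le> L f g"
    and ode: "\<And>f t. f \<in> S \<Longrightarrow> (z f has_real_derivative (\<Sum>g\<in>S. L f g * z g t)) (at t)"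
    and initial: "\<And>f. f \<in> S \<Longrightarrow> 0 \<le> z f 0"
begin

text \<open>An integrating factor, used with \<open>c\<close> a diagonal coefficient to remove the
  term of unknown sign.\<close>

lemma monotone_after_rescaling:
  assumes f: "f \<in> S" and "a \<le> b"
    and deriv: "\<And>t. (w has_real_derivative w' t) (at t)"
    and ge: "\<And>t. a < t \<Longrightarrow> t < b \<Longrightarrow> c * w t \<le> w' t"
  shows "exp (- c * a) * w a \<le> exp (- c * b) * w b"
proof (rule DERIV_nonneg_imp_increasing_open[OF \<open>a \<le> b\<close>])
  have d: "((\<lambda>t. exp (- c * t) * w t) has_real_derivative exp (- c * t) * (w' t - c * w t)) (at t)" for t
    by (rule derivative_eq_intros deriv refl)+ (simp add: algebra_simps)
  show "\<exists>y. ((\<lambda>t. exp (- c * t) * w t) has_real_derivative y) (at t) \<and> 0 \<le> y"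
    if "a < t" "t < b" for t
    using d ge[OF that] by (intro exI conjI) auto
  show "continuous_on {a..b} (\<lambda>t. exp (- c * t) * w t)"
    using d by (intro continuous_at_imp_continuous_on ballI DERIV_isCont)
qed

text \<open>The added exponential makes all components positive at time 0, and \<open>C\<close>
  dominates the row sums, so the perturbed functions satisfy the system with an extra nonnegative
  source. At the first time some component reaches 0, its rescaled value would have had to
  decrease.\<close>

lemma perturbed_pos:
  assumes f: "f \<in> S" and "0 \<le> t" and \<epsilon>: "0 < \<epsilon>"
    and C: "\<And>f. f \<in> S \<Longrightarrow> (\<Sum>g\<in>S. L f g) \<le> C"
  shows "0 < z f t + \<epsilon> * exp (C * t)"
proof (rule ccontr)
  let ?w = "\<lambda>f t. z f t + \<epsilon> * exp (C * t)"
  let ?T = "\<Union>f\<in>S. {t. 0 \<le> t \<and> ?w f t \<le> 0}"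
  assume "\<not> 0 < ?w f t"
  then have "t \<in> ?T"
    using f \<open>0 \<le> t\<close> by (auto simp: not_less)
  then have ne: "?T \<noteq> {}"
    by blast
  have cont: "continuous_on UNIV (z f)" if "f \<in> S" for f
    by (intro continuous_at_imp_continuous_on ballI DERIV_isCont[OF ode[OF that]])
  have "closed ?T"
    by (intro closed_UN finite ballI closed_Collect_conj closed_Collect_le continuous_intros cont)
  moreover have bdd: "bdd_below ?T"
    by (rule bdd_belowI[of _ 0]) auto
  ultimately have "Inf ?T \<in> ?T"
    by (intro closed_contains_Inf ne)
  then obtain h where h: "h \<in> S" "0 \<le> Inf ?T" "?w h (Inf ?T) \<le> 0"
    by blast
  \<comment> \<open>First time at which some perturbed component is no longer positive.\<close>
  define b where "b = Inf ?T"
  have before: "0 < ?w g s" if "g \<in> S" "0 \<le> s" "s < b" for g s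
  proof (rule ccontr)
    assume "\<not> 0 < ?w g s"
    then have "s \<in> ?T"
      using that by (auto simp: not_less)
    then have "b \<le> s"
      unfolding b_def by (rule cInf_lower[OF _ bdd])
    then show False
      using that by simp
  qed
  have "exp (- L h h * 0) * ?w h 0 \<le> exp (- L h h * b) * ?w h b"
  proof (rule monotone_after_rescaling[OF h(1)])
    show "0 \<le> b"
      using h by (simp add: b_def)
    show "(?w h has_real_derivative ((\<Sum>g\<in>S. L h g * z g s) + \<epsilon> * (exp (C * s) * C))) (at s)" for s
      by (rule derivative_eq_intros ode[OF h(1)] refl)+ simp
    fix s assume s: "0 < s" "s < b"
    \<comment> \<open>The derivative of the perturbed component, rewritten as the linear system plus
      the nonnegative source.\<close>
    have "(\<Sum>g\<in>S. L h g * z g s) + \<epsilon> * (exp (C * s) * C) =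
        (\<Sum>g\<in>S. L h g * ?w g s) + \<epsilon> * exp (C * s) * (C - (\<Sum>g\<in>S. L h g))"
    proof -
      have "(\<Sum>g\<in>S. L h g * ?w g s) = (\<Sum>g\<in>S. L h g * z g s) + (\<Sum>g\<in>S. L h g) * (\<epsilon> * exp (C * s))"
        by (simp add: distrib_left sum.distrib sum_distrib_right)
      then show ?thesis
        by (simp add: algebra_simps)
    qed
    moreover have "0 \<le> \<epsilon> * exp (C * s) * (C - (\<Sum>g\<in>S. L h g))"
      using C[OF h(1)] \<epsilon> by simp
    moreover have "(\<Sum>g\<in>S. L h g * ?w g s) = L h h * ?w h s + (\<Sum>g\<in>S - {h}. L h g * ?w g s)"
      by (rule sum.remove[OF finite h(1)])
    moreover have "0 \<le> (\<Sum>g\<in>S - {h}. L h g * ?w g s)"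
    proof (rule sum_nonneg)
      fix g assume g: "g \<in> S - {h}"
      have "0 \<le> L h g" "0 \<le> ?w g s"
        using g off_diagonal[OF h(1), of g] before[of g s] s by auto
      then show "0 \<le> L h g * ?w g s"
        by (rule mult_nonneg_nonneg)
    qed
    ultimately show "L h h * ?w h s \<le> (\<Sum>g\<in>S. L h g * z g s) + \<epsilon> * (exp (C * s) * C)"
      by linarith
  qed
  moreover have "exp (- L h h * b) * ?w h b \<le> 0"
    using h(3) by (simp add: b_def mult_nonneg_nonpos)
  ultimately show False
    using initial[OF h(1)] \<epsilon> by simp
qed

lemma nonneg:
  assumes "f \<in> S" "0 \<le> t"
  shows "0 \<le> z f t"
proof (rule field_le_epsilon)
  fix e :: real assume "0 < e"
  define C where "C = (\<Sum>f\<in>S. \<bar>\<Sum>g\<in>S. L f g\<bar>)"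
  have "(\<Sum>g\<in>S. L f g) \<le> C" if "f \<in> S" for f
    using member_le_sum[OF that, of "\<lambda>f. \<bar>\<Sum>g\<in>S. L f g\<bar>"] finite by (simp add: C_def)
  \<comment> \<open>The constant is chosen so that the perturbation at time t equals
    \<open>e\<close>.\<close>
  from perturbed_pos[OF assms divide_pos_pos[OF \<open>0 < e\<close> exp_gt_zero[of "C * t"]] this]
  show "0 \<le> z f t + e"
    by simp
qed

text \<open>A rescaled component is nondecreasing and nonnegative, so a zero propagates
  backwards.\<close>

lemma zero_before:
  assumes f: "f \<in> S" and t: "z f t = 0" and s: "0 \<le> s" "s \<le> t"
  shows "z f s = 0"
proof -
  have "exp (- L f f * s) * z f s \<le> exp (- L f f * t) * z f t"
  proof (rule monotone_after_rescaling[OF f s(2) ode[OF f]])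
    fix r assume r: "s < r" "r < t"
    have "(\<Sum>g\<in>S. L f g * z g r) = L f f * z f r + (\<Sum>g\<in>S - {f}. L f g * z g r)"
      by (rule sum.remove[OF finite f])
    moreover have "0 \<le> (\<Sum>g\<in>S - {f}. L f g * z g r)"
      using s r by (intro sum_nonneg mult_nonneg_nonneg off_diagonal f nonneg) auto
    ultimately show "L f f * z f r \<le> (\<Sum>g\<in>S. L f g * z g r)"
      by simp
  qed
  then have "exp (- L f f * s) * z f s \<le> 0"
    by (simp add: t)
  then have "z f s \<le> 0"
    by (simp add: mult_le_0_iff)
  then show ?thesis
    using nonneg[OF f s(1)] by simp
qed

text \<open>Where a component vanishes on an interval its derivative vanishes too; this is a sum of
  nonnegative terms, so every neighbour with positive coefficient vanishes. The right endpoint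
  follows by continuity, all earlier times by \<open>zero_before\<close>.\<close>

lemma zero_spreads:
  assumes f: "f \<in> S" and zero: "\<And>s. 0 \<le> s \<Longrightarrow> s \<le> t \<Longrightarrow> z f s = 0"
    and g: "g \<in> S" and pos: "0 < L f g" and s: "0 \<le> s" "s \<le> t" and t: "0 < t"
  shows "z g s = 0"
proof -
  have inner: "z g r = 0" if r: "0 < r" "r < t" for r
  proof -
    have "((\<lambda>_. 0) has_real_derivative (\<Sum>g\<in>S. L f g * z g r)) (at r)"
    proof (rule has_field_derivative_transform_within_open[OF ode[OF f]])
      show "open {0<..<t}" "r \<in> {0<..<t}"
        using r by auto
      show "z f q = 0" if "q \<in> {0<..<t}" for q
        using that zero by simp
    qed
    then have "(\<Sum>g\<in>S. L f g * z g r) = 0"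
      by (rule DERIV_unique) (rule DERIV_const)
    moreover have "0 \<le> L f g * z g r" if "g \<in> S" for g
      using off_diagonal[OF f that] nonneg[OF that, of r] zero[of r] r
      by (cases "g = f") auto
    ultimately have "L f g * z g r = 0"
      using sum_nonneg_eq_0_iff[OF finite, of "\<lambda>g. L f g * z g r"] g by auto
    then show ?thesis
      using pos by simp
  qed
  have "z g t = 0"
  proof -
    have cont: "isCont (z g) t"
      using ode[OF g] by (rule DERIV_isCont)
    have lim: "(z g \<longlongrightarrow> z g t) (at_left t)"
      using cont by (simp add: isCont_def filterlim_at_split)
    have ev: "\<forall>\<^sub>F r in at_left t. z g r = 0"
      using eventually_at_left_real[OF t] by eventually_elim (simp add: inner)
    show ?thesis
      by (rule tendsto_unique[OF trivial_limit_at_left_real lim tendsto_eventually[OF ev]])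
  qed
  then show ?thesis
    using zero_before[OF g _ s] by blast
qed

end

section \<open>Total positivity of the flow of a Jacobi matrix\<close>

text \<open>Irreducibility of the compound system in combinatorial form. Lowering the first entry
  that differs from its index keeps the tuple increasing, so each tuple is joined to the lowest one
  by unit steps; steps are reversible.\<close>

lemma increasing_connected:
  assumes step: "\<And>f i b. f \<in> increasing k n \<Longrightarrow> f(i := b) \<in> increasing k n \<Longrightarrow> i < k \<Longrightarrow>
      b = Suc (f i) \<or> f i = Suc b \<Longrightarrow> P f \<Longrightarrow> P (f(i := b))"
    and f: "f \<in> increasing k n" and g: "g \<in> increasing k n" and "P f"
  shows "P g"
proof -
  let ?e = "restrict (\<lambda>i. i) {..<k}"
  have "P f \<longleftrightarrow> P ?e" if "f \<in> increasing k n" for f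
    using that
  proof (induction "\<Sum>i<k. f i" arbitrary: f rule: less_induct)
    case less
    show ?case
    proof (cases "\<exists>i<k. f i \<noteq> i")
      case False
      then have "f = ?e"
        using less.prems by (auto simp: increasing_def fun_eq_iff PiE_iff extensional_def)
      then show ?thesis
        by simp
    next
      case True
      define i where "i = (LEAST i. i < k \<and> f i \<noteq> i)"
      have i: "i < k" "f i \<noteq> i"
        using LeastI_ex[OF True] by (auto simp: i_def)
      have below: "f r = r" if "r < i" for r
        using not_less_Least[of r "\<lambda>i. i < k \<and> f i \<noteq> i"] that i by (auto simp: i_def)
      have mono: "f r < f s" if "r < s" "s < k" for r s
        using less.prems that by (auto simp: increasing_def strict_mono_on_def)
      have range: "f r < n" if "r < k" for r
        using less.prems that by (auto simp: increasing_def)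
      have gt: "i < f i"
      proof (cases i)
        case (Suc j)
        then show ?thesis
          using mono[of j i] below[of j] i by simp
      qed (use i in simp)
      define h where "h = f(i := f i - 1)"
      have h: "h \<in> increasing k n"
      proof -
        have "h r < h s" if "r < s" "s < k" for r s
          using mono[OF that] mono[of r s] below[of r] gt that i mono[of i s] by (auto simp: h_def)
        moreover have "h r < n" if "r < k" for r
          using range[OF that] range[OF i(1)] by (auto simp: h_def)
        moreover have "h r = undefined" if "\<not> r < k" for r
          using less.prems that i by (auto simp: h_def increasing_def PiE_iff extensional_def)
        ultimately show ?thesis
          by (auto simp: increasing_def strict_mono_on_def PiE_iff extensional_def)
      qed
      have fh: "f = h(i := Suc (h i))"
        using gt by (auto simp: h_def)
      have "(\<Sum>i<k. h i) < (\<Sum>i<k. f i)"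
        by (rule sum_strict_mono_ex1) (use i gt in \<open>auto simp: h_def\<close>)
      from less.hyps[OF this h] have "P h \<longleftrightarrow> P ?e" .
      moreover have "P f \<longleftrightarrow> P h"
      proof
        assume "P f"
        then show "P h"
          using step[of f i "f i - 1"] less.prems h i gt by (simp add: h_def)
      next
        assume "P h"
        then have "P (h(i := Suc (h i)))"
          using step[of h i "Suc (h i)"] less.prems h i fh[symmetric] by simp
        then show "P f"
          using fh by simp
      qed
      ultimately show ?thesis
        by simp
    qed
  qed
  then show ?thesis
    using f g \<open>P f\<close> by blast
qed

lemma sum_mult_inverse:
  fixes A :: "nat \<Rightarrow> 'a :: comm_ring_1" and n d :: nat
  assumes "\<And>b. b < n \<Longrightarrow> (\<Sum>l<d. A l * B l b) = of_bool (a = b)" and "a < n"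
  shows "(\<Sum>l<d. A l * (\<Sum>b<n. B l b * f b)) = f a"
proof -
  have "(\<Sum>l<d. A l * (\<Sum>b<n. B l b * f b)) = (\<Sum>b<n. (\<Sum>l<d. A l * B l b) * f b)"
    unfolding sum_distrib_left sum_distrib_right by (subst sum.swap) (simp add: mult.assoc)
  also have "\<dots> = (\<Sum>b<n. if b = a then f a else 0)"
    using assms(1) by (intro sum.cong) auto
  finally show ?thesis
    using assms(2) by simp
qed

lemma orthonormal_transpose:
  fixes Q :: "nat \<Rightarrow> nat \<Rightarrow> real"
  assumes "\<And>a b. a < n \<Longrightarrow> b < n \<Longrightarrow> (\<Sum>c<n. Q a c * Q b c) = of_bool (a = b)"
    and "i < n" "j < n"
  shows "(\<Sum>a<n. Q a i * Q a j) = of_bool (i = j)"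
proof -
  let ?Q = "mat n n (\<lambda>(i, j). Q i j)" and ?T = "mat n n (\<lambda>(i, j). Q j i)"
  have "?Q * ?T = 1\<^sub>m n"
    using assms(1) by (intro eq_matI) (auto simp: scalar_prod_def atLeast0LessThan)
  then have "?T * ?Q = 1\<^sub>m n"
    by (rule mat_mult_left_right_inverse[of _ n, rotated 2]) auto
  then have "(?T * ?Q) $$ (i, j) = of_bool (i = j)"
    using assms(2,3) by simp
  then show ?thesis
    using assms(2,3) by (simp add: scalar_prod_def atLeast0LessThan)
qed

text \<open>Column \<open>c\<close> of \<open>Q\<close> is a unit eigenvector for
  \<open>ev c\<close>, and the first k columns span the top eigenspace. The eigenbasis is part of
  the data because it comes from two sources: orthogonal polynomials, or
  \<open>jacobi_matrix_spectrum\<close>.\<close>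

locale jacobi_spectrum =
  fixes n :: nat and J Q :: "nat \<Rightarrow> nat \<Rightarrow> real" and ev :: "nat \<Rightarrow> real"
  assumes tridiagonal: "\<And>i j. i < n \<Longrightarrow> j < n \<Longrightarrow> Suc i < j \<or> Suc j < i \<Longrightarrow> J i j = 0"
    and super_pos: "\<And>i. Suc i < n \<Longrightarrow> 0 < J i (Suc i)"
    and sub_pos: "\<And>i. Suc i < n \<Longrightarrow> 0 < J (Suc i) i"
    and orthonormal: "\<And>i j. i < n \<Longrightarrow> j < n \<Longrightarrow> (\<Sum>a<n. Q a i * Q a j) = of_bool (i = j)"
    and eigen: "\<And>a c. a < n \<Longrightarrow> c < n \<Longrightarrow> (\<Sum>b<n. J a b * Q b c) = ev c * Q a c"
    and ev_decreasing: "\<And>i j. i < j \<Longrightarrow> j < n \<Longrightarrow> ev j < ev i"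
begin

lemma orthonormal_rows:
  "a < n \<Longrightarrow> b < n \<Longrightarrow> (\<Sum>c<n. Q a c * Q b c) = of_bool (a = b)"
  using orthonormal_transpose[of n "\<lambda>a c. Q c a" a b] orthonormal by simp

text \<open>\<open>exp (t J) Q X\<close>, written in the eigenbasis.\<close>

definition flow :: "(nat \<Rightarrow> nat \<Rightarrow> real) \<Rightarrow> real \<Rightarrow> nat \<Rightarrow> nat \<Rightarrow> real" where
  "flow X t a c = (\<Sum>l<n. Q a l * (exp (t * ev l) * X l c))"

lemma flow_derivative:
  assumes "a < n"
  shows "((\<lambda>t. flow X t a c) has_real_derivative (\<Sum>b<n. J a b * flow X t b c)) (at t)"
proof -
  have "((\<lambda>t. flow X t a c) has_real_derivative (\<Sum>l<n. Q a l * (exp (t * ev l) * ev l * X l c))) (at t)"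
    unfolding flow_def by (auto intro!: derivative_eq_intros sum.cong)
  also have "(\<Sum>l<n. Q a l * (exp (t * ev l) * ev l * X l c)) =
      (\<Sum>l<n. (\<Sum>b<n. J a b * Q b l) * (exp (t * ev l) * X l c))"
    by (rule sum.cong) (simp_all add: eigen[OF assms])
  also have "\<dots> = (\<Sum>b<n. J a b * flow X t b c)"
    unfolding flow_def sum_distrib_left sum_distrib_right
    by (subst sum.swap) (simp add: mult.assoc)
  finally show ?thesis .
qed

text \<open>The additive compound of \<open>J\<close>: the generator of the flow induced on maximal
  minors, restricted to increasing tuples.\<close>

definition compound :: "nat \<Rightarrow> (nat \<Rightarrow> nat) \<Rightarrow> (nat \<Rightarrow> nat) \<Rightarrow> real" where
  "compound k f g = (\<Sum>i<k. \<Sum>b<n. J (f i) b * of_bool (f(i := b) = g))"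

lemma J_nonneg:
  assumes "a < n" "b < n" "a \<noteq> b"
  shows "0 \<le> J a b"
proof -
  consider "Suc a < b \<or> Suc b < a" | "b = Suc a" | "a = Suc b"
    using assms by linarith
  then show ?thesis
    by cases (use assms tridiagonal super_pos[of a] sub_pos[of b] in \<open>auto simp: less_imp_le\<close>)
qed

text \<open>Here tridiagonality matters. A nonzero entry of \<open>J\<close> moves a row index by at
  most one, which can destroy the order only by a collision with a neighbour; the minor is then 0.
  No re-sorting, and so no negative sign, ever occurs.\<close>

lemma update_not_increasing:
  assumes f: "f \<in> increasing k n" and i: "i < k" and b: "b < n"
    and not: "f(i := b) \<notin> increasing k n"
  shows "J (f i) b = 0 \<or> \<not> inj_on (f(i := b)) {..<k}"
proof (rule ccontr)
  assume neg: "\<not> ?thesis"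
  have mono: "f r < f s" if "r < s" "s < k" for r s
    using f that by (auto simp: increasing_def strict_mono_on_def)
  have fi: "f i < n"
    using f i by (auto simp: increasing_def)
  have near: "\<not> (Suc (f i) < b \<or> Suc b < f i)"
    using tridiagonal[OF fi b] neg by blast
  have ne: "f r \<noteq> b" if "r < k" "r \<noteq> i" for r
    using neg that i unfolding inj_on_def by (metis fun_upd_other fun_upd_same lessThan_iff)
  have "(f(i := b)) r < (f(i := b)) s" if "r < s" "s < k" for r s
    using mono[OF that] mono[of i s] mono[of r i] ne[of r] ne[of s] near that i
    by (cases "r = i"; cases "s = i") auto
  moreover have "f(i := b) \<in> {..<k} \<rightarrow>\<^sub>E {..<n}"
    using f i b by (auto simp: increasing_def PiE_iff extensional_def)
  ultimately have "f(i := b) \<in> increasing k n"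
    by (auto simp: increasing_def strict_mono_on_def simp del: fun_upd_apply)
  then show False
    using not by simp
qed

lemma minor_flow_derivative:
  assumes f: "f \<in> increasing k n"
  shows "((\<lambda>t. s * minor k (flow X t) f) has_real_derivative
     (\<Sum>g\<in>increasing k n. compound k f g * (s * minor k (flow X t) g))) (at t)"
proof -
  let ?S = "increasing k n"
  have fn: "f i < n" if "i < k" for i
    using f that by (auto simp: increasing_def)
  have pick: "J (f i) b * minor k (flow X t) (f(i := b)) =
      (\<Sum>g\<in>?S. J (f i) b * of_bool (f(i := b) = g) * minor k (flow X t) g)"
    if "i < k" "b < n" for i b
  proof (cases "f(i := b) \<in> ?S")
    case True
    have "(\<Sum>g\<in>?S. J (f i) b * of_bool (f(i := b) = g) * minor k (flow X t) g) =
        (\<Sum>g\<in>{f(i := b)}. J (f i) b * of_bool (f(i := b) = g) * minor k (flow X t) g)"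
      using True by (intro sum.mono_neutral_right finite_increasing) auto
    then show ?thesis
      by simp
  next
    case False
    then have "J (f i) b = 0 \<or> minor k (flow X t) (f(i := b)) = 0"
      using update_not_increasing[OF f that] minor_not_inj by blast
    moreover have "(\<Sum>g\<in>?S. J (f i) b * of_bool (f(i := b) = g) * minor k (flow X t) g) = 0"
      using False by (intro sum.neutral) auto
    ultimately show ?thesis
      by auto
  qed
  have "(\<Sum>i<k. \<Sum>b<n. J (f i) b * minor k (flow X t) (f(i := b))) =
      (\<Sum>i<k. \<Sum>b<n. \<Sum>g\<in>?S. J (f i) b * of_bool (f(i := b) = g) * minor k (flow X t) g)"
    by (intro sum.cong refl pick) auto
  also have "\<dots> = (\<Sum>i<k. \<Sum>g\<in>?S. \<Sum>b<n. J (f i) b * of_bool (f(i := b) = g) * minor k (flow X t) g)"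
    by (rule sum.cong[OF refl sum.swap])
  also have "\<dots> = (\<Sum>g\<in>?S. \<Sum>i<k. \<Sum>b<n. J (f i) b * of_bool (f(i := b) = g) * minor k (flow X t) g)"
    by (rule sum.swap)
  also have "\<dots> = (\<Sum>g\<in>?S. compound k f g * minor k (flow X t) g)"
    unfolding compound_def sum_distrib_right ..
  finally have eq: "(\<Sum>i<k. \<Sum>b<n. J (f i) b * minor k (flow X t) (f(i := b))) =
      (\<Sum>g\<in>?S. compound k f g * minor k (flow X t) g)" .
  have "((\<lambda>t. minor k (flow X t) f) has_real_derivative
      (\<Sum>i<k. \<Sum>b<n. J (f i) b * minor k (flow X t) (f(i := b)))) (at t)"
    by (rule has_real_derivative_minor[OF flow_derivative fn])
  from DERIV_cmult[OF this, of s] show ?thesis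
    unfolding eq sum_distrib_left by (simp add: mult.left_commute)
qed

text \<open>The minors form a cooperative system. A zero at a positive time would spread over all
  increasing tuples by unit moves and reach \<open>f0\<close> at time 0. The factor \<open>s\<close>
  allows for Pluecker coordinates with a common negative sign.\<close>

theorem flow_totally_positive:
  assumes nonneg: "\<And>f. f \<in> increasing k n \<Longrightarrow> 0 \<le> s * minor k (flow X 0) f"
    and nz: "f0 \<in> increasing k n" "s * minor k (flow X 0) f0 \<noteq> 0"
    and t: "0 < t" and f: "f \<in> increasing k n"
  shows "0 < s * minor k (flow X t) f"
proof -
  let ?S = "increasing k n" and ?z = "\<lambda>f t. s * minor k (flow X t) f"
  have nn: "0 \<le> J (f i) b * of_bool (f(i := b) = g)"
    if "f \<in> ?S" "f \<noteq> g" "i < k" "b < n" for f g i b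
  proof (cases "f(i := b) = g")
    case True
    then have "f i \<noteq> b"
      using that by auto
    moreover have "f i < n"
      using that by (auto simp: increasing_def)
    ultimately show ?thesis
      using J_nonneg that by simp
  qed simp
  interpret cooperative_system ?S "compound k" ?z
  proof
    show "0 \<le> compound k f g" if "f \<in> ?S" "g \<in> ?S" "f \<noteq> g" for f g
      unfolding compound_def using nn[OF that(1,3)] by (intro sum_nonneg) auto
  qed (use finite_increasing minor_flow_derivative nonneg in auto)
  have "0 \<le> ?z f t"
    using nonneg f t less_imp_le by (intro cooperative_system.nonneg[OF cooperative_system_axioms]) auto
  moreover have "?z f t \<noteq> 0"
  proof
    assume zero: "?z f t = 0"
    define P where "P g \<longleftrightarrow> (\<forall>r. 0 \<le> r \<longrightarrow> r \<le> t \<longrightarrow> ?z g r = 0)" for g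
    have "P f"
      using zero_before[OF f zero] by (simp add: P_def)
    have "P f0"
    proof (rule increasing_connected[where P = P, OF _ f nz(1) \<open>P f\<close>])
      fix h i b
      assume h: "h \<in> ?S" "h(i := b) \<in> ?S" "i < k" and b: "b = Suc (h i) \<or> h i = Suc b" and "P h"
      have bn: "b < n" "h i < n"
        using PiE_mem[of "h(i := b)" "{..<k}" "\<lambda>_. {..<n}" i] h by (auto simp: increasing_def)
      then have "0 < J (h i) b"
        using b super_pos[of "h i"] sub_pos[of b] by auto
      moreover have "J (h i) b * of_bool (h(i := b) = h(i := b)) \<le> compound k h (h(i := b))"
      proof -
        have ne: "h \<noteq> h(i := b)"
          using b by (metis fun_upd_same n_not_Suc_n)
        have "J (h i) b * of_bool (h(i := b) = h(i := b)) \<le>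
            (\<Sum>c<n. J (h i) c * of_bool (h(i := c) = h(i := b)))"
          by (rule member_le_sum[of b _ "\<lambda>c. J (h i) c * of_bool (h(i := c) = h(i := b))"])
            (use nn[OF h(1) ne h(3)] bn in auto)
        also have "\<dots> \<le> compound k h (h(i := b))"
          unfolding compound_def
          by (rule member_le_sum[of i _ "\<lambda>i'. \<Sum>c<n. J (h i') c * of_bool (h(i' := c) = h(i := b))"])
            (use h(3) in simp, rule sum_nonneg, rule nn[OF h(1) ne], auto)
        finally show ?thesis .
      qed
      ultimately have "0 < compound k h (h(i := b))"
        by simp
      then show "P (h(i := b))"
        using zero_spreads[OF h(1) _ h(2)] \<open>P h\<close> t unfolding P_def by blast
    qed
    then show False
      using nz(2) t by (simp add: P_def)
  qed
  ultimately show ?thesis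
    by linarith
qed

end

section \<open>Pluecker coordinates of the top eigenspace\<close>

lemma increasing_eqI:
  assumes f: "f \<in> increasing k n" and g: "g \<in> increasing k n" and sub: "f ` {..<k} \<subseteq> g ` {..<k}"
  shows "f = g"
proof -
  have inj: "inj_on f {..<k}" "inj_on g {..<k}"
    using f g by (auto simp: increasing_def strict_mono_on_imp_inj_on)
  have "f ` {..<k} = g ` {..<k}"
    using sub by (intro card_subset_eq) (auto simp: card_image inj)
  moreover have "sorted_wrt (<) (map h [0..<k])" if "h \<in> increasing k n" for h
    using that by (auto simp: increasing_def strict_mono_on_def sorted_wrt_iff_nth_less)
  ultimately have "map f [0..<k] = map g [0..<k]"
    using f g by (intro strict_sorted_equal) (auto simp: atLeast0LessThan)
  then have "f i = g i" if "i < k" for i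
    using that by (auto simp: map_eq_conv)
  moreover have "f i = g i" if "\<not> i < k" for i
    using f g that by (auto simp: increasing_def PiE_iff extensional_def)
  ultimately show ?thesis
    by blast
qed

lemma minor_coordinate_frame:
  assumes "f \<in> increasing k n" "g \<in> increasing k n"
  shows "minor k (\<lambda>a c. of_bool (a = g c)) f = of_bool (f = g)"
proof (cases "f = g")
  case True
  have inj: "inj_on g {..<k}"
    using assms by (auto simp: increasing_def strict_mono_on_imp_inj_on)
  have "mat k k (\<lambda>(i, j). of_bool (g i = g j)) = (1\<^sub>m k :: 'a mat)"
    using inj by (intro eq_matI) (auto simp: inj_on_eq_iff)
  then show ?thesis
    using True by (simp add: minor_def)
next
  case False
  then obtain i where i: "i < k" "f i \<notin> g ` {..<k}"
    using increasing_eqI[OF assms] by auto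
  have "(\<Prod>r<k. of_bool (f r = g (p r))) = (0 :: 'a)" if "p permutes {..<k}" for p
  proof (rule prod_zero)
    have "p i < k"
      using permutes_in_image[OF that, of i] i by simp
    then have "f i \<noteq> g (p i)"
      using i by blast
    then show "\<exists>r\<in>{..<k}. of_bool (f r = g (p r)) = (0 :: 'a)"
      using i(1) by (intro bexI[of _ i]) auto
  qed simp
  then show ?thesis
    using False by (simp add: minor_leibniz)
qed

context jacobi_spectrum begin

definition chart :: "nat \<Rightarrow> (nat \<Rightarrow> nat \<Rightarrow> real) \<Rightarrow> nat \<Rightarrow> nat \<Rightarrow> real" where
  "chart k X l c = (if l < k then of_bool (l = c) else X l c)"

definition frame :: "nat \<Rightarrow> (nat \<Rightarrow> nat \<Rightarrow> real) \<Rightarrow> nat \<Rightarrow> nat \<Rightarrow> real" where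
  "frame k X a c = (\<Sum>l<n. Q a l * chart k X l c)"

text \<open>The flow multiplies row \<open>l\<close> by \<open>exp (t * ev l)\<close>; restoring the
  identity block divides column \<open>c\<close> by \<open>exp (t * ev c)\<close>.\<close>

definition chart_flow :: "(nat \<Rightarrow> nat \<Rightarrow> real) \<Rightarrow> real \<Rightarrow> nat \<Rightarrow> nat \<Rightarrow> real" where
  "chart_flow X t l c = exp (t * (ev l - ev c)) * X l c"

lemma frame_eq_flow: "frame k X = flow (chart k X) 0"
  by (simp add: frame_def flow_def fun_eq_iff)

lemma minor_flow_chart:
  "minor k (flow (chart k X) t) f = minor k (frame k (chart_flow X t)) f * exp (t * (\<Sum>c<k. ev c))"
proof -
  have "exp (t * ev l) * chart k X l c = chart k (chart_flow X t) l c * exp (t * ev c)" for l c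
    by (simp add: chart_def chart_flow_def right_diff_distrib exp_diff)
  then have "flow (chart k X) t a c = frame k (chart_flow X t) a c * exp (t * ev c)" for a c
    by (simp add: flow_def frame_def sum_distrib_right mult.assoc)
  then have "minor k (flow (chart k X) t) f =
      minor k (\<lambda>a c. frame k (chart_flow X t) a c * exp (t * ev c)) f"
    by (intro minor_cong)
  then show ?thesis
    by (simp add: minor_scale_columns exp_sum sum_distrib_left)
qed

text \<open>Below the identity block \<open>ev l < ev c\<close>, so these entries decay and the
  subspace tends to the top eigenspace.\<close>

lemma tendsto_minor_chart_flow:
  assumes "k \<le> n"
  shows "((\<lambda>t. minor k (frame k (chart_flow X t)) f) \<longlongrightarrow> minor k Q f) at_top"
proof (rule tendsto_minor)
  fix i c assume c: "c < k"
  have "((\<lambda>t. chart k (chart_flow X t) l c) \<longlongrightarrow> of_bool (l = c)) at_top" if l: "l < n" for l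
  proof (cases "l < k")
    case False
    then have "ev l - ev c < 0"
      using ev_decreasing[of c l] c l by simp
    then have "((\<lambda>t. exp (t * (ev l - ev c))) \<longlongrightarrow> 0) at_top"
      using filterlim_compose[OF exp_at_bot
          filterlim_tendsto_neg_mult_at_bot[OF tendsto_const[of "ev l - ev c"] _ filterlim_ident]]
      by (simp add: mult.commute)
    from tendsto_mult_right[OF this, of "X l c"] show ?thesis
      using False c by (auto simp: chart_def chart_flow_def)
  qed (simp add: chart_def)
  then have "((\<lambda>t. frame k (chart_flow X t) (f i) c) \<longlongrightarrow> (\<Sum>l<n. Q (f i) l * of_bool (l = c))) at_top"
    unfolding frame_def by (intro tendsto_sum tendsto_mult_left) auto
  moreover have "(\<Sum>l<n. Q (f i) l * of_bool (l = c)) = Q (f i) c"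
    using c assms by (simp add: of_bool_def if_distrib cong: if_cong)
  ultimately show "((\<lambda>t. frame k (chart_flow X t) (f i) c) \<longlongrightarrow> Q (f i) c) at_top"
    by simp
qed

text \<open>A coordinate subspace transverse to the lower eigenvectors has nonnegative Pluecker
  coordinates and flows to the top eigenspace, so the minors of \<open>Q\<close> have weakly one
  sign. Flowing the eigenspace itself, which is only rescaled, makes this strict.\<close>

theorem top_minors_same_sign:
  assumes k: "k \<le> n" and f: "f \<in> increasing k n" and f': "f' \<in> increasing k n"
  shows "0 < minor k Q f * minor k Q f'"
proof -
  have "mat k k (\<lambda>(i, j). \<Sum>a<n. Q a i * Q a j) = 1\<^sub>m k"
    using k by (intro eq_matI) (auto simp: orthonormal)
  then have "\<exists>g\<in>increasing k n. minor k Q g \<noteq> 0"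
    by (intro nonzero_gram_imp_nonzero_minor[where A = Q]) simp
  then obtain g where g: "g \<in> increasing k n" "minor k Q g \<noteq> 0"
    by blast
  have gn: "g i < n" if "i < k" for i
    using g that by (auto simp: increasing_def)
  \<comment> \<open>The coordinate subspace of the rows \<open>g\<close>, written in the eigenbasis.
    Its top block is invertible because \<open>minor k Q g\<close> is nonzero, and \<open>M\<close>
    normalises that block to the identity.\<close>
  define X' where "X' l c = Q (g c) l" for l c
  have "det (mat k k (\<lambda>(i, j). X' i j)) = det (transpose_mat (mat k k (\<lambda>(i, j). Q (g i) j)))"
    by (rule arg_cong[of _ _ det]) (auto intro!: eq_matI simp: X'_def)
  also have "\<dots> \<noteq> 0"
    using g(2) by (subst det_transpose[of _ k]) (auto simp: minor_def)
  finally obtain M where M: "\<And>i j. i < k \<Longrightarrow> j < k \<Longrightarrow> (\<Sum>l<k. X' i l * M l j) = of_bool (i = j)"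
    using det_nonzero_inverse by metis
  have "mat k k (\<lambda>(i, j). X' i j) * mat k k (\<lambda>(i, j). M i j) = 1\<^sub>m k"
    using M by (intro eq_matI) (auto simp: scalar_prod_def atLeast0LessThan)
  then have "det (mat k k (\<lambda>(i, j). X' i j)) * det (mat k k (\<lambda>(i, j). M i j)) = 1"
    by (metis det_mult det_one mat_carrier)
  define s where "s = det (mat k k (\<lambda>(i, j). M i j))"
  have s: "s \<noteq> 0"
    using \<open>_ * _ = 1\<close> by (auto simp: s_def)
  define X where "X l c = (\<Sum>r<k. X' l r * M r c)" for l c
  have minor_X: "minor k (flow (chart k X) t) h = minor k (flow X' t) h * s" for t h
  proof -
    have "chart k X l c = (\<Sum>r<k. X' l r * M r c)" if "c < k" for l c
      using M that by (auto simp: chart_def X_def)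
    then have "flow (chart k X) t a c = (\<Sum>r<k. flow X' t a r * M r c)" if "c < k" for a c
      using that unfolding flow_def sum_distrib_right
      by (subst sum.swap) (simp add: sum_distrib_left mult.assoc)
    then have "minor k (flow (chart k X) t) h = minor k (\<lambda>a c. \<Sum>r<k. flow X' t a r * M r c) h"
      by (intro minor_cong)
    then show ?thesis
      by (simp add: minor_mult s_def)
  qed
  have initial: "minor k (flow X' 0) h = of_bool (h = g)" if h: "h \<in> increasing k n" for h
  proof -
    have "minor k (flow X' 0) h = minor k (\<lambda>a c. of_bool (a = g c)) h"
    proof (rule minor_cong)
      fix i j assume "i < k" "j < k"
      then show "flow X' 0 (h i) j = of_bool (h i = g j)"
        using PiE_mem[of h "{..<k}" "\<lambda>_. {..<n}" i] h gn orthonormal_rows[of "h i" "g j"]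
        by (simp add: flow_def X'_def increasing_def)
    qed
    then show ?thesis
      using minor_coordinate_frame[OF h g(1)] by simp
  qed
  have pos: "0 < 1 * minor k (flow X' t) h" if "h \<in> increasing k n" "0 < t" for h t
    by (rule flow_totally_positive[OF _ g(1) _ that(2,1)]) (auto simp: initial g(1))
  have nonneg: "0 \<le> s * minor k Q h" if h: "h \<in> increasing k n" for h
  proof (rule tendsto_lowerbound)
    show "((\<lambda>t. s * minor k (frame k (chart_flow X t)) h) \<longlongrightarrow> s * minor k Q h) at_top"
      by (intro tendsto_mult_left tendsto_minor_chart_flow k)
    show "\<forall>\<^sub>F t in at_top. 0 \<le> s * minor k (frame k (chart_flow X t)) h"
      using eventually_gt_at_top[of 0]
    proof eventually_elim
      case (elim t)
      have "0 \<le> s * minor k (flow (chart k X) t) h"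
        using pos[OF h elim] mult_nonneg_nonneg[of "minor k (flow X' t) h" "s * s"]
        by (simp add: minor_X mult.left_commute)
      then have "0 \<le> s * minor k (frame k (chart_flow X t)) h * exp (t * (\<Sum>c<k. ev c))"
        by (simp add: minor_flow_chart mult.assoc)
      then show ?case
        by (simp add: zero_le_mult_iff)
    qed
  qed simp
  \<comment> \<open>The top eigenspace in the eigenbasis, on which the flow only scales
    columns.\<close>
  define X0 :: "nat \<Rightarrow> nat \<Rightarrow> real" where "X0 l c = of_bool (l = c)" for l c
  have X0: "minor k (flow X0 t) h = minor k Q h * exp (t * (\<Sum>c<k. ev c))" for t h
  proof -
    have "flow X0 t a c = Q a c * exp (t * ev c)" if "c < k" for a c
      using that k by (simp add: flow_def X0_def of_bool_def if_distrib cong: if_cong)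
    then have "minor k (flow X0 t) h = minor k (\<lambda>a c. Q a c * exp (t * ev c)) h"
      by (intro minor_cong)
    then show ?thesis
      by (simp add: minor_scale_columns exp_sum sum_distrib_left)
  qed
  have "0 < s * minor k (flow X0 1) h" if "h \<in> increasing k n" for h
    by (rule flow_totally_positive[OF _ g(1) _ _ that]) (use nonneg s g in \<open>auto simp: X0\<close>)
  then have "0 < s * minor k Q h * exp (\<Sum>c<k. ev c)" if "h \<in> increasing k n" for h
    using that by (simp add: X0 mult.assoc)
  then have "0 < s * minor k Q h" if "h \<in> increasing k n" for h
    using that by (simp add: zero_less_mult_iff)
  from this[OF f] this[OF f'] show ?thesis
    by (auto simp: zero_less_mult_iff)
qed

end

section \<open>Totally nonnegative subspaces in the chart at the top eigenspace\<close>

definition leading_coords :: "nat \<Rightarrow> (nat \<Rightarrow> real) \<Rightarrow> nat \<Rightarrow> real" where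
  "leading_coords N x = (\<lambda>a. if a < N then x a else 0)"

locale chart_at_top = jacobi_spectrum +
  fixes k m :: nat
  assumes km: "k + m \<le> n"
begin

lemma k_le: "k \<le> n"
  using km by simp

text \<open>A matrix with \<open>k\<close> columns and the identity as its top block is coded by the list of its
  remaining rows.\<close>

definition coords :: "(nat \<Rightarrow> real) \<Rightarrow> nat \<Rightarrow> nat \<Rightarrow> real" where
  "coords x l c = x ((l - k) * k + c)"

abbreviation "fr x \<equiv> frame k (coords x)"

abbreviation "base \<equiv> restrict (\<lambda>i. i) {..<k}"

text \<open>Eigenvectors are determined up to sign, so the minors of \<open>Q\<close> may all be
  negative. Only the sign of this number matters.\<close>

definition top_sign :: real where
  "top_sign = minor k Q base"

lemma base_increasing: "base \<in> increasing k n"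
  using k_le by (auto simp: increasing_def strict_mono_on_def)

lemma top_sign_mult_pos: "f \<in> increasing k n \<Longrightarrow> 0 < top_sign * minor k Q f"
  unfolding top_sign_def by (rule top_minors_same_sign[OF k_le base_increasing])

text \<open>Scaling the first column by \<open>top_sign\<close> multiplies every minor by it. For
  \<open>k = 0\<close> there is no column, but \<open>top_sign\<close> is then the empty determinant
  1.\<close>

lemma prod_top_sign: "(\<Prod>j<k. if j = 0 then top_sign else 1) = top_sign"
proof (cases k)
  case 0
  show ?thesis
    unfolding top_sign_def using 0 by (simp add: minor_leibniz)
next
  case (Suc r)
  then show ?thesis
    by (simp add: prod.delta)
qed

lemma top_sign_nonzero: "top_sign \<noteq> 0"
  using top_sign_mult_pos[OF base_increasing] by auto

abbreviation "E' \<equiv> Euclidean_space ((n - k) * k)"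

definition nonneg_coords :: "(nat \<Rightarrow> real) set" where
  "nonneg_coords = {x \<in> topspace E'. \<forall>f\<in>increasing k n. 0 \<le> top_sign * minor k (fr x) f}"

definition pos_coords :: "(nat \<Rightarrow> real) set" where
  "pos_coords = {x \<in> topspace E'. \<forall>f\<in>increasing k n. 0 < top_sign * minor k (fr x) f}"

text \<open>Index \<open>a\<close> codes column \<open>a mod k\<close> and row
  \<open>k + a div k\<close>, so these are the eigenvalue gaps governing the chart flow. The value 1
  beyond the last coordinate only keeps every exponent positive.\<close>

definition exponents :: "nat \<Rightarrow> real" where
  "exponents a = (if a < (n - k) * k then ev (a mod k) - ev (k + a div k) else 1)"

lemma index_bounds:
  assumes "a < (n - k) * k"
  shows "a mod k < k" "k + a div k < n" "0 < k"
proof -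
  show "0 < k"
    using assms by (cases k) auto
  then show "a mod k < k"
    by simp
  have "a div k < n - k"
    using assms by (simp add: less_mult_imp_div_less)
  then show "k + a div k < n"
    by simp
qed

lemma index_less:
  assumes "k \<le> l" "l < r" "c < k"
  shows "(l - k) * k + c < (r - k) * k"
proof -
  have "(l - k) * k + c < (l - k + 1) * k"
    using assms by simp
  also have "\<dots> \<le> (r - k) * k"
    using assms by (intro mult_right_mono) auto
  finally show ?thesis .
qed

lemma exponents_pos: "0 < exponents a"
proof (cases "a < (n - k) * k")
  case True
  then show ?thesis
    using index_bounds[OF True] ev_decreasing[of "a mod k" "k + a div k"]
      trans_less_add1[OF index_bounds(1)[OF True]] True by (simp add: exponents_def)
qed (simp add: exponents_def)

lemma gram_chart:
  assumes "i < n"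
  shows "(\<Sum>a<n. Q a i * frame k X a j) = chart k X i j"
  unfolding frame_def by (rule sum_mult_inverse[OF orthonormal[OF assms] assms])

lemma det_gram_top: "det (mat k k (\<lambda>(i, j). \<Sum>a<n. Q a i * frame k X a j)) = 1"
proof -
  have "mat k k (\<lambda>(i, j). \<Sum>a<n. Q a i * frame k X a j) = 1\<^sub>m k"
    using k_le by (intro eq_matI) (auto simp: gram_chart chart_def)
  then show ?thesis
    by simp
qed

lemma minor_frame_nonzero: "\<exists>f\<in>increasing k n. minor k (frame k X) f \<noteq> 0"
  by (rule nonzero_gram_imp_nonzero_minor[where A = Q]) (simp add: det_gram_top)

text \<open>The dilation by \<open>r\<close> is the flow of \<open>J\<close> at time
  \<open>ln r\<close> read in the chart, so strict total positivity applies.\<close>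

lemma dilation_nonneg_coords:
  assumes x: "x \<in> nonneg_coords" and r: "1 < r"
  shows "dilation exponents r x \<in> pos_coords"
proof -
  have fr_eq: "fr (dilation exponents r x) a c = frame k (chart_flow (coords x) (ln r)) a c" if "c < k" for a c
    unfolding frame_def
  proof (rule sum.cong[OF refl])
    fix l assume l: "l \<in> {..<n}"
    show "Q a l * chart k (coords (dilation exponents r x)) l c =
        Q a l * chart k (chart_flow (coords x) (ln r)) l c"
    proof (cases "l < k")
      case False
      let ?a = "(l - k) * k + c"
      have "?a < (n - k) * k"
        using False l that by (intro index_less) auto
      then have "exponents ?a = ev c - ev l"
        using that False by (simp add: exponents_def)
      then have "coords (dilation exponents r x) l c = x ?a * r powr (ev l - ev c)"
        using powr_minus_divide[of r "ev c - ev l"] by (simp add: coords_def dilation_def)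
      also have "r powr (ev l - ev c) = exp (ln r * (ev l - ev c))"
        using r by (simp add: powr_def mult.commute)
      finally show ?thesis
        using False by (simp add: chart_def chart_flow_def coords_def)
    qed (simp add: chart_def)
  qed
  obtain f0 where f0: "f0 \<in> increasing k n" "minor k (fr x) f0 \<noteq> 0"
    using minor_frame_nonzero by blast
  have "0 < top_sign * minor k (fr (dilation exponents r x)) f" if f: "f \<in> increasing k n" for f
  proof -
    have "0 < top_sign * minor k (flow (chart k (coords x)) (ln r)) f"
      by (rule flow_totally_positive[OF _ f0(1) _ _ f])
        (use x r f0(2) top_sign_nonzero in \<open>auto simp: nonneg_coords_def frame_eq_flow\<close>)
    then have "0 < top_sign * minor k (frame k (chart_flow (coords x) (ln r))) f * exp (ln r * (\<Sum>c<k. ev c))"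
      by (simp add: minor_flow_chart mult.assoc)
    then have "0 < top_sign * minor k (frame k (chart_flow (coords x) (ln r))) f"
      by (simp add: zero_less_mult_iff)
    also have "minor k (frame k (chart_flow (coords x) (ln r))) f = minor k (fr (dilation exponents r x)) f"
      by (rule minor_cong) (simp add: fr_eq)
    finally show ?thesis .
  qed
  then show ?thesis
    using x by (simp add: pos_coords_def nonneg_coords_def dilation_in_Euclidean_space)
qed

lemma continuous_on_minor_fr: "continuous_on S (\<lambda>x. minor k (fr x) f)"
  unfolding continuous_on_def
proof (rule ballI, rule tendsto_minor)
  fix x i c assume "x \<in> S"
  have lim: "((\<lambda>y. chart k (coords y) l c) \<longlongrightarrow> chart k (coords x) l c) (at x within S)" for l
  proof (cases "l < k")
    case False
    have "continuous_on S (\<lambda>y. y ((l - k) * k + c))"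
      by (rule continuous_on_subset[OF continuous_on_product_coordinates subset_UNIV])
    then show ?thesis
      using False \<open>x \<in> S\<close> by (simp add: chart_def coords_def continuous_on_def)
  qed (simp add: chart_def)
  show "((\<lambda>y. fr y (f i) c) \<longlongrightarrow> fr x (f i) c) (at x within S)"
    unfolding frame_def by (rule tendsto_sum, rule tendsto_mult_left, rule lim)
qed

lemma openin_pos_coords: "openin E' pos_coords"
proof -
  have "open (\<Inter>f\<in>increasing k n. {x. 0 < top_sign * minor k (fr x) f})"
    by (intro open_INT finite_increasing ballI open_Collect_less continuous_on_const
        continuous_on_mult_left continuous_on_minor_fr)
  moreover have "pos_coords = topspace E' \<inter> (\<Inter>f\<in>increasing k n. {x. 0 < top_sign * minor k (fr x) f})"
    by (auto simp: pos_coords_def)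
  ultimately show ?thesis
    by (auto simp: Euclidean_space_eq_top_of_set openin_open)
qed

lemma closed_nonneg_coords: "closed nonneg_coords"
proof -
  have "closed (\<Inter>f\<in>increasing k n. {x. 0 \<le> top_sign * minor k (fr x) f})"
    by (intro closed_INT ballI closed_Collect_le continuous_on_const
        continuous_on_mult_left continuous_on_minor_fr)
  moreover have "closed (topspace E')"
    using closedin_Euclidean_space_iff by blast
  moreover have "nonneg_coords = topspace E' \<inter> (\<Inter>f\<in>increasing k n. {x. 0 \<le> top_sign * minor k (fr x) f})"
    by (auto simp: nonneg_coords_def)
  ultimately show ?thesis
    by (metis closed_Int)
qed

text \<open>If \<open>f\<close> is not injective, both sides are \<open>0\<close> because \<open>x / 0 = 0\<close>.\<close>

lemma minor_fr_bounded:
  assumes x: "x \<in> nonneg_coords" and f: "f \<in> {..<k} \<rightarrow>\<^sub>E {..<n}"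
  shows "\<bar>minor k (fr x) f\<bar> \<le> fact k / \<bar>minor k Q f\<bar>"
proof (cases "inj_on f {..<k}")
  case True
  have sign: "0 \<le> minor k Q g * minor k (fr x) g" if "g \<in> increasing k n" for g
  proof -
    have "0 \<le> top_sign * minor k (fr x) g"
      using x that by (simp add: nonneg_coords_def)
    then show ?thesis
      using top_sign_mult_pos[OF that] by (auto simp: zero_less_mult_iff zero_le_mult_iff)
  qed
  have "minor k Q f \<noteq> 0"
  proof -
    obtain g p where "g \<in> increasing k n" "\<forall>Y :: nat \<Rightarrow> nat \<Rightarrow> real. minor k Y f = signof p * minor k Y g"
      using sort_tuple[OF f True, where 'a = real] by blast
    then show ?thesis
      using top_sign_mult_pos[of g] by auto
  qed
  moreover have "minor k Q f * minor k (fr x) f \<le> fact k"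
    using cauchy_binet_ge[OF sign f] by (simp add: det_gram_top)
  moreover have "0 \<le> minor k Q f * minor k (fr x) f"
    by (rule minor_mult_nonneg[OF sign f])
  ultimately show ?thesis
    by (simp add: pos_le_divide_eq abs_mult[symmetric] mult.commute)
qed (simp add: minor_not_inj)

text \<open>The coordinate is a Gram determinant of the frame against the top eigenvectors with
  column \<open>?c\<close> exchanged for eigenvector \<open>?l\<close>. Cauchy-Binet expresses it by
  minors of the frame, and those are bounded because their Gram determinant against \<open>Q\<close>
  is 1 and has no cancellation.\<close>

lemma coords_bounded:
  assumes a: "a < (n - k) * k"
  shows "\<exists>B. \<forall>x\<in>nonneg_coords. \<bar>x a\<bar> \<le> B"
proof -
  let ?c = "a mod k" and ?l = "k + a div k" and ?F = "{..<k} \<rightarrow>\<^sub>E {..<n}"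
  define A where "A b i = (if i = ?c then Q b ?l else Q b i)" for b i
  have idx: "?c < k" "?l < n"
    using index_bounds[OF a] by auto
  have "\<bar>x a\<bar> \<le> (\<Sum>f\<in>?F. \<bar>minor k A f\<bar> * (fact k / \<bar>minor k Q f\<bar>))" if x: "x \<in> nonneg_coords" for x
  proof -
    have "x a = minor k (\<lambda>b j. if b < k then of_bool (b = j) else coords x ?l j) (\<lambda>r. if r = ?c then k else r)"
      using minor_replace_row_identity[OF idx(1), of "coords x ?l"] by (simp add: coords_def)
    also have "\<dots> = det (mat k k (\<lambda>(i, j). \<Sum>b<n. A b i * fr x b j))"
      unfolding minor_def
    proof (rule arg_cong[of _ _ det], rule eq_matI)
      fix i j assume ij: "i < dim_row (mat k k (\<lambda>(i, j). \<Sum>b<n. A b i * fr x b j))"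
        "j < dim_col (mat k k (\<lambda>(i, j). \<Sum>b<n. A b i * fr x b j))"
      have "(\<Sum>b<n. A b i * fr x b j) = chart k (coords x) (if i = ?c then ?l else i) j"
        using ij idx k_le gram_chart[of ?l "coords x" j] gram_chart[of i "coords x" j] by (simp add: A_def)
      then show "mat k k (\<lambda>(i, j). if (if i = ?c then k else i) < k then of_bool ((if i = ?c then k else i) = j)
            else coords x ?l j) $$ (i, j) = mat k k (\<lambda>(i, j). \<Sum>b<n. A b i * fr x b j) $$ (i, j)"
        using ij by (simp add: chart_def)
    qed auto
    finally have "fact k * \<bar>x a\<bar> = \<bar>\<Sum>f\<in>?F. minor k A f * minor k (fr x) f\<bar>"
      unfolding cauchy_binet by (simp add: abs_mult)
    also have "\<dots> \<le> (\<Sum>f\<in>?F. \<bar>minor k A f * minor k (fr x) f\<bar>)"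
      by (rule sum_abs)
    also have "\<dots> \<le> (\<Sum>f\<in>?F. \<bar>minor k A f\<bar> * (fact k / \<bar>minor k Q f\<bar>))"
      unfolding abs_mult by (intro sum_mono mult_left_mono minor_fr_bounded x) auto
    finally have "fact k * \<bar>x a\<bar> \<le> (\<Sum>f\<in>?F. \<bar>minor k A f\<bar> * (fact k / \<bar>minor k Q f\<bar>))" .
    moreover have "1 * \<bar>x a\<bar> \<le> fact k * \<bar>x a\<bar>"
      by (intro mult_right_mono fact_ge_1) auto
    ultimately show ?thesis
      by linarith
  qed
  then show ?thesis
    by blast
qed

lemma compact_nonneg_coords: "compact nonneg_coords"
proof -
  obtain B where B: "\<And>a x. a < (n - k) * k \<Longrightarrow> x \<in> nonneg_coords \<Longrightarrow> \<bar>x a\<bar> \<le> B a"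
    using coords_bounded by metis
  define C where "C a = (if a < (n - k) * k then B a else 0)" for a
  have "nonneg_coords \<subseteq> (\<Pi>\<^sub>E a\<in>UNIV. {- C a..C a})"
  proof
    fix x assume x: "x \<in> nonneg_coords"
    have "\<bar>x a\<bar> \<le> C a" for a
      using B[OF _ x, of a] x by (auto simp: C_def nonneg_coords_def topspace_Euclidean_space)
    then show "x \<in> (\<Pi>\<^sub>E a\<in>UNIV. {- C a..C a})"
      by (auto simp: abs_le_iff minus_le_iff)
  qed
  moreover have "compact (\<Pi>\<^sub>E a\<in>(UNIV :: nat set). {- C a..C a})"
    using compactin_PiE[of "\<lambda>_::nat. euclideanreal" UNIV "\<lambda>a. {- C a..C a}"]
    by (simp add: euclidean_product_topology)
  ultimately show ?thesis
    using compact_Int_closed[of "\<Pi>\<^sub>E a\<in>(UNIV :: nat set). {- C a..C a}" nonneg_coords]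
    by (simp add: inf.absorb2 closed_nonneg_coords)
qed

lemma zero_nonneg_coords: "(\<lambda>_. 0) \<in> nonneg_coords"
proof -
  have "fr (\<lambda>_. 0) a c = Q a c" if "c < k" for a c
  proof -
    have "fr (\<lambda>_. 0) a c = (\<Sum>l<n. Q a l * of_bool (l = c))"
      unfolding frame_def using that by (intro sum.cong) (auto simp: chart_def coords_def)
    then show ?thesis
      using that k_le by (simp add: of_bool_def if_distrib cong: if_cong)
  qed
  then have "minor k (fr (\<lambda>_. 0)) f = minor k Q f" for f
    by (intro minor_cong)
  then show ?thesis
    using top_sign_mult_pos less_imp_le by (auto simp: nonneg_coords_def topspace_Euclidean_space)
qed

text \<open>The amplituhedron in chart coordinates: a map whose kernel is spanned by the
  eigenvectors from \<open>k + m\<close> on forgets the rows from \<open>k + m\<close> on, that is,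
  all but the first \<open>k * m\<close> coordinates.\<close>

definition body :: "(nat \<Rightarrow> real) set" where
  "body = leading_coords (k * m) ` nonneg_coords"

abbreviation "E0 \<equiv> Euclidean_space (k * m)"

lemma size_le: "k * m \<le> (n - k) * k"
  using km by (subst mult.commute) (intro mult_le_mono1, simp)

lemma continuous_on_leading_coords: "continuous_on S (leading_coords N)"
  unfolding leading_coords_def
proof (rule continuous_on_coordinatewise_then_product)
  show "continuous_on S (\<lambda>x. if i < N then x i else 0)" for i
    by (cases "i < N")
      (simp_all add: continuous_on_subset[OF continuous_on_product_coordinates subset_UNIV])
qed

text \<open>The coordinate projection is open and commutes with the dilation, so contraction into
  the positive part passes to the image.\<close>

sublocale body: contracted_body "k * m" exponents body
proof
  show "compactin E0 body"
    unfolding Euclidean_space_eq_top_of_set compactin_subtopology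
    using compact_continuous_image[OF continuous_on_leading_coords compact_nonneg_coords, of "k * m"]
    by (auto simp: body_def) (simp add: leading_coords_def)
  show "body \<noteq> {}"
    using zero_nonneg_coords by (auto simp: body_def)
  fix r :: real and x :: "nat \<Rightarrow> real"
  assume x: "x \<in> body" and r: "1 < r"
  then obtain y where y: "y \<in> nonneg_coords" "x = leading_coords (k * m) y"
    by (auto simp: body_def)
  have eq: "dilation exponents r x = leading_coords (k * m) (dilation exponents r y)"
    by (auto simp: y dilation_def leading_coords_def)
  have "openin E0 (leading_coords (k * m) ` pos_coords)"
  proof -
    \<comment> \<open>Overwrites the leading coordinates of \<open>p\<close> by \<open>w\<close>.
      The projection of an open set is the union over \<open>p\<close> of its preimages under these
      sections, hence open.\<close>
    define glue where "glue p w = (\<lambda>a. if a < k * m then w a else p a)" for p w :: "nat \<Rightarrow> real"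
    have op: "openin E0 {w \<in> topspace E0. glue p w \<in> pos_coords}" if p: "p \<in> topspace E'" for p
    proof (rule openin_continuous_map_preimage[OF _ openin_pos_coords])
      have "continuous_on S (glue p)" for S
        unfolding glue_def
      proof (rule continuous_on_coordinatewise_then_product)
        show "continuous_on S (\<lambda>w. if i < k * m then w i else p i)" for i
          by (cases "i < k * m")
            (simp_all add: continuous_on_subset[OF continuous_on_product_coordinates subset_UNIV])
      qed
      moreover have "glue p w \<in> topspace E'" for w
      proof -
        have "\<not> i < k * m" if "(n - k) * k \<le> i" for i
          using size_le that by linarith
        then show ?thesis
          using p by (auto simp: glue_def topspace_Euclidean_space)
      qed
      ultimately show "continuous_map E0 E' (glue p)"
        unfolding Euclidean_space_eq_top_of_set continuous_map_in_subtopology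
        by (auto simp: topspace_Euclidean_space)
    qed
    have "leading_coords (k * m) ` pos_coords =
        (\<Union>p\<in>topspace E'. {w \<in> topspace E0. glue p w \<in> pos_coords})"
    proof (intro equalityI subsetI)
      fix w assume "w \<in> leading_coords (k * m) ` pos_coords"
      then obtain p where p: "p \<in> pos_coords" "w = leading_coords (k * m) p"
        by blast
      then have "glue p w = p" "w \<in> topspace E0" "p \<in> topspace E'"
        by (auto simp: glue_def leading_coords_def topspace_Euclidean_space pos_coords_def)
      then show "w \<in> (\<Union>p\<in>topspace E'. {w \<in> topspace E0. glue p w \<in> pos_coords})"
        using p(1) by (intro UN_I[of p]) auto
    next
      fix w assume "w \<in> (\<Union>p\<in>topspace E'. {w \<in> topspace E0. glue p w \<in> pos_coords})"
      then obtain p where p: "w \<in> topspace E0" "glue p w \<in> pos_coords"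
        by blast
      then have "w = leading_coords (k * m) (glue p w)"
        by (auto simp: glue_def leading_coords_def topspace_Euclidean_space)
      then show "w \<in> leading_coords (k * m) ` pos_coords"
        using p by blast
    qed
    then show ?thesis
      using op by (auto intro!: openin_Union)
  qed
  moreover have "leading_coords (k * m) ` pos_coords \<subseteq> body"
    unfolding body_def pos_coords_def nonneg_coords_def using less_imp_le by blast
  ultimately have "leading_coords (k * m) ` pos_coords \<subseteq> E0 interior_of body"
    by (rule interior_of_maximal[rotated])
  then show "dilation exponents r x \<in> E0 interior_of body"
    using dilation_nonneg_coords[OF y(1) r] unfolding eq by blast
qed (rule exponents_pos)

text \<open>Every totally nonnegative subspace lies in the chart: the determinant of its projection
  to the top eigenspace is a Cauchy-Binet sum of terms of one sign, not all 0. Dividing by this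
  block gives the coordinates.\<close>

lemma nonneg_matrix_in_chart:
  assumes nonneg: "\<And>f. f \<in> increasing k n \<Longrightarrow> 0 \<le> minor k Y f"
    and nz: "\<exists>f\<in>increasing k n. minor k Y f \<noteq> 0"
  shows "\<exists>x\<in>nonneg_coords. \<exists>G. det (mat k k (\<lambda>(i, j). G i j)) \<noteq> 0 \<and>
    (\<forall>a<n. \<forall>c<k. Y a c = (\<Sum>r<k. fr x a r * G r c))"
proof -
  define G where "G l c = (\<Sum>a<n. Q a l * Y a c)" for l c
  let ?G = "mat k k (\<lambda>(i, j). G i j)"
  obtain f0 where f0: "f0 \<in> increasing k n" "minor k Y f0 \<noteq> 0"
    using nz by blast
  have "0 < top_sign * det ?G"
  proof -
    \<comment> \<open>The common sign is moved into the first column so that all Cauchy-Binet terms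
      become nonnegative.\<close>
    let ?Q = "\<lambda>a j. Q a j * (if j = 0 then top_sign else 1)"
    have mQ: "minor k ?Q f = top_sign * minor k Q f" for f
      by (simp add: minor_scale_columns prod_top_sign mult.commute)
    have "minor k ?Q f0 * minor k Y f0 \<le> fact k * det (mat k k (\<lambda>(i, j). \<Sum>l<n. ?Q l i * Y l j))"
    proof (rule cauchy_binet_ge)
      show "0 \<le> minor k ?Q g * minor k Y g" if "g \<in> increasing k n" for g
        unfolding mQ using mult_nonneg_nonneg[OF less_imp_le[OF top_sign_mult_pos[OF that]] nonneg[OF that]] .
      show "f0 \<in> {..<k} \<rightarrow>\<^sub>E {..<n}"
        using f0(1) increasing_subset by blast
    qed
    moreover have "0 < minor k ?Q f0 * minor k Y f0"
      using top_sign_mult_pos[OF f0(1)] nonneg[OF f0(1)] f0(2) by (simp add: mQ)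
    moreover have "det (mat k k (\<lambda>(i, j). \<Sum>l<n. ?Q l i * Y l j)) = top_sign * det ?G"
    proof -
      have "det (mat k k (\<lambda>(i, j). \<Sum>l<n. ?Q l i * Y l j)) =
          minor k (\<lambda>a j. \<Sum>l<n. Y l a * ?Q l j) (\<lambda>i. i)"
        unfolding minor_def
        by (subst det_transpose[of _ k, symmetric])
          (auto intro!: arg_cong[of _ _ det] eq_matI simp: mult.commute)
      also have "\<dots> = minor k (\<lambda>a j. (\<Sum>l<n. Y l a * Q l j) * (if j = 0 then top_sign else 1)) (\<lambda>i. i)"
        by (simp add: sum_distrib_right mult.assoc)
      also have "\<dots> = minor k (\<lambda>a j. \<Sum>l<n. Y l a * Q l j) (\<lambda>i. i) * top_sign"
        by (simp only: minor_scale_columns prod_top_sign)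
      also have "minor k (\<lambda>a j. \<Sum>l<n. Y l a * Q l j) (\<lambda>i. i) = det ?G"
        unfolding minor_def
        by (subst det_transpose[of _ k, symmetric])
          (auto intro!: arg_cong[of _ _ det] eq_matI simp: mult.commute G_def)
      finally show ?thesis
        by simp
    qed
    ultimately have "0 < fact k * (top_sign * det ?G)"
      by (simp only: less_le_trans)
    then show ?thesis
      by (simp add: zero_less_mult_iff)
  qed
  then have nzG: "det ?G \<noteq> 0"
    by auto
  then obtain M where M: "\<And>i j. i < k \<Longrightarrow> j < k \<Longrightarrow> (\<Sum>l<k. G i l * M l j) = of_bool (i = j)"
      "\<And>i j. i < k \<Longrightarrow> j < k \<Longrightarrow> (\<Sum>l<k. M i l * G l j) = of_bool (i = j)"
    using det_nonzero_inverse by metis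
  have "?G * mat k k (\<lambda>(i, j). M i j) = 1\<^sub>m k"
    using M by (intro eq_matI) (auto simp: scalar_prod_def atLeast0LessThan)
  then have dets: "det ?G * det (mat k k (\<lambda>(i, j). M i j)) = 1"
    by (metis det_mult det_one mat_carrier)
  define x where "x a = (if a < (n - k) * k then \<Sum>r<k. G (k + a div k) r * M r (a mod k) else 0)" for a
  have chart: "chart k (coords x) l c = (\<Sum>r<k. G l r * M r c)" if "l < n" "c < k" for l c
  proof (cases "l < k")
    case False
    then have "(l - k) * k + c < (n - k) * k"
      using that by (intro index_less) auto
    then show ?thesis
      using False that by (simp add: chart_def coords_def x_def)
  qed (use M that in \<open>simp add: chart_def\<close>)
  have fr: "fr x a c = (\<Sum>r<k. Y a r * M r c)" if "a < n" "c < k" for a c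
  proof -
    have "fr x a c = (\<Sum>l<n. Q a l * (\<Sum>r<k. G l r * M r c))"
      unfolding frame_def using chart that by (intro sum.cong) auto
    also have "\<dots> = (\<Sum>r<k. (\<Sum>l<n. Q a l * G l r) * M r c)"
      unfolding sum_distrib_left sum_distrib_right by (subst sum.swap) (simp add: mult.assoc)
    also have "\<dots> = (\<Sum>r<k. Y a r * M r c)"
      using that unfolding G_def
      by (intro sum.cong refl arg_cong2[where f = "(*)"] sum_mult_inverse orthonormal_rows)
    finally show ?thesis .
  qed
  have minor_fr: "minor k (fr x) f = minor k Y f * det (mat k k (\<lambda>(i, j). M i j))" if "f \<in> increasing k n" for f
  proof -
    have "minor k (fr x) f = minor k (\<lambda>a c. \<Sum>r<k. Y a r * M r c) f"
      using that by (intro minor_cong fr) (auto simp: increasing_def)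
    then show ?thesis
      by (simp add: minor_mult)
  qed
  have "0 < top_sign * det (mat k k (\<lambda>(i, j). M i j))"
  proof -
    have "top_sign * det (mat k k (\<lambda>(i, j). M i j)) * (det ?G * det ?G) = top_sign * det ?G"
      using dets by (simp add: algebra_simps)
    then show ?thesis
      using \<open>0 < top_sign * det ?G\<close> nzG by (metis not_square_less_zero zero_less_mult_pos2 mult_eq_0_iff linorder_neqE_linordered_idom)
  qed
  then have "0 \<le> top_sign * minor k (fr x) f" if "f \<in> increasing k n" for f
    using nonneg[OF that] mult_nonneg_nonneg[of "minor k Y f" "top_sign * det (mat k k (\<lambda>(i, j). M i j))"]
    by (simp add: minor_fr[OF that] mult.left_commute)
  then have "x \<in> nonneg_coords"
    by (auto simp: nonneg_coords_def topspace_Euclidean_space x_def)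
  moreover have "Y a c = (\<Sum>r<k. fr x a r * G r c)" if "a < n" "c < k" for a c
  proof -
    have "(\<Sum>r<k. fr x a r * G r c) = (\<Sum>r<k. (\<Sum>q<k. Y a q * M q r) * G r c)"
      using that by (intro sum.cong) (simp_all add: fr)
    also have "\<dots> = (\<Sum>q<k. Y a q * (\<Sum>r<k. M q r * G r c))"
      unfolding sum_distrib_left sum_distrib_right by (subst sum.swap) (simp add: mult.assoc)
    also have "\<dots> = (\<Sum>q<k. Y a q * of_bool (q = c))"
      using that by (intro sum.cong) (simp_all add: M)
    also have "\<dots> = Y a c"
      using that by (simp add: of_bool_def if_distrib cong: if_cong)
    finally show ?thesis ..
  qed
  ultimately show ?thesis
    using nzG by blast
qed

text \<open>A diagonal column scaling leaves the column space alone and absorbs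
  \<open>top_sign\<close>, as \<open>Gr_nonneg\<close> asks for a representative with nonnegative
  minors.\<close>

lemma chart_gives_nonneg_matrix:
  assumes x: "x \<in> nonneg_coords"
  shows "\<exists>d. (\<Prod>j<k. d j) \<noteq> 0 \<and> (\<forall>f\<in>increasing k n. 0 \<le> minor k (\<lambda>a j. fr x a j * d j) f)"
proof -
  have "minor k (\<lambda>a j. fr x a j * (if j = 0 then top_sign else 1)) f = top_sign * minor k (fr x) f" for f
    by (subst minor_scale_columns, subst prod_top_sign, rule mult.commute)
  then show ?thesis
    using x top_sign_nonzero
    by (intro exI[of _ "\<lambda>j. if j = 0 then top_sign else 1"])
      (simp only: prod_top_sign nonneg_coords_def mem_Collect_eq, simp)
qed

end

section \<open>Full-rank matrices and their column spaces\<close>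

context vec_space begin

lemma col_space_image:
  "A \<in> carrier_mat n k \<Longrightarrow> col_space A = (\<lambda>v. A *\<^sub>v v) ` carrier_vec k"
  by (auto simp: col_space_eq)

text \<open>The rank is defined through the set of columns, which forgets repetitions; distinctness
  of the columns therefore has to be secured in both directions.\<close>

lemma full_rank_iff:
  assumes A: "A \<in> carrier_mat n k"
  shows "rank A = k \<longleftrightarrow> (\<forall>v \<in> carrier_vec k. A *\<^sub>v v = 0\<^sub>v n \<longrightarrow> v = 0\<^sub>v k)"
proof
  assume rank: "rank A = k"
  have "distinct (cols A)"
  proof (rule ccontr)
    assume "\<not> distinct (cols A)"
    then have "card (set (cols A)) < k"
      using A card_distinct[of "cols A"] card_length[of "cols A"] by fastforce
    moreover obtain S where S: "maximal S (\<lambda>T. T \<subseteq> set (cols A) \<and> lin_indpt T)"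
      using maximal_exists[of "\<lambda>T. T \<subseteq> set (cols A) \<and> lin_indpt T" "card (set (cols A))" "{}"]
        card_mono[of "set (cols A)"] finite_subset[of _ "set (cols A)"]
      by (auto simp: lin_dep_def)
    moreover have "rank A = card S"
      by (rule rank_card_indpt[OF A S])
    moreover have "card S \<le> card (set (cols A))"
      using S by (intro card_mono) (auto simp: maximal_def)
    ultimately show False
      using rank by simp
  qed
  then have "lin_indpt (set (cols A))"
    using full_rank_lin_indpt[OF A rank] by blast
  then show "\<forall>v \<in> carrier_vec k. A *\<^sub>v v = 0\<^sub>v n \<longrightarrow> v = 0\<^sub>v k"
    using lin_depI[OF A _ _ _ \<open>distinct (cols A)\<close>] by blast
next
  assume inj: "\<forall>v \<in> carrier_vec k. A *\<^sub>v v = 0\<^sub>v n \<longrightarrow> v = 0\<^sub>v k"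
  have distinct: "distinct (cols A)"
  proof (rule ccontr)
    assume "\<not> distinct (cols A)"
    then obtain i j where ij: "i < k" "j < k" "i \<noteq> j" "col A i = col A j"
      using A by (auto simp: distinct_conv_nth)
    let ?v = "unit_vec k i - unit_vec k j :: 'a vec"
    have "A *\<^sub>v ?v = A *\<^sub>v unit_vec k i - A *\<^sub>v unit_vec k j"
      by (rule mult_minus_distrib_mat_vec[OF A]) auto
    also have "\<dots> = 0\<^sub>v n"
    proof -
      have "A *\<^sub>v unit_vec k i = col A i"
        using A ij(1) by (intro eq_vecI) auto
      moreover have "A *\<^sub>v unit_vec k j = col A j"
        using A ij(2) by (intro eq_vecI) auto
      moreover have "col A j \<in> carrier_vec n"
        using A ij by auto
      ultimately show ?thesis
        using ij(4) by simp
    qed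
    finally have "?v = 0\<^sub>v k"
      using inj by simp
    then have "?v $ i = 0"
      using ij by simp
    then show False
      using ij by simp
  qed
  have "lin_indpt (set (cols A))"
  proof
    assume "lin_dep (set (cols A))"
    then obtain v where "v \<in> carrier_vec k" "v \<noteq> 0\<^sub>v k" "A *\<^sub>v v = 0\<^sub>v n"
      using lin_depE[OF A _ distinct] by blast
    then show False
      using inj by blast
  qed
  then show "rank A = k"
    by (rule lin_indpt_full_rank[OF A distinct])
qed

lemma col_space_mult_invertible:
  assumes B: "B \<in> carrier_mat n k" and G: "G \<in> carrier_mat k k" and det: "det G \<noteq> 0"
  shows "col_space (B * G) = col_space B"
proof -
  have "G \<in> Units (ring_mat TYPE('a) k ())"
    using det_non_zero_imp_unit[OF G det] .
  then obtain G' where G': "G' \<in> carrier_mat k k" "G * G' = 1\<^sub>m k"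
    by (auto simp: Units_def ring_mat_def)
  have "(\<lambda>v. G *\<^sub>v v) ` carrier_vec k = carrier_vec k"
  proof (intro equalityI subsetI)
    fix w :: "'a vec" assume w: "w \<in> carrier_vec k"
    then have "w = G *\<^sub>v (G' *\<^sub>v w)"
      using G' assoc_mult_mat_vec[OF G G'(1) w] by simp
    then show "w \<in> (\<lambda>v. G *\<^sub>v v) ` carrier_vec k"
      using G'(1) w by (metis imageI mult_mat_vec_carrier)
  qed (use G in auto)
  moreover have "col_space (B * G) = (\<lambda>v. B *\<^sub>v v) ` (\<lambda>v. G *\<^sub>v v) ` carrier_vec k"
    using assoc_mult_mat_vec[OF B G] B G
    by (subst col_space_image[where k = k]) (auto simp: image_image)
  ultimately show ?thesis
    by (simp add: col_space_image[OF B])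
qed

lemma col_space_eqD:
  assumes A: "A \<in> carrier_mat n k" "rank A = k" and B: "B \<in> carrier_mat n k"
    and eq: "col_space A = col_space B"
  shows "\<exists>G \<in> carrier_mat k k. det G \<noteq> 0 \<and> A = B * G"
proof -
  have "\<exists>w \<in> carrier_vec k. col A j = B *\<^sub>v w" if "j < k" for j
  proof -
    have "col A j = A *\<^sub>v unit_vec k j"
      using A that by (auto intro!: eq_vecI)
    then have "col A j \<in> col_space A"
      by (auto simp: col_space_image[OF A(1)])
    then show ?thesis
      unfolding eq by (auto simp: col_space_image[OF B])
  qed
  then obtain w where w: "\<And>j. j < k \<Longrightarrow> w j \<in> carrier_vec k" "\<And>j. j < k \<Longrightarrow> col A j = B *\<^sub>v w j"
    by metis
  define G where "G = mat k k (\<lambda>(i, j). w j $ i)"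
  have G: "G \<in> carrier_mat k k"
    by (simp add: G_def)
  have col: "col G j = w j" if "j < k" for j
    using w(1)[OF that] that by (auto intro!: eq_vecI simp: G_def)
  have AB: "A = B * G"
  proof (rule eq_matI)
    fix i j assume ij: "i < dim_row (B * G)" "j < dim_col (B * G)"
    then have "i < n" "j < k"
      using B G by auto
    have "A $$ (i, j) = col A j $ i"
      using A \<open>i < n\<close> \<open>j < k\<close> by simp
    also have "\<dots> = (B *\<^sub>v col G j) $ i"
      using w(2) col \<open>j < k\<close> by simp
    also have "\<dots> = (B * G) $$ (i, j)"
      using ij by simp
    finally show "A $$ (i, j) = (B * G) $$ (i, j)" .
  qed (use A B G in auto)
  have "det G \<noteq> 0"
  proof
    assume "det G = 0"
    then obtain v where v: "v \<in> carrier_vec k" "v \<noteq> 0\<^sub>v k" "G *\<^sub>v v = 0\<^sub>v k"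
      using det_0_iff_vec_prod_zero_field[OF G] by blast
    then have "A *\<^sub>v v = 0\<^sub>v n"
      using assoc_mult_mat_vec[OF B G v(1)] B unfolding AB by (auto intro!: eq_vecI)
    then show False
      using v A full_rank_iff by blast
  qed
  then show ?thesis
    using G AB by blast
qed

end

abbreviation entries :: "'a mat \<Rightarrow> nat \<Rightarrow> nat \<Rightarrow> 'a" where
  "entries A \<equiv> \<lambda>i j. A $$ (i, j)"

lemma trivial_kernel_if_minor_nonzero:
  fixes A :: "'a :: field mat"
  assumes A: "A \<in> carrier_mat n k" and f: "\<And>i. i < k \<Longrightarrow> f i < n" and nz: "minor k (entries A) f \<noteq> 0"
    and v: "v \<in> carrier_vec k" "A *\<^sub>v v = 0\<^sub>v n"
  shows "v = 0\<^sub>v k"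
proof -
  let ?M = "mat k k (\<lambda>(i, j). A $$ (f i, j))"
  have "?M *\<^sub>v v = 0\<^sub>v k"
  proof (rule eq_vecI)
    fix i assume "i < dim_vec (0\<^sub>v k :: 'a vec)"
    then have i: "i < k"
      by simp
    have "(?M *\<^sub>v v) $ i = (A *\<^sub>v v) $ f i"
      using i f[OF i] A v(1) by (auto simp: scalar_prod_def intro!: sum.cong)
    then show "(?M *\<^sub>v v) $ i = 0\<^sub>v k $ i"
      using v i f[OF i] by simp
  qed auto
  then show ?thesis
    using nz det_0_iff_vec_prod_zero_field[of ?M k] v(1) by (auto simp: minor_def)
qed

lemma full_rank_if_minor_nonzero:
  fixes A :: "'a :: field mat"
  assumes "A \<in> carrier_mat n k" "\<And>i. i < k \<Longrightarrow> f i < n" "minor k (entries A) f \<noteq> 0"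
  shows "vec_space.rank n A = k"
  using trivial_kernel_if_minor_nonzero[OF assms] vec_space.full_rank_iff[OF assms(1)] by blast

text \<open>Over the reals a kernel vector v of the Gram matrix satisfies
  \<open>A *\<^sub>v v = 0\<close> because the squared length of that vector is 0; so the Gram
  determinant is nonzero and Cauchy-Binet applies.\<close>

lemma minor_nonzero_if_trivial_kernel:
  fixes A :: "real mat"
  assumes A: "A \<in> carrier_mat n k" and inj: "\<And>v. v \<in> carrier_vec k \<Longrightarrow> A *\<^sub>v v = 0\<^sub>v n \<Longrightarrow> v = 0\<^sub>v k"
  shows "\<exists>f\<in>increasing k n. minor k (entries A) f \<noteq> 0"
proof (rule nonzero_gram_imp_nonzero_minor[where A = "entries A"])
  let ?G = "mat k k (\<lambda>(i, j). \<Sum>l<n. A $$ (l, i) * A $$ (l, j))"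
  have G: "?G = transpose_mat A * A"
    using A by (intro eq_matI) (auto simp: scalar_prod_def atLeast0LessThan)
  show "det ?G \<noteq> 0"
  proof
    assume "det ?G = 0"
    then obtain v where v: "v \<in> carrier_vec k" "v \<noteq> 0\<^sub>v k" "?G *\<^sub>v v = 0\<^sub>v k"
      using det_0_iff_vec_prod_zero_field[of ?G k] by auto
    have Av: "A *\<^sub>v v \<in> carrier_vec n"
      using A v by auto
    have "(A *\<^sub>v v) \<bullet> (A *\<^sub>v v) = v \<bullet> (transpose_mat A *\<^sub>v (A *\<^sub>v v))"
      using transpose_vec_mult_scalar[OF A v(1) Av] comm_scalar_prod[OF Av Av]
        comm_scalar_prod[of "transpose_mat A *\<^sub>v (A *\<^sub>v v)" k v] A v Av by simp
    also have "transpose_mat A *\<^sub>v (A *\<^sub>v v) = ?G *\<^sub>v v"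
      unfolding G using A v by (intro assoc_mult_mat_vec[symmetric]) auto
    also have "v \<bullet> \<dots> = 0"
      using v by simp
    finally have zero: "(A *\<^sub>v v) \<bullet> (A *\<^sub>v v) = 0" .
    have sq: "w \<bullet> w = (\<Sum>i<n. (w $ i)\<^sup>2)" if "w \<in> carrier_vec n" for w :: "real vec"
      using that by (simp add: scalar_prod_def atLeast0LessThan power2_eq_square)
    have "\<forall>i\<in>{..<n}. ((A *\<^sub>v v) $ i)\<^sup>2 = 0"
      using zero unfolding sq[OF Av] by (subst (asm) sum_nonneg_eq_0_iff) auto
    then have "A *\<^sub>v v = 0\<^sub>v n"
      using A by (intro eq_vecI) (simp_all del: index_mult_mat_vec)
    then show False
      using inj v by blast
  qed
qed

lemma minor_nonzero_if_full_rank: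
  fixes A :: "real mat"
  assumes "A \<in> carrier_mat n k" "vec_space.rank n A = k"
  shows "\<exists>f\<in>increasing k n. minor k (entries A) f \<noteq> 0"
  using minor_nonzero_if_trivial_kernel[OF assms(1)] vec_space.full_rank_iff[OF assms(1)] assms(2) by blast

lemma minor_nonzero_if_complex_full_rank:
  fixes A :: "real mat"
  assumes A: "A \<in> carrier_mat n k" and rank: "vec_space.rank n (cmat A) = k"
  shows "\<exists>f\<in>increasing k n. minor k (entries A) f \<noteq> 0"
proof (rule minor_nonzero_if_trivial_kernel[OF A])
  fix v assume v: "v \<in> carrier_vec k" "A *\<^sub>v v = 0\<^sub>v n"
  have "cmat A *\<^sub>v map_vec complex_of_real v = map_vec complex_of_real (A *\<^sub>v v)"
    using of_real_hom.mult_mat_vec_hom[OF A v(1)] by metis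
  also have "\<dots> = 0\<^sub>v n"
    unfolding v(2) by (intro eq_vecI) auto
  finally have "map_vec complex_of_real v = 0\<^sub>v k"
    using vec_space.full_rank_iff[of "cmat A" n k] A rank v(1) by auto
  then have "complex_of_real (v $ i) = 0" if "i < k" for i
    using that v(1) by (metis carrier_vecD index_map_vec(1) index_zero_vec(1))
  then show "v = 0\<^sub>v k"
    using v(1) by (intro eq_vecI) auto
qed

lemma minor_of_real: "minor k (\<lambda>a j. complex_of_real (Y a j)) f = complex_of_real (minor k Y f)"
  by (simp add: minor_leibniz)

section \<open>Real affine charts of the Grassmannian\<close>

text \<open>Interior and frontier depend on the ambient space: openness of \<open>f\<close> carries
  interiors over, and closedness of the image prevents the frontier from acquiring points outside
  it.\<close>

lemma ball_in_embedding:
  assumes cont: "continuous_map X Y f" and op: "open_map X Y f" and inj: "inj_on f (topspace X)"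
    and K: "closedin X K" and fK: "closedin Y (f ` K)" and ball: "ball_in X N K"
  shows "ball_in Y N (f ` K)"
proof -
  have emb: "embedding_map X Y f"
    by (rule injective_open_imp_embedding_map[OF cont op inj])
  have KX: "K \<subseteq> topspace X"
    using K by (rule closedin_subset)
  have hom: "subtopology Y (f ` S) homeomorphic_space subtopology X S" if S: "S \<subseteq> topspace X" for S
  proof -
    let ?Y = "subtopology Y (f ` topspace X)"
    have "f ` topspace X \<subseteq> topspace Y"
      using cont by (rule continuous_map_image_subset_topspace)
    then have "homeomorphic_map (subtopology X S) (subtopology ?Y (f ` S)) f"
      using emb S unfolding embedding_map_def
      by (intro homeomorphic_map_subtopologies) (auto simp: inf.absorb2)
    moreover have "f ` topspace X \<inter> f ` S = f ` S"
      using S by blast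
    ultimately have "homeomorphic_map (subtopology X S) (subtopology Y (f ` S)) f"
      by (simp add: subtopology_subtopology)
    then show ?thesis
      using homeomorphic_map_imp_homeomorphic_space homeomorphic_space_sym by blast
  qed
  have int: "Y interior_of (f ` K) = f ` (X interior_of K)"
  proof
    show "f ` (X interior_of K) \<subseteq> Y interior_of (f ` K)"
      using op interior_of_subset[of X K]
      by (intro interior_of_maximal image_mono) (auto simp: open_map_def)
    show "Y interior_of (f ` K) \<subseteq> f ` (X interior_of K)"
    proof
      fix y assume y: "y \<in> Y interior_of (f ` K)"
      let ?U = "{x \<in> topspace X. f x \<in> Y interior_of (f ` K)}"
      have U: "openin X ?U"
        by (rule openin_continuous_map_preimage[OF cont openin_interior_of])
      have "?U \<subseteq> K"
      proof
        fix x assume x: "x \<in> ?U"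
        then obtain x' where "x' \<in> K" "f x = f x'"
          using interior_of_subset[of Y "f ` K"] by blast
        then show "x \<in> K"
          using inj x KX by (auto dest: inj_onD)
      qed
      then have sub: "?U \<subseteq> X interior_of K"
        by (rule interior_of_maximal[OF _ U])
      obtain x where "x \<in> K" "y = f x"
        using y interior_of_subset[of Y "f ` K"] by blast
      then show "y \<in> f ` (X interior_of K)"
        using sub y KX by blast
    qed
  qed
  have frK: "X frontier_of K = K - X interior_of K"
    by (simp add: frontier_of_def closure_of_closedin[OF K])
  have "Y frontier_of (f ` K) = f ` K - f ` (X interior_of K)"
    by (simp add: frontier_of_def closure_of_closedin[OF fK] int)
  also have "\<dots> = f ` (K - X interior_of K)"
    using inj KX interior_of_subset[of X K]
    by (intro inj_on_image_set_diff[symmetric, of f "topspace X"]) auto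
  finally have fr: "Y frontier_of (f ` K) = f ` (X frontier_of K)"
    by (simp add: frK)
  have sub: "X interior_of K \<subseteq> topspace X" "X frontier_of K \<subseteq> topspace X"
    by (rule interior_of_subset_topspace, rule frontier_of_subset_topspace)
  show ?thesis
    using ball hom[OF KX] hom[OF sub(1)] hom[OF sub(2)]
    unfolding ball_in_def int fr using homeomorphic_space_trans by blast
qed

lemma continuous_map_entry:
  assumes "i < d" "j < k"
  shows "continuous_map (mat_topology d k) euclidean (\<lambda>A. A $$ (i, j))"
proof -
  have "continuous_map (product_topology (\<lambda>_. euclidean) ({..<d} \<times> {..<k})) euclidean (\<lambda>x. x (i, j))"
    using assms by (intro continuous_map_product_projection) auto
  from continuous_map_pullback[OF this]
  have "continuous_map (mat_topology d k) euclidean ((\<lambda>x. x (i, j)) \<circ> (\<lambda>A. \<lambda>p \<in> {..<d} \<times> {..<k}. A $$ p))"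
    unfolding mat_topology_def .
  then show ?thesis
    using assms by (simp add: o_def)
qed

lemma tendsto_entry:
  assumes "B \<in> frames k d" "i < d" "j < k"
  shows "((\<lambda>A. A $$ (i, j)) \<longlongrightarrow> B $$ (i, j)) (atin (frame_topology k d) B)"
proof -
  have "continuous_map (frame_topology k d) euclidean (\<lambda>A. A $$ (i, j))"
    unfolding frame_topology_def
    by (rule continuous_map_from_subtopology[OF continuous_map_entry[OF assms(2,3)]])
  then show ?thesis
    using assms(1) unfolding continuous_map_atin limitin_canonical_iff topspace_frame_topology by blast
qed

text \<open>The chart around the span of the first \<open>k\<close> columns of \<open>H\<close>, in
  the basis \<open>H\<close>. In the application \<open>H\<close> holds the images under Z of the
  first \<open>k + m\<close> eigenvectors.\<close>

locale grassmannian_chart =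
  fixes k m :: nat and H H' :: "nat \<Rightarrow> nat \<Rightarrow> real"
  assumes left_inverse: "\<And>i j. i < k + m \<Longrightarrow> j < k + m \<Longrightarrow> (\<Sum>l<k + m. H' i l * H l j) = of_bool (i = j)"
    and right_inverse: "\<And>i j. i < k + m \<Longrightarrow> j < k + m \<Longrightarrow> (\<Sum>l<k + m. H i l * H' l j) = of_bool (i = j)"
begin

abbreviation "d \<equiv> k + m"
abbreviation "E0 \<equiv> Euclidean_space (k * m)"
abbreviation "base \<equiv> restrict (\<lambda>i. i) {..<k}"

definition block :: "(nat \<Rightarrow> real) \<Rightarrow> nat \<Rightarrow> nat \<Rightarrow> real" where
  "block x l c = (if l < k then of_bool (l = c) else x ((l - k) * k + c))"

definition chart_mat :: "(nat \<Rightarrow> real) \<Rightarrow> real mat" where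
  "chart_mat x = mat d k (\<lambda>(r, c). \<Sum>l<d. H r l * block x l c)"

definition chart_point :: "(nat \<Rightarrow> real) \<Rightarrow> complex vec set" where
  "chart_point x = vec_space.col_space d (cmat (chart_mat x))"

text \<open>The columns of \<open>B\<close> in the basis \<open>H\<close>. \<open>B\<close> is
  complex because the topology is that of complex frames, although only real subspaces are
  charted.\<close>

definition pulled :: "complex mat \<Rightarrow> nat \<Rightarrow> nat \<Rightarrow> complex" where
  "pulled B l c = (\<Sum>r<d. complex_of_real (H' l r) * B $$ (r, c))"

text \<open>Meaningful only inside the chart, where the minor at \<open>base\<close> does not vanish.\<close>

definition coordinate :: "complex mat \<Rightarrow> nat \<Rightarrow> real" where
  "coordinate B a = (if a < k * m then
     Re (minor k (pulled B) (base(a mod k := k + a div k)) / minor k (pulled B) base) else 0)"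

text \<open>A change of frame multiplies all minors by one factor, so their ratios depend on the
  column space only.\<close>

lemma minor_pulled_mult:
  assumes B: "B \<in> carrier_mat d k" and G: "G \<in> carrier_mat k k"
  shows "minor k (pulled (B * G)) f = minor k (pulled B) f * det G"
proof -
  have "pulled (B * G) l c = (\<Sum>r<k. pulled B l r * G $$ (r, c))" if "c < k" for l c
  proof -
    have "pulled (B * G) l c = (\<Sum>q<d. complex_of_real (H' l q) * (\<Sum>r<k. B $$ (q, r) * G $$ (r, c)))"
      unfolding pulled_def using B G that
      by (intro sum.cong refl) (simp add: scalar_prod_def atLeast0LessThan)
    also have "\<dots> = (\<Sum>r<k. pulled B l r * G $$ (r, c))"
      unfolding pulled_def sum_distrib_left sum_distrib_right
      by (subst sum.swap) (simp add: mult.assoc)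
    finally show ?thesis .
  qed
  then have "minor k (pulled (B * G)) f = minor k (\<lambda>l c. \<Sum>r<k. pulled B l r * G $$ (r, c)) f"
    by (intro minor_cong)
  also have "\<dots> = minor k (pulled B) f * det (mat k k (\<lambda>(i, j). G $$ (i, j)))"
    by (rule minor_mult)
  also have "mat k k (\<lambda>(i, j). G $$ (i, j)) = G"
    using G by (intro eq_matI) auto
  finally show ?thesis .
qed

lemma pulled_cmat:
  assumes "A \<in> carrier_mat d k" "c < k"
  shows "pulled (cmat A) l c = complex_of_real (\<Sum>r<d. H' l r * A $$ (r, c))"
  using assms by (simp add: pulled_def)

lemma pulled_chart_mat:
  assumes "l < d" "c < k"
  shows "pulled (cmat (chart_mat x)) l c = complex_of_real (block x l c)"
proof -
  have "(\<Sum>r<d. H' l r * chart_mat x $$ (r, c)) = (\<Sum>r<d. H' l r * (\<Sum>q<d. H r q * block x q c))"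
    using assms by (intro sum.cong) (auto simp: chart_mat_def)
  also have "\<dots> = block x l c"
    using assms by (intro sum_mult_inverse left_inverse)
  finally show ?thesis
    using assms by (subst pulled_cmat) (auto simp: chart_mat_def)
qed

lemma minor_pulled_chart_mat:
  assumes "\<And>i. i < k \<Longrightarrow> f i < d"
  shows "minor k (pulled (cmat (chart_mat x))) f = complex_of_real (minor k (block x) f)"
  unfolding minor_of_real[symmetric] using assms by (intro minor_cong) (simp add: pulled_chart_mat)

lemma minor_block_base: "minor k (block x) base = 1"
proof -
  have "mat k k (\<lambda>(i, j). block x (base i) j) = 1\<^sub>m k"
    by (intro eq_matI) (auto simp: block_def)
  then show ?thesis
    by (simp add: minor_def)
qed

lemma index_bounds:
  assumes "a < k * m"
  shows "a mod k < k" "k + a div k < d"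
proof -
  show "a mod k < k"
    using assms by (cases k) auto
  show "k + a div k < d"
    using assms by (simp add: less_mult_imp_div_less mult.commute)
qed

lemma minor_block_replaced:
  assumes a: "a < k * m"
  shows "minor k (block x) (base(a mod k := k + a div k)) = x a"
proof -
  have "minor k (block x) (base(a mod k := k + a div k)) =
      minor k (\<lambda>b j. if b < k then of_bool (b = j) else x (a div k * k + j)) (\<lambda>r. if r = a mod k then k else r)"
    by (rule minor_cong) (auto simp: block_def)
  also have "\<dots> = x a"
    using index_bounds[OF a] by (simp add: minor_replace_row_identity)
  finally show ?thesis .
qed

lemma coordinate_chart_mat:
  assumes "x \<in> topspace E0"
  shows "coordinate (cmat (chart_mat x)) = x"
proof
  fix a
  show "coordinate (cmat (chart_mat x)) a = x a"
  proof (cases "a < k * m")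
    case True
    have "minor k (pulled (cmat (chart_mat x))) (base(a mod k := k + a div k)) = complex_of_real (x a)"
      using index_bounds[OF True]
      by (subst minor_pulled_chart_mat) (auto simp: minor_block_replaced[OF True])
    moreover have "minor k (pulled (cmat (chart_mat x))) base = 1"
      by (subst minor_pulled_chart_mat) (auto simp: minor_block_base)
    ultimately show ?thesis
      using True by (simp add: coordinate_def)
  next
    case False
    then show ?thesis
      using assms by (auto simp: coordinate_def topspace_Euclidean_space)
  qed
qed

lemma chart_mat_carrier: "chart_mat x \<in> carrier_mat d k"
  by (simp add: chart_mat_def)

lemma minor_of_mult:
  "minor k (\<lambda>r c. \<Sum>l<d. M r l * Y l c) f \<noteq> (0 :: real) \<Longrightarrow> \<exists>g\<in>increasing k d. minor k Y g \<noteq> 0"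
proof -
  assume nz: "minor k (\<lambda>r c. \<Sum>l<d. M r l * Y l c) f \<noteq> 0"
  show ?thesis
    by (rule nonzero_gram_imp_nonzero_minor[where A = "\<lambda>l i. M (f i) l"])
      (use nz in \<open>simp add: minor_def\<close>)
qed

lemma minor_pulled_nonzero:
  assumes A: "A \<in> carrier_mat d k" and rank: "vec_space.rank d (cmat A) = k"
  shows "\<exists>f\<in>increasing k d. minor k (pulled (cmat A)) f \<noteq> 0"
proof -
  obtain f where f: "f \<in> increasing k d" "minor k (entries A) f \<noteq> 0"
    using minor_nonzero_if_complex_full_rank[OF A rank] by blast
  let ?Y = "\<lambda>l c. \<Sum>r<d. H' l r * A $$ (r, c)"
  have "minor k (entries A) f = minor k (\<lambda>r c. \<Sum>l<d. H r l * ?Y l c) f"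
  proof (rule minor_cong)
    fix i c assume i: "i < k" "c < k"
    then have fi: "f i < d"
      using f by (auto simp: increasing_def)
    show "A $$ (f i, c) = (\<Sum>l<d. H (f i) l * ?Y l c)"
      by (rule sum_mult_inverse[OF right_inverse[OF fi] fi, symmetric])
  qed
  then obtain g where g: "g \<in> increasing k d" "minor k ?Y g \<noteq> 0"
    using minor_of_mult[of H ?Y f] f(2) by auto
  have "minor k (pulled (cmat A)) g = complex_of_real (minor k ?Y g)"
    unfolding minor_of_real[symmetric] using A by (intro minor_cong) (simp add: pulled_cmat)
  then have "minor k (pulled (cmat A)) g \<noteq> 0"
    using g(2) by simp
  then show ?thesis
    using g(1) by blast
qed

lemma chart_mat_frame: "cmat (chart_mat x) \<in> frames k d"
proof -
  let ?A = "cmat (chart_mat x)"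
  have A: "?A \<in> carrier_mat d k"
    using chart_mat_carrier by simp
  have "v = 0\<^sub>v k" if v: "v \<in> carrier_vec k" "?A *\<^sub>v v = 0\<^sub>v d" for v
  proof -
    let ?B = "mat d k (\<lambda>(l, c). pulled ?A l c)"
    have "?B *\<^sub>v v = 0\<^sub>v d"
    proof (rule eq_vecI)
      fix l assume "l < dim_vec (0\<^sub>v d :: complex vec)"
      then have l: "l < d" by simp
      have "(?B *\<^sub>v v) $ l = (\<Sum>c<k. pulled ?A l c * v $ c)"
        using l v by (simp add: scalar_prod_def atLeast0LessThan)
      also have "\<dots> = (\<Sum>r<d. complex_of_real (H' l r) * (?A *\<^sub>v v) $ r)"
      proof -
        have "(?A *\<^sub>v v) $ r = (\<Sum>c<k. ?A $$ (r, c) * v $ c)" if "r < d" for r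
          using A that v(1) by (simp add: scalar_prod_def atLeast0LessThan row_def del: index_map_mat)
        then show ?thesis
          unfolding pulled_def sum_distrib_right
          by (subst sum.swap) (simp add: mult.assoc sum_distrib_left)
      qed
      also have "\<dots> = 0"
        using v by simp
      finally show "(?B *\<^sub>v v) $ l = 0\<^sub>v d $ l"
        using l by simp
    qed simp
    moreover have "minor k (entries ?B) base = 1"
    proof -
      have "minor k (entries ?B) base = minor k (pulled ?A) base"
        by (rule minor_cong) auto
      also have "\<dots> = 1"
        by (subst minor_pulled_chart_mat) (auto simp: minor_block_base)
      finally show ?thesis .
    qed
    ultimately show ?thesis
      using trivial_kernel_if_minor_nonzero[of ?B d k base v] v by simp
  qed
  then show ?thesis
    using A vec_space.full_rank_iff[OF A] by (auto simp: frames_def)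
qed

lemma chart_point_Gr_real: "chart_point x \<in> Gr_real k d"
  using chart_mat_frame[of x] chart_mat_carrier[of x] col_space_frames[of d k]
  unfolding Gr_real_def chart_point_def by blast

lemma frames_eqD:
  assumes "A \<in> frames k d" "B \<in> frames k d" "vec_space.col_space d A = vec_space.col_space d B"
  shows "\<exists>s. s \<noteq> 0 \<and> (\<forall>f. minor k (pulled A) f = minor k (pulled B) f * s)"
proof -
  obtain G where G: "G \<in> carrier_mat k k" "det G \<noteq> 0" "A = B * G"
    using vec_space.col_space_eqD[of A d k B] assms by (auto simp: frames_def)
  then show ?thesis
    using minor_pulled_mult[of B G] assms(2) by (auto simp: frames_def)
qed

lemma coordinate_cong:
  assumes "A \<in> frames k d" "B \<in> frames k d" "vec_space.col_space d A = vec_space.col_space d B"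
  shows "coordinate A = coordinate B" "minor k (pulled A) base = 0 \<longleftrightarrow> minor k (pulled B) base = 0"
  using frames_eqD[OF assms] by (auto simp: coordinate_def fun_eq_iff)

lemma inj_chart_point: "inj_on chart_point (topspace E0)"
proof (rule inj_onI)
  fix x y assume xy: "x \<in> topspace E0" "y \<in> topspace E0" "chart_point x = chart_point y"
  then show "x = y"
    using coordinate_cong(1)[OF chart_mat_frame chart_mat_frame, of x y] coordinate_chart_mat
    by (simp add: chart_point_def)
qed

lemma continuous_map_chart_point: "continuous_map E0 (Gr_real_topology k d) chart_point"
proof -
  have entry: "continuous_map E0 euclidean (\<lambda>x. cmat (chart_mat x) $$ (r, c))" if "r < d" "c < k" for r c
  proof -
    have cont: "continuous_on S (\<lambda>x. block x l c)" for S l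
    proof (cases "l < k")
      case False
      then show ?thesis
        by (simp add: block_def continuous_on_subset[OF continuous_on_product_coordinates subset_UNIV])
    qed (simp add: block_def)
    have "continuous_on {x. \<forall>i\<ge>k * m. x i = 0} (\<lambda>x. complex_of_real (\<Sum>l<d. H r l * block x l c))"
      by (rule continuous_on_of_real, rule continuous_on_sum, rule continuous_on_mult_left, rule cont)
    then show ?thesis
      using that by (simp add: Euclidean_space_eq_top_of_set chart_mat_def)
  qed
  have "continuous_map E0 (mat_topology d k) (\<lambda>x. cmat (chart_mat x))"
    unfolding mat_topology_def
  proof (rule continuous_map_pullback')
    show "continuous_map E0 (product_topology (\<lambda>_. euclidean) ({..<d} \<times> {..<k}))
        ((\<lambda>A. \<lambda>p\<in>{..<d} \<times> {..<k}. A $$ p) \<circ> (\<lambda>x. cmat (chart_mat x)))"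
      unfolding continuous_map_componentwise
    proof (intro conjI ballI)
      fix p assume "p \<in> {..<d} \<times> {..<k}"
      then show "continuous_map E0 euclidean
          (\<lambda>x. ((\<lambda>A. \<lambda>p\<in>{..<d} \<times> {..<k}. A $$ p) \<circ> (\<lambda>x. cmat (chart_mat x))) x p)"
        using entry[of "fst p" "snd p"] by (auto simp: o_def)
    qed (auto simp: o_def)
  qed (use chart_mat_carrier in auto)
  then have "continuous_map E0 (frame_topology k d) (\<lambda>x. cmat (chart_mat x))"
    unfolding frame_topology_def continuous_map_in_subtopology using chart_mat_frame by auto
  moreover have "continuous_map (frame_topology k d) (Gr_topology k d) (vec_space.col_space d)"
    by (rule quotient_imp_continuous_map[OF quotient_map_Gr])
  ultimately have "continuous_map E0 (Gr_topology k d) (vec_space.col_space d \<circ> (\<lambda>x. cmat (chart_mat x)))"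
    by (rule continuous_map_compose)
  then show ?thesis
    using chart_point_Gr_real
    by (auto simp: Gr_real_topology_def continuous_map_in_subtopology o_def chart_point_def[abs_def])
qed

lemma tendsto_minor_pulled:
  assumes B: "B \<in> frames k d"
  shows "((\<lambda>A. minor k (pulled A) f) \<longlongrightarrow> minor k (pulled B) f) (atin (frame_topology k d) B)"
proof (rule tendsto_minor)
  fix i j assume "j < k"
  then show "((\<lambda>A. pulled A (f i) j) \<longlongrightarrow> pulled B (f i) j) (atin (frame_topology k d) B)"
    unfolding pulled_def by (intro tendsto_sum tendsto_mult_left tendsto_entry B) auto
qed

lemma continuous_map_minor_pulled:
  "continuous_map (frame_topology k d) euclidean (\<lambda>A. minor k (pulled A) f)"
  unfolding continuous_map_atin limitin_canonical_iff topspace_frame_topology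
  using tendsto_minor_pulled by blast

text \<open>\<open>inv\<close> says that \<open>S\<close> is saturated, hence the full preimage of
  its image under the quotient map.\<close>

lemma openin_Gr_realI:
  assumes "openin (frame_topology k d) S"
    and inv: "\<And>A B. A \<in> frames k d \<Longrightarrow> B \<in> S \<Longrightarrow>
      vec_space.col_space d A = vec_space.col_space d B \<Longrightarrow> A \<in> S"
  shows "openin (Gr_real_topology k d) (vec_space.col_space d ` S \<inter> Gr_real k d)"
proof -
  have S: "S \<subseteq> frames k d"
    using openin_subset[OF assms(1)] by (simp add: topspace_frame_topology)
  have "{A \<in> frames k d. vec_space.col_space d A \<in> vec_space.col_space d ` S} = S"
  proof (intro equalityI subsetI)
    fix A assume "A \<in> {A \<in> frames k d. vec_space.col_space d A \<in> vec_space.col_space d ` S}"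
    then obtain B where "A \<in> frames k d" "B \<in> S" "vec_space.col_space d A = vec_space.col_space d B"
      by auto
    then show "A \<in> S"
      by (rule inv)
  qed (use S in auto)
  moreover have "vec_space.col_space d ` S \<subseteq> Gr k d"
    using S col_space_frames[of d k] by blast
  ultimately have "openin (Gr_topology k d) (vec_space.col_space d ` S)"
    using assms(1) unfolding openin_Gr_topology by simp
  then show ?thesis
    unfolding Gr_real_topology_def openin_subtopology by blast
qed

text \<open>Cramer's rule: after division by the top block \<open>D\<close>, each remaining entry is
  a ratio of two minors. For a real matrix this ratio is real, so taking \<open>Re\<close> loses
  nothing.\<close>

lemma chart_point_coordinate:
  assumes A: "A \<in> carrier_mat d k" and frame: "cmat A \<in> frames k d" and nz: "minor k (pulled (cmat A)) base \<noteq> 0"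
  shows "chart_point (coordinate (cmat A)) = vec_space.col_space d (cmat A)"
proof -
  define Y where "Y l c = (\<Sum>r<d. H' l r * A $$ (r, c))" for l c
  have pm: "minor k (pulled (cmat A)) f = complex_of_real (minor k Y f)" for f
    unfolding minor_of_real[symmetric] Y_def using A by (intro minor_cong) (simp add: pulled_cmat)
  define D where "D = mat k k (\<lambda>(i, j). Y i j)"
  have detD: "det D = minor k Y base"
    unfolding minor_def D_def by (rule arg_cong[of _ _ det]) (rule eq_matI, auto)
  then have nzD: "det D \<noteq> 0"
    using nz pm[of base] by simp
  then obtain M where M: "\<forall>i<k. \<forall>j<k. (\<Sum>l<k. Y i l * M l j) = of_bool (i = j)"
    using det_nonzero_inverse[of k Y] unfolding D_def by blast
  define G where "G = mat k k (\<lambda>(i, j). M i j)"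
  have G: "G \<in> carrier_mat k k"
    by (simp add: G_def)
  have "D * G = 1\<^sub>m k"
    using M by (intro eq_matI) (auto simp: D_def G_def scalar_prod_def atLeast0LessThan)
  then have dets: "det D * det G = 1"
    using det_mult[of D k G] by (simp add: D_def G_def)
  then have nzG: "det G \<noteq> 0"
    by auto
  define x where "x = coordinate (cmat A)"
  define W where "W l c = (\<Sum>r<k. Y l r * M r c)" for l c
  have minorW: "minor k W f = minor k Y f / minor k Y base" for f
  proof -
    have "det G = 1 / det D"
      using dets nzD by (simp add: eq_divide_eq mult.commute)
    moreover have "minor k W f = minor k Y f * det G"
      unfolding W_def G_def by (rule minor_mult)
    ultimately show ?thesis
      by (simp add: detD)
  qed
  have W_top: "W l c = of_bool (l = c)" if "l < k" "c < k" for l c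
    using M that by (simp add: W_def)
  have block: "block x l c = W l c" if lc: "l < d" "c < k" for l c
  proof (cases "l < k")
    case True
    then show ?thesis
      using W_top lc by (simp add: block_def)
  next
    case False
    define a where "a = (l - k) * k + c"
    have a: "a mod k = c" "k + a div k = l"
      using lc False by (auto simp: a_def)
    have "a < (l - k + 1) * k"
      using lc by (simp add: a_def)
    also have "\<dots> \<le> m * k"
      using lc False by (intro mult_right_mono) auto
    finally have am: "a < k * m"
      by (simp add: mult.commute)
    have "block x l c = x a"
      using False by (simp add: block_def a_def)
    also have "\<dots> = minor k Y (base(c := l)) / minor k Y base"
      using am unfolding x_def coordinate_def a pm of_real_divide[symmetric] by simp
    also have "\<dots> = minor k W (base(c := l))"
      by (rule minorW[symmetric])
    also have "\<dots> = minor k (\<lambda>b j. if b < k then of_bool (b = j) else W l j) (\<lambda>r. if r = c then k else r)"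
      by (rule minor_cong) (auto simp: W_top)
    also have "\<dots> = W l c"
      by (rule minor_replace_row_identity[OF lc(2)])
    finally show ?thesis .
  qed
  have HY: "(\<Sum>l<d. H i l * Y l r) = A $$ (i, r)" if "i < d" for i r
    unfolding Y_def by (rule sum_mult_inverse[OF right_inverse[OF that] that])
  have "chart_mat x = A * G"
  proof (rule eq_matI)
    fix i j assume "i < dim_row (A * G)" "j < dim_col (A * G)"
    then have ij: "i < d" "j < k"
      using A G by auto
    have "chart_mat x $$ (i, j) = (\<Sum>l<d. H i l * block x l j)"
      using ij by (simp add: chart_mat_def)
    also have "\<dots> = (\<Sum>l<d. H i l * W l j)"
      using ij by (intro sum.cong) (simp_all add: block)
    also have "\<dots> = (\<Sum>r<k. (\<Sum>l<d. H i l * Y l r) * M r j)"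
      unfolding W_def sum_distrib_left sum_distrib_right by (subst sum.swap) (simp add: mult.assoc)
    also have "\<dots> = (\<Sum>r<k. A $$ (i, r) * M r j)"
      by (simp add: HY ij)
    also have "\<dots> = (A * G) $$ (i, j)"
      using A ij by (simp add: G_def scalar_prod_def atLeast0LessThan)
    finally show "chart_mat x $$ (i, j) = (A * G) $$ (i, j)" .
  qed (use A G in \<open>auto simp: chart_mat_def\<close>)
  then have "cmat (chart_mat x) = cmat A * cmat G"
    using of_real_hom.mat_hom_mult[OF A G] by simp
  moreover have "det (cmat G) \<noteq> 0"
    using nzG by (metis of_real_hom.hom_det of_real_eq_0_iff)
  ultimately show ?thesis
    unfolding chart_point_def x_def[symmetric] using A G
    by (simp add: vec_space.col_space_mult_invertible[of "cmat A" d k "cmat G"])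
qed

text \<open>The image of \<open>U\<close> consists of the real subspaces among those whose frames
  have \<open>coordinate\<close> in \<open>U\<close>; that set of complex frames is open and
  saturated.\<close>

lemma open_map_chart_point: "open_map E0 (Gr_real_topology k d) chart_point"
  unfolding open_map_def
proof (intro allI impI)
  fix U assume U: "openin E0 U"
  let ?D = "{A \<in> frames k d. minor k (pulled A) base \<noteq> 0}"
  let ?S = "{A \<in> ?D. coordinate A \<in> U}"
  have D: "openin (frame_topology k d) ?D"
  proof -
    have "openin euclidean (- {0 :: complex})"
      unfolding open_openin[symmetric] by (rule open_Compl) simp
    from openin_continuous_map_preimage[OF continuous_map_minor_pulled this, of base] show ?thesis
      by (simp add: topspace_frame_topology)
  qed
  have "continuous_map (subtopology (frame_topology k d) ?D) E0 coordinate"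
  proof -
    have "continuous_map (subtopology (frame_topology k d) ?D) euclideanreal (\<lambda>A. coordinate A a)" for a
    proof (cases "a < k * m")
      case True
      have "continuous_map (subtopology (frame_topology k d) ?D) euclideanreal
          (\<lambda>A. Re (minor k (pulled A) (base(a mod k := k + a div k)) / minor k (pulled A) base))"
        unfolding continuous_map_atin limitin_canonical_iff
      proof
        fix B assume B: "B \<in> topspace (subtopology (frame_topology k d) ?D)"
        have lim: "((\<lambda>A. minor k (pulled A) f) \<longlongrightarrow> minor k (pulled B) f)
            (atin (subtopology (frame_topology k d) ?D) B)" for f
          using continuous_map_from_subtopology[OF continuous_map_minor_pulled, of ?D f] B
          unfolding continuous_map_atin limitin_canonical_iff by blast
        have "minor k (pulled B) base \<noteq> 0"
          using B by (simp add: topspace_frame_topology)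
        from tendsto_Re[OF tendsto_divide[OF lim lim this]]
        show "((\<lambda>A. Re (minor k (pulled A) (base(a mod k := k + a div k)) / minor k (pulled A) base)) \<longlongrightarrow>
            Re (minor k (pulled B) (base(a mod k := k + a div k)) / minor k (pulled B) base))
            (atin (subtopology (frame_topology k d) ?D) B)" .
      qed
      then show ?thesis
        using True by (simp add: coordinate_def)
    qed (simp add: coordinate_def)
    then have "continuous_map (subtopology (frame_topology k d) ?D) (powertop_real UNIV) coordinate"
      by (simp add: continuous_map_componentwise_UNIV)
    then show ?thesis
      unfolding Euclidean_space_def continuous_map_in_subtopology by (auto simp: coordinate_def)
  qed
  from openin_continuous_map_preimage[OF this U]
  have "openin (subtopology (frame_topology k d) ?D) {A \<in> topspace (subtopology (frame_topology k d) ?D). coordinate A \<in> U}" .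
  moreover have "{A \<in> topspace (subtopology (frame_topology k d) ?D). coordinate A \<in> U} = ?S"
    by (auto simp: topspace_frame_topology)
  ultimately have S: "openin (frame_topology k d) ?S"
    using openin_trans_full[OF _ D] by simp
  have "openin (Gr_real_topology k d) (vec_space.col_space d ` ?S \<inter> Gr_real k d)"
  proof (rule openin_Gr_realI[OF S])
    fix A B assume "A \<in> frames k d" "B \<in> ?S" "vec_space.col_space d A = vec_space.col_space d B"
    then show "A \<in> ?S"
      using coordinate_cong[of A B] by auto
  qed
  moreover have "vec_space.col_space d ` ?S \<inter> Gr_real k d = chart_point ` U"
  proof (intro equalityI subsetI)
    fix W assume "W \<in> vec_space.col_space d ` ?S \<inter> Gr_real k d"
    then obtain B A where B: "B \<in> ?S" "W = vec_space.col_space d B"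
      and A: "A \<in> carrier_mat d k" "W = vec_space.col_space d (cmat A)" and W: "W \<in> Gr k d"
      by (auto simp: Gr_real_def)
    have "vec_space.rank d (cmat A) = k"
      using W unfolding A(2) Gr_def vec_space.rank_def vec_space.col_space_def by simp
    then have frame: "cmat A \<in> frames k d"
      using A by (auto simp: frames_def)
    then have "coordinate (cmat A) \<in> U" "minor k (pulled (cmat A)) base \<noteq> 0"
      using coordinate_cong[of "cmat A" B] A B by auto
    then show "W \<in> chart_point ` U"
      using chart_point_coordinate[OF A(1) frame] A(2) by (metis image_eqI)
  next
    fix W assume "W \<in> chart_point ` U"
    then obtain x where x: "x \<in> U" "W = chart_point x"
      by blast
    then have "x \<in> topspace E0"
      using U openin_subset by blast
    then have "coordinate (cmat (chart_mat x)) \<in> U"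
      using x by (simp add: coordinate_chart_mat)
    moreover have "minor k (pulled (cmat (chart_mat x))) base \<noteq> 0"
      by (subst minor_pulled_chart_mat) (auto simp: minor_block_base)
    ultimately have "cmat (chart_mat x) \<in> ?S"
      using chart_mat_frame by blast
    then show "W \<in> vec_space.col_space d ` ?S \<inter> Gr_real k d"
      using x chart_point_Gr_real[of x] by (auto simp: chart_point_def)
  qed
  ultimately show "openin (Gr_real_topology k d) (chart_point ` U)"
    by simp
qed

text \<open>A subspace outside the chart is separated from a compact part of the chart because there the
  ratios of the minors to the one at \<open>base\<close> are bounded.\<close>

lemma closedin_chart_image:
  assumes K: "compactin E0 K"
  shows "closedin (Gr_real_topology k d) (chart_point ` K)"
proof -
  have top: "topspace (Gr_real_topology k d) = Gr_real k d"
    by (auto simp: Gr_real_topology_def topspace_Gr_topology Gr_real_def)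
  have KE: "K \<subseteq> topspace E0"
    using K compactin_subset_topspace by blast
  have compact: "compact K"
    using K unfolding Euclidean_space_eq_top_of_set compactin_subtopology by simp
  have "\<exists>b. \<forall>x\<in>K. \<bar>minor k (block x) f\<bar> \<le> b" for f
  proof -
    have "continuous_on K (\<lambda>x. minor k (block x) f)"
      unfolding continuous_on_def
    proof (rule ballI, rule tendsto_minor)
      fix x i c assume "x \<in> K"
      have "continuous_on K (\<lambda>y. y ((f i - k) * k + c))"
        by (rule continuous_on_subset[OF continuous_on_product_coordinates subset_UNIV])
      then show "((\<lambda>y. block y (f i) c) \<longlongrightarrow> block x (f i) c) (at x within K)"
        using \<open>x \<in> K\<close> by (cases "f i < k") (simp_all add: block_def continuous_on_def)
    qed
    then have "compact ((\<lambda>x. minor k (block x) f) ` K)"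
      using compact by (rule compact_continuous_image)
    then show ?thesis
      by (auto dest!: compact_imp_bounded simp: bounded_real)
  qed
  then obtain b where b: "\<And>f x. x \<in> K \<Longrightarrow> \<bar>minor k (block x) f\<bar> \<le> b f"
    by metis
  \<comment> \<open>Frames violating one of the bounds valid on \<open>K\<close>. Real frames
    outside the chart are among them, since their minor at \<open>base\<close> is 0 while another is
    not.\<close>
  let ?N = "\<Union>f\<in>increasing k d. {A \<in> frames k d. b f * cmod (minor k (pulled A) base) < cmod (minor k (pulled A) f)}"
  have "openin (frame_topology k d) {A \<in> frames k d. b f * cmod (minor k (pulled A) base) < cmod (minor k (pulled A) f)}" for f
  proof -
    have "continuous_map (frame_topology k d) euclideanreal
        (\<lambda>A. cmod (minor k (pulled A) f) - b f * cmod (minor k (pulled A) base))"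
      unfolding continuous_map_atin limitin_canonical_iff topspace_frame_topology
    proof
      fix B assume B: "B \<in> frames k d"
      show "((\<lambda>A. cmod (minor k (pulled A) f) - b f * cmod (minor k (pulled A) base)) \<longlongrightarrow>
          cmod (minor k (pulled B) f) - b f * cmod (minor k (pulled B) base)) (atin (frame_topology k d) B)"
        by (rule tendsto_diff[OF tendsto_norm[OF tendsto_minor_pulled[OF B]]
              tendsto_mult_left[OF tendsto_norm[OF tendsto_minor_pulled[OF B]]]])
    qed
    from openin_continuous_map_preimage[OF this, of "{0<..}"] show ?thesis
      by (simp add: topspace_frame_topology)
  qed
  then have N: "openin (frame_topology k d) ?N"
    by auto
  have openN: "openin (Gr_real_topology k d) (vec_space.col_space d ` ?N \<inter> Gr_real k d)"
  proof (rule openin_Gr_realI[OF N])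
    fix A B assume AB: "A \<in> frames k d" "B \<in> ?N" "vec_space.col_space d A = vec_space.col_space d B"
    then obtain f where f: "f \<in> increasing k d" "B \<in> frames k d"
        "b f * cmod (minor k (pulled B) base) < cmod (minor k (pulled B) f)"
      by blast
    obtain s where s: "s \<noteq> 0" "\<And>f. minor k (pulled A) f = minor k (pulled B) f * s"
      using frames_eqD[OF AB(1) f(2) AB(3)] by blast
    have "b f * cmod (minor k (pulled B) base) * cmod s < cmod (minor k (pulled B) f) * cmod s"
      using f(3) s(1) by (intro mult_strict_right_mono) auto
    then have "b f * cmod (minor k (pulled A) base) < cmod (minor k (pulled A) f)"
      by (simp add: s(2) norm_mult mult.assoc)
    then show "A \<in> ?N"
      using AB(1) f(1) by blast
  qed
  have "closedin E0 K"
    using compact KE by (simp add: closedin_Euclidean_space_iff compact_imp_closed)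
  then have "openin E0 (topspace E0 - K)"
    by (rule openin_diff[OF openin_topspace])
  then have openC: "openin (Gr_real_topology k d) (chart_point ` (topspace E0 - K))"
    using open_map_chart_point by (simp add: open_map_def)
  have compl: "Gr_real k d - chart_point ` K =
      (vec_space.col_space d ` ?N \<inter> Gr_real k d) \<union> chart_point ` (topspace E0 - K)"
  proof (intro equalityI subsetI)
    fix W assume W: "W \<in> Gr_real k d - chart_point ` K"
    then obtain A where A: "A \<in> carrier_mat d k" "W = vec_space.col_space d (cmat A)" and Gr: "W \<in> Gr k d"
      by (auto simp: Gr_real_def)
    have rank: "vec_space.rank d (cmat A) = k"
      using Gr unfolding A(2) Gr_def vec_space.rank_def vec_space.col_space_def by simp
    then have frame: "cmat A \<in> frames k d"
      using A by (auto simp: frames_def)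
    show "W \<in> (vec_space.col_space d ` ?N \<inter> Gr_real k d) \<union> chart_point ` (topspace E0 - K)"
    proof (cases "minor k (pulled (cmat A)) base = 0")
      case True
      obtain f where "f \<in> increasing k d" "minor k (pulled (cmat A)) f \<noteq> 0"
        using minor_pulled_nonzero[OF A(1) rank] by blast
      then have "cmat A \<in> ?N"
        using frame True by auto
      then show ?thesis
        using A W by blast
    next
      case False
      then have eq: "chart_point (coordinate (cmat A)) = W"
        using chart_point_coordinate[OF A(1) frame] A(2) by simp
      moreover have "coordinate (cmat A) \<in> topspace E0"
        by (auto simp: coordinate_def topspace_Euclidean_space)
      moreover have "coordinate (cmat A) \<notin> K"
        using eq W by blast
      ultimately show ?thesis
        by blast
    qed
  next
    fix W assume W: "W \<in> (vec_space.col_space d ` ?N \<inter> Gr_real k d) \<union> chart_point ` (topspace E0 - K)"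
    have "W \<in> Gr_real k d"
      using W chart_point_Gr_real by blast
    moreover have "W \<notin> chart_point ` K"
    proof
      assume "W \<in> chart_point ` K"
      then obtain x where x: "x \<in> K" "W = chart_point x"
        by blast
      consider "W \<in> vec_space.col_space d ` ?N" | y where "y \<in> topspace E0 - K" "W = chart_point y"
        using W by blast
      then show False
      proof cases
        case 1
        then obtain B f where B: "B \<in> frames k d" "W = vec_space.col_space d B" "f \<in> increasing k d"
            "b f * cmod (minor k (pulled B) base) < cmod (minor k (pulled B) f)"
          by blast
        let ?A = "cmat (chart_mat x)"
        obtain s where s: "s \<noteq> 0" "\<And>f. minor k (pulled B) f = minor k (pulled ?A) f * s"
          using frames_eqD[OF B(1) chart_mat_frame[of x]] B(2) x(2) by (auto simp: chart_point_def)
        have fd: "f i < d" if "i < k" for i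
          using B(3) that by (auto simp: increasing_def)
        have "minor k (pulled ?A) f = complex_of_real (minor k (block x) f)"
          by (rule minor_pulled_chart_mat[OF fd])
        moreover have "minor k (pulled ?A) base = 1"
          by (subst minor_pulled_chart_mat) (auto simp: minor_block_base)
        ultimately have "b f * cmod s < \<bar>minor k (block x) f\<bar> * cmod s"
          using B(4) by (simp add: s(2) norm_mult)
        then have "b f < \<bar>minor k (block x) f\<bar>"
          by (simp add: mult_less_cancel_right)
        then show False
          using b[OF x(1), of f] by simp
      next
        case (2 y)
        then show False
          using x inj_chart_point KE by (auto dest: inj_onD)
      qed
    qed
    ultimately show "W \<in> Gr_real k d - chart_point ` K"
      by blast
  qed
  have "openin (Gr_real_topology k d) (Gr_real k d - chart_point ` K)"
    unfolding compl by (rule openin_Un[OF openN openC])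
  moreover have "chart_point ` K \<subseteq> Gr_real k d"
    using chart_point_Gr_real by (rule image_subsetI)
  ultimately show ?thesis
    by (simp add: closedin_def top)
qed

theorem ball_in_chart:
  assumes "contracted_body (k * m) \<mu> K"
  shows "ball_in (Gr_real_topology k d) (k * m) (chart_point ` K)"
proof -
  interpret contracted_body "k * m" \<mu> K
    by (rule assms)
  show ?thesis
    by (rule ball_in_embedding[OF continuous_map_chart_point open_map_chart_point inj_chart_point
          closedin closedin_chart_image[OF compactin] ball_in_Euclidean_space])
qed

end

section \<open>Amplituhedra whose kernel is an eigenspace\<close>

lemma pick_image:
  assumes mono: "strict_mono_on {..<k} f" and r: "r < k"
  shows "pick (f ` {..<k}) r = f r"
proof -
  have inj: "inj_on f {..<k}"
    using mono by (rule strict_mono_on_imp_inj_on)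
  have "{a \<in> f ` {..<k}. a < f r} = f ` {..<r}"
    using mono r by (auto simp: strict_mono_on_less)
  also have "card \<dots> = r"
    using inj r by (subst card_image) (auto intro: inj_on_subset)
  finally show ?thesis
    using pick_card_in_set[of "f r" "f ` {..<k}"] r by simp
qed

lemma increasing_onto:
  assumes "I \<subseteq> {..<n}" "card I = k"
  shows "\<exists>f\<in>increasing k n. f ` {..<k} = I"
proof -
  have "finite I"
    using assms(1) finite_subset by blast
  then obtain h where h: "bij_betw h {0..<k} I"
    using ex_bij_betw_nat_finite[of I] assms(2) by blast
  let ?h = "restrict h {..<k}"
  have inj: "inj_on ?h {..<k}" and im: "?h ` {..<k} = I"
    using h by (auto simp: bij_betw_def atLeast0LessThan inj_on_def)
  then have "?h \<in> {..<k} \<rightarrow>\<^sub>E {..<n}"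
    using assms(1) by auto
  from sort_tuple[OF this inj, where 'a = int]
  obtain g where "g \<in> increasing k n" "g ` {..<k} = ?h ` {..<k}"
    by blast
  then show ?thesis
    using im by auto
qed

lemma image_increasing:
  assumes "f \<in> increasing k n"
  shows "f ` {..<k} \<subseteq> {..<n}" "card (f ` {..<k}) = k"
  using assms by (auto simp: increasing_def card_image strict_mono_on_imp_inj_on)

lemma det_submatrix_rows:
  assumes A: "A \<in> carrier_mat n k'" and f: "f \<in> increasing k n" and "k \<le> k'"
  shows "det (submatrix A (f ` {..<k}) {..<k}) = minor k (entries A) f"
    and "k = k' \<Longrightarrow> det (submatrix A (f ` {..<k}) UNIV) = minor k (entries A) f"
proof -
  have mono: "strict_mono_on {..<k} f"
    using f by (simp add: increasing_def)
  have rows: "card {i. i < dim_row A \<and> i \<in> f ` {..<k}} = k"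
  proof -
    have "{i. i < dim_row A \<and> i \<in> f ` {..<k}} = f ` {..<k}"
      using A image_increasing(1)[OF f] by auto
    then show ?thesis
      using image_increasing(2)[OF f] by simp
  qed
  have cols: "card {j. j < dim_col A \<and> j \<in> {..<k}} = k"
  proof -
    have "{j. j < dim_col A \<and> j \<in> {..<k}} = {..<k}"
      using A assms(3) by auto
    then show ?thesis
      by simp
  qed
  have pick: "pick {..<k} j = j" if "j < k" for j
    using pick_image[of k "\<lambda>i. i" j] that by (simp add: strict_mono_on_ident)
  have "submatrix A (f ` {..<k}) {..<k} = mat k k (\<lambda>(i, j). A $$ (f i, j))"
    unfolding submatrix_def rows cols
    by (rule eq_matI) (auto simp: pick pick_image[OF mono])
  then show "det (submatrix A (f ` {..<k}) {..<k}) = minor k (entries A) f"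
    by (simp add: minor_def)
  assume "k = k'"
  then have cols': "card {j. j < dim_col A \<and> j \<in> UNIV} = k"
    using A by simp
  have "submatrix A (f ` {..<k}) UNIV = mat k k (\<lambda>(i, j). A $$ (f i, j))"
    unfolding submatrix_def rows cols'
    by (rule eq_matI) (auto simp: pick_UNIV pick_image[OF mono])
  then show "det (submatrix A (f ` {..<k}) UNIV) = minor k (entries A) f"
    by (simp add: minor_def)
qed

lemma det_submatrix_columns:
  assumes Z: "Z \<in> carrier_mat d n" and f: "f \<in> increasing d n"
  shows "det (submatrix Z UNIV (f ` {..<d})) = minor d (\<lambda>a i. Z $$ (i, a)) f"
proof -
  have mono: "strict_mono_on {..<d} f"
    using f by (simp add: increasing_def)
  have cols: "card {j. j < dim_col Z \<and> j \<in> f ` {..<d}} = d"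
  proof -
    have "{j. j < dim_col Z \<and> j \<in> f ` {..<d}} = f ` {..<d}"
      using Z image_increasing(1)[OF f] by auto
    then show ?thesis
      using image_increasing(2)[OF f] by simp
  qed
  have rows: "card {i. i < dim_row Z \<and> i \<in> UNIV} = d"
    using Z by simp
  have "submatrix Z UNIV (f ` {..<d}) = transpose_mat (mat d d (\<lambda>(i, j). Z $$ (j, f i)))"
    unfolding submatrix_def rows cols
    by (rule eq_matI) (auto simp: pick_UNIV pick_image[OF mono])
  then show ?thesis
    by (simp add: det_transpose[of _ d] minor_def)
qed

lemma maximal_minors_posD:
  assumes "Z \<in> carrier_mat d n" "maximal_minors_pos d n Z" "f \<in> increasing d n"
  shows "0 < minor d (\<lambda>a i. Z $$ (i, a)) f"
  using assms image_increasing[OF assms(3)] det_submatrix_columns[OF assms(1,3)]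
  unfolding maximal_minors_pos_def by metis

lemma image_col_space:
  fixes Z :: "'a :: field mat"
  assumes Z: "Z \<in> carrier_mat d n" and A: "A \<in> carrier_mat n k"
  shows "(\<lambda>v. Z *\<^sub>v v) ` vec_space.col_space n A = vec_space.col_space d (Z * A)"
proof -
  have "Z * A \<in> carrier_mat d k"
    using Z A by simp
  then show ?thesis
    using assoc_mult_mat_vec[OF Z A]
    by (simp add: vec_space.col_space_image[of _ _ k] A image_image)
qed

lemma det_diagonal: "det (mat k k (\<lambda>(i, j). of_bool (i = j) * e j)) = (\<Prod>j<k. e j)"
proof -
  have "minor k (\<lambda>a j. of_bool (a = j)) (\<lambda>i. i) = (1 :: 'a)"
  proof -
    have "mat k k (\<lambda>(i, j). of_bool (i = j)) = (1\<^sub>m k :: 'a mat)"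
      by (intro eq_matI) auto
    then show ?thesis
      by (simp add: minor_def)
  qed
  then show ?thesis
    using minor_scale_columns[of k "\<lambda>a j. of_bool (a = j)" e "\<lambda>i. i"] by (simp add: minor_def)
qed

context chart_at_top begin

text \<open>Since Z kills the last eigenvectors, it equals \<open>H\<close> times the transpose of
  the first \<open>k + m\<close> columns of \<open>Q\<close>. Applied to a frame in the chart this
  is \<open>H\<close> times the truncated block, so the amplituhedron is the chart image of
  \<open>body\<close>.\<close>

theorem ball_in_amplituhedron:
  assumes Z: "Z \<in> carrier_mat (k + m) n" and pos: "maximal_minors_pos (k + m) n Z"
    and kernel: "\<And>r c. r < k + m \<Longrightarrow> k + m \<le> c \<Longrightarrow> c < n \<Longrightarrow> (\<Sum>a<n. Z $$ (r, a) * Q a c) = 0"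
  shows "ball_in (Gr_real_topology k (k + m)) (k * m) (amplituhedron n k Z)"
proof -
  let ?d = "k + m"
  define H where "H r c = (\<Sum>a<n. Z $$ (r, a) * Q a c)" for r c
  have Z_eq: "Z $$ (r, a) = (\<Sum>c<?d. H r c * Q a c)" if "r < ?d" "a < n" for r a
  proof -
    have "(\<Sum>c<?d. H r c * Q a c) = (\<Sum>c<n. H r c * Q a c)"
      using km kernel[OF that(1)] by (intro sum.mono_neutral_left) (auto simp: H_def)
    also have "\<dots> = (\<Sum>c<n. Q a c * (\<Sum>b<n. Q b c * Z $$ (r, b)))"
      by (simp add: H_def mult.commute)
    also have "\<dots> = Z $$ (r, a)"
      by (rule sum_mult_inverse[OF orthonormal_rows[OF that(2)] that(2)])
    finally show ?thesis ..
  qed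
  \<comment> \<open>The maximal minor of Z at its first \<open>k + m\<close> columns is a minor of
    \<open>Q\<close> times this determinant.\<close>
  have detH: "det (mat ?d ?d (\<lambda>(i, j). H i j)) \<noteq> 0"
  proof
    assume zero: "det (mat ?d ?d (\<lambda>(i, j). H i j)) = 0"
    define f where "f = restrict (\<lambda>i. i) {..<?d}"
    have f: "f \<in> increasing ?d n"
      using km by (auto simp: f_def increasing_def strict_mono_on_def)
    have "minor ?d (\<lambda>a i. Z $$ (i, a)) f = minor ?d (\<lambda>a i. \<Sum>c<?d. Q a c * H i c) f"
      using km by (intro minor_cong) (simp add: Z_eq mult.commute f_def)
    also have "\<dots> = minor ?d Q f * det (mat ?d ?d (\<lambda>(i, j). H j i))"
      by (rule minor_mult)
    also have "det (mat ?d ?d (\<lambda>(i, j). H j i)) = det (transpose_mat (mat ?d ?d (\<lambda>(i, j). H i j)))"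
      by (rule arg_cong[of _ _ det]) (rule eq_matI, auto)
    also have "\<dots> = 0"
      using zero by (subst det_transpose[of _ ?d]) auto
    finally show False
      using maximal_minors_posD[OF Z pos f] by simp
  qed
  obtain H' where H': "\<forall>i<?d. \<forall>j<?d. (\<Sum>l<?d. H i l * H' l j) = of_bool (i = j)"
      "\<forall>i<?d. \<forall>j<?d. (\<Sum>l<?d. H' i l * H l j) = of_bool (i = j)"
    using det_nonzero_inverse[OF detH] by blast
  interpret gr: grassmannian_chart k m H H'
    using H' by unfold_locales auto
  have block: "gr.block (leading_coords (k * m) x) l c = chart k (coords x) l c" if lc: "l < ?d" "c < k" for x l c
  proof (cases "l < k")
    case False
    have "(l - k) * k + c < (l - k + 1) * k"
      using lc by simp
    also have "\<dots> \<le> m * k"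
      using lc False by (intro mult_right_mono) auto
    finally show ?thesis
      using False by (simp add: gr.block_def chart_def coords_def leading_coords_def mult.commute)
  qed (simp add: gr.block_def chart_def)
  have ZA: "Z * A = gr.chart_mat (leading_coords (k * m) x) * G"
    if A: "A \<in> carrier_mat n k" and G: "G \<in> carrier_mat k k"
      and eq: "\<And>a c. a < n \<Longrightarrow> c < k \<Longrightarrow> A $$ (a, c) = (\<Sum>r<k. fr x a r * G $$ (r, c))" for A G x
  proof (rule eq_matI)
    fix r c assume "r < dim_row (gr.chart_mat (leading_coords (k * m) x) * G)"
      "c < dim_col (gr.chart_mat (leading_coords (k * m) x) * G)"
    then have rc: "r < ?d" "c < k"
      using gr.chart_mat_carrier[of "leading_coords (k * m) x"] G by auto
    have Zfr: "(\<Sum>a<n. Z $$ (r, a) * fr x a q) = gr.chart_mat (leading_coords (k * m) x) $$ (r, q)" if "q < k" for q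
    proof -
      have "(\<Sum>a<n. Z $$ (r, a) * fr x a q) = (\<Sum>a<n. (\<Sum>l<?d. H r l * Q a l) * fr x a q)"
        using rc by (intro sum.cong) (simp_all add: Z_eq)
      also have "\<dots> = (\<Sum>l<?d. H r l * (\<Sum>a<n. Q a l * fr x a q))"
        unfolding sum_distrib_left sum_distrib_right by (subst sum.swap) (simp add: mult.assoc)
      also have "\<dots> = (\<Sum>l<?d. H r l * gr.block (leading_coords (k * m) x) l q)"
        using km that by (intro sum.cong) (simp_all add: gram_chart block)
      finally show ?thesis
        using rc that by (simp add: gr.chart_mat_def)
    qed
    have "(Z * A) $$ (r, c) = (\<Sum>a<n. Z $$ (r, a) * A $$ (a, c))"
      using Z A rc by (simp add: scalar_prod_def atLeast0LessThan)
    also have "\<dots> = (\<Sum>a<n. Z $$ (r, a) * (\<Sum>q<k. fr x a q * G $$ (q, c)))"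
      using rc by (intro sum.cong) (simp_all add: eq)
    also have "\<dots> = (\<Sum>q<k. (\<Sum>a<n. Z $$ (r, a) * fr x a q) * G $$ (q, c))"
      unfolding sum_distrib_left sum_distrib_right by (subst sum.swap) (simp add: mult.assoc)
    also have "\<dots> = (\<Sum>q<k. gr.chart_mat (leading_coords (k * m) x) $$ (r, q) * G $$ (q, c))"
      by (intro sum.cong) (simp_all add: Zfr)
    also have "\<dots> = (gr.chart_mat (leading_coords (k * m) x) * G) $$ (r, c)"
      using rc G gr.chart_mat_carrier[of "leading_coords (k * m) x"] by (simp add: scalar_prod_def atLeast0LessThan)
    finally show "(Z * A) $$ (r, c) = (gr.chart_mat (leading_coords (k * m) x) * G) $$ (r, c)" .
  qed (use Z A G gr.chart_mat_carrier[of "leading_coords (k * m) x"] in auto)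
  have image: "(\<lambda>v. cmat Z *\<^sub>v v) ` vec_space.col_space n (cmat A) = gr.chart_point (leading_coords (k * m) x)"
    if A: "A \<in> carrier_mat n k" and G: "G \<in> carrier_mat k k" and det: "det G \<noteq> 0"
      and eq: "\<And>a c. a < n \<Longrightarrow> c < k \<Longrightarrow> A $$ (a, c) = (\<Sum>r<k. fr x a r * G $$ (r, c))" for A G x
  proof -
    have "cmat Z * cmat A = cmat (Z * A)"
      by (rule of_real_hom.mat_hom_mult[OF Z A, symmetric])
    also have "Z * A = gr.chart_mat (leading_coords (k * m) x) * G"
      by (rule ZA[OF A G]) (rule eq)
    also have "cmat \<dots> = cmat (gr.chart_mat (leading_coords (k * m) x)) * cmat G"
      by (rule of_real_hom.mat_hom_mult[OF gr.chart_mat_carrier G])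
    finally have ZA': "cmat Z * cmat A = cmat (gr.chart_mat (leading_coords (k * m) x)) * cmat G" .
    have "det (cmat G) \<noteq> 0"
      using det by (metis of_real_hom.hom_det of_real_eq_0_iff)
    then have "vec_space.col_space ?d (cmat (gr.chart_mat (leading_coords (k * m) x)) * cmat G) =
        gr.chart_point (leading_coords (k * m) x)"
      unfolding gr.chart_point_def using gr.chart_mat_carrier[of "leading_coords (k * m) x"] G
      by (intro vec_space.col_space_mult_invertible) auto
    moreover have "(\<lambda>v. cmat Z *\<^sub>v v) ` vec_space.col_space n (cmat A) = vec_space.col_space ?d (cmat Z * cmat A)"
      using Z A by (intro image_col_space) auto
    ultimately show ?thesis
      by (simp add: ZA')
  qed
  have "amplituhedron n k Z = gr.chart_point ` body"
  proof (intro equalityI subsetI)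
    fix W assume "W \<in> amplituhedron n k Z"
    then obtain A where A: "A \<in> carrier_mat n k" "vec_space.rank n A = k"
        and minors: "\<And>I. I \<subseteq> {..<n} \<Longrightarrow> card I = k \<Longrightarrow> 0 \<le> det (submatrix A I UNIV)"
        and W: "W = (\<lambda>v. cmat Z *\<^sub>v v) ` vec_space.col_space n (cmat A)"
      unfolding amplituhedron_def Gr_nonneg_def by blast
    have "0 \<le> minor k (entries A) f" if "f \<in> increasing k n" for f
      using minors[OF image_increasing[OF that]] det_submatrix_rows(2)[OF A(1) that] by simp
    from nonneg_matrix_in_chart[OF this minor_nonzero_if_full_rank[OF A]]
    obtain x G where x: "x \<in> nonneg_coords" and G: "det (mat k k (\<lambda>(i, j). G i j)) \<noteq> 0"
        "\<forall>a<n. \<forall>c<k. A $$ (a, c) = (\<Sum>r<k. fr x a r * G r c)"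
      by blast
    have "W = gr.chart_point (leading_coords (k * m) x)"
      unfolding W using G by (intro image[OF A(1), of "mat k k (\<lambda>(i, j). G i j)"]) auto
    then show "W \<in> gr.chart_point ` body"
      using x by (simp add: body_def)
  next
    fix W assume "W \<in> gr.chart_point ` body"
    then obtain x where x: "x \<in> nonneg_coords" and W: "W = gr.chart_point (leading_coords (k * m) x)"
      by (auto simp: body_def)
    from chart_gives_nonneg_matrix[OF x]
    obtain e where e: "(\<Prod>j<k. e j) \<noteq> 0" "\<forall>f\<in>increasing k n. 0 \<le> minor k (\<lambda>a j. fr x a j * e j) f"
      by (elim exE conjE)
    define A where "A = mat n k (\<lambda>(a, j). fr x a j * e j)"
    have A: "A \<in> carrier_mat n k"
      by (simp add: A_def)
    have range: "f i < n" if "f \<in> increasing k n" "i < k" for f i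
      using image_increasing(1)[OF that(1)] that(2) by blast
    have minor_A: "minor k (entries A) f = minor k (\<lambda>a j. fr x a j * e j) f" if f: "f \<in> increasing k n" for f
      by (rule minor_cong) (simp add: A_def range[OF f])
    obtain f where f: "f \<in> increasing k n" "minor k (fr x) f \<noteq> 0"
      using minor_frame_nonzero[of "coords x"] by (rule bexE)
    have "minor k (entries A) f \<noteq> 0"
      unfolding minor_A[OF f(1)] minor_scale_columns by (rule no_zero_divisors[OF f(2) e(1)])
    from full_rank_if_minor_nonzero[OF A _ this] have "vec_space.rank n A = k"
      using range[OF f(1)] by blast
    moreover have "0 \<le> det (submatrix A I UNIV)" if I: "I \<subseteq> {..<n}" "card I = k" for I
    proof -
      obtain g where g: "g \<in> increasing k n" "g ` {..<k} = I"
        using increasing_onto[OF I] by blast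
      have "det (submatrix A I UNIV) = minor k (entries A) g"
        using det_submatrix_rows(2)[OF A g(1) order_refl refl] by (simp only: g(2))
      then show ?thesis
        using bspec[OF e(2) g(1)] by (simp only: minor_A[OF g(1)])
    qed
    ultimately have "vec_space.col_space n (cmat A) \<in> Gr_nonneg k n"
      using A unfolding Gr_nonneg_def mem_Collect_eq by (intro exI[of _ A] conjI refl allI impI) simp_all
    moreover have "(\<lambda>v. cmat Z *\<^sub>v v) ` vec_space.col_space n (cmat A) = W"
      unfolding W
    proof (rule image[OF A, of "mat k k (\<lambda>(i, j). of_bool (i = j) * e j)"])
      show "det (mat k k (\<lambda>(i, j). of_bool (i = j) * e j)) \<noteq> 0"
        unfolding det_diagonal by (rule e(1))
      show "A $$ (a, c) = (\<Sum>r<k. fr x a r * mat k k (\<lambda>(i, j). of_bool (i = j) * e j) $$ (r, c))"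
        if "a < n" "c < k" for a c
      proof -
        have "(\<Sum>r<k. fr x a r * mat k k (\<lambda>(i, j). of_bool (i = j) * e j) $$ (r, c)) =
            (\<Sum>r<k. if r = c then fr x a r * e c else 0)"
          by (rule sum.cong) (use that in auto)
        then show ?thesis
          using that by (simp add: A_def)
      qed
    qed simp
    ultimately show "W \<in> amplituhedron n k Z"
      unfolding amplituhedron_def by (rule rev_image_eqI[OF _ sym])
  qed
  then show ?thesis
    using gr.ball_in_chart[OF body.contracted_body_axioms] by simp
qed

end

section \<open>Orthogonal polynomials on finitely many points\<close>

locale point_measure =
  fixes n :: nat and l x :: "nat \<Rightarrow> real"
  assumes points: "\<And>i j. i < j \<Longrightarrow> j < n \<Longrightarrow> l j < l i"
    and weights: "\<And>i. i < n \<Longrightarrow> 0 < x i"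
begin

text \<open>Grouped so that for members of an orthonormal family each factor is an entry of
  \<open>eigenmatrix\<close>.\<close>

definition ip :: "real poly \<Rightarrow> real poly \<Rightarrow> real" where
  "ip p q = (\<Sum>i<n. (x i * poly p (l i)) * (x i * poly q (l i)))"

lemma ip_diff: "ip (p - q) r = ip p r - ip q r"
  by (simp add: ip_def algebra_simps sum_subtractf)

lemma ip_smult: "ip (Polynomial.smult a p) r = a * ip p r"
  by (simp add: ip_def sum_distrib_left algebra_simps)

lemma ip_sum: "ip (\<Sum>c\<in>C. p c) r = (\<Sum>c\<in>C. ip (p c) r)"
proof -
  have "ip (\<Sum>c\<in>C. p c) r = (\<Sum>i<n. \<Sum>c\<in>C. (x i * poly (p c) (l i)) * (x i * poly r (l i)))"
    by (simp add: ip_def poly_sum sum_distrib_left sum_distrib_right)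
  also have "\<dots> = (\<Sum>c\<in>C. ip (p c) r)"
    unfolding ip_def by (rule sum.swap)
  finally show ?thesis .
qed

lemma ip_commute: "ip p q = ip q p"
  by (simp add: ip_def mult.commute)

lemma inj_points: "inj_on l {..<n}"
proof (rule inj_onI)
  fix i j assume "i \<in> {..<n}" "j \<in> {..<n}" "l i = l j"
  then show "i = j"
    using points[of i j] points[of j i] by (cases i j rule: linorder_cases) auto
qed

text \<open>A nonzero polynomial of degree below \<open>n\<close> cannot vanish at \<open>n\<close>
  distinct points.\<close>

lemma ip_pos:
  assumes "p \<noteq> 0" "degree p < n"
  shows "0 < ip p p"
proof -
  have "0 \<le> ip p p"
    by (simp add: ip_def sum_nonneg)
  moreover have "ip p p \<noteq> 0"
  proof
    assume "ip p p = 0"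
    then have "\<forall>i\<in>{..<n}. (x i * poly p (l i)) * (x i * poly p (l i)) = 0"
      unfolding ip_def by (subst (asm) sum_nonneg_eq_0_iff) auto
    then have "poly p (l i) = 0" if "i < n" for i
      using that weights[of i] by force
    then have "l ` {..<n} \<subseteq> {t. poly p t = 0}"
      by auto
    then have "card (l ` {..<n}) \<le> card {t. poly p t = 0}"
      by (rule card_mono[OF poly_roots_finite[OF assms(1)]])
    also have "\<dots> \<le> degree p"
      by (rule card_poly_roots_bound[OF assms(1)])
    finally show False
      using assms(2) by (simp add: card_image[OF inj_points])
  qed
  ultimately show ?thesis
    by linarith
qed

definition orthonormal_family :: "nat \<Rightarrow> (nat \<Rightarrow> real poly) \<Rightarrow> bool" where
  "orthonormal_family N P \<longleftrightarrow> (\<forall>j<N. degree (P j) = j \<and> 0 < coeff (P j) j) \<and>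
     (\<forall>i<N. \<forall>j<N. ip (P i) (P j) = of_bool (i = j))"

text \<open>Gram-Schmidt on the monomials: \<open>R\<close> is the new monomial minus its
  projection. It is monic, which fixes the sign of the leading coefficient.\<close>

lemma ex_orthonormal_family:
  assumes "N \<le> n"
  shows "\<exists>P. orthonormal_family N P"
  using assms
proof (induction N)
  case 0
  then show ?case
    by (simp add: orthonormal_family_def)
next
  case (Suc N)
  then obtain P where P: "orthonormal_family N P"
    by auto
  then have deg: "degree (P c) = c" if "c < N" for c
    using that by (simp add: orthonormal_family_def)
  have orth: "ip (P i) (P j) = of_bool (i = j)" if "i < N" "j < N" for i j
    using P that by (simp add: orthonormal_family_def)
  define S where "S = (\<Sum>c<N. Polynomial.smult (ip (monom 1 N) (P c)) (P c))"
  define R where "R = monom 1 N - S"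
  have S: "coeff S i = 0" if "N \<le> i" for i
    using that deg by (simp add: S_def coeff_sum coeff_eq_0)
  have coeffR: "coeff R N = 1" "\<And>i. N < i \<Longrightarrow> coeff R i = 0"
    using S by (auto simp: R_def)
  then have degR: "degree R = N"
    by (intro antisym degree_le le_degree) auto
  have R0: "R \<noteq> 0"
    using coeffR(1) by auto
  have ipR: "ip R (P c) = 0" if "c < N" for c
  proof -
    have "ip S (P c) = (\<Sum>b<N. ip (monom 1 N) (P b) * of_bool (b = c))"
      unfolding S_def ip_sum ip_smult using that by (intro sum.cong) (simp_all add: orth)
    also have "\<dots> = ip (monom 1 N) (P c)"
      using that by (simp add: of_bool_def if_distrib cong: if_cong)
    finally show ?thesis
      by (simp add: R_def ip_diff)
  qed
  have pos: "0 < ip R R"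
    using ip_pos[OF R0] degR Suc.prems by simp
  define s where "s = 1 / sqrt (ip R R)"
  have s: "0 < s" "s * s * ip R R = 1"
    using pos by (auto simp: s_def)
  have "orthonormal_family (Suc N) (P(N := Polynomial.smult s R))"
    unfolding orthonormal_family_def
  proof (intro conjI allI impI)
    fix i j assume ij: "i < Suc N" "j < Suc N"
    have c: "ip (P c) (Polynomial.smult s R) = 0" "ip (Polynomial.smult s R) (P c) = 0" if "c < N" for c
      using ipR[OF that] by (simp_all add: ip_smult ip_commute[of "P c"])
    have "ip (Polynomial.smult s R) (Polynomial.smult s R) = 1"
      using s by (simp add: ip_smult ip_commute[of R "Polynomial.smult s R"] mult.assoc)
    then show "ip ((P(N := Polynomial.smult s R)) i) ((P(N := Polynomial.smult s R)) j) = of_bool (i = j)"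
      using ij c orth by (auto simp: less_Suc_eq)
  next
    fix j assume "j < Suc N"
    then show "degree ((P(N := Polynomial.smult s R)) j) = j" "0 < coeff ((P(N := Polynomial.smult s R)) j) j"
      using P s coeffR(1) degR by (auto simp: orthonormal_family_def less_Suc_eq)
  qed
  then show ?case
    by blast
qed

end

locale orthonormal_polynomials = point_measure +
  fixes P :: "nat \<Rightarrow> real poly"
  assumes family: "orthonormal_family n P"
begin

lemma degree_P: "j < n \<Longrightarrow> degree (P j) = j"
  and lead_P: "j < n \<Longrightarrow> 0 < coeff (P j) j"
  and ip_P: "i < n \<Longrightarrow> j < n \<Longrightarrow> ip (P i) (P j) = of_bool (i = j)"
  using family by (auto simp: orthonormal_family_def)

lemma expansion:
  assumes "N \<le> n" "\<And>i. N \<le> i \<Longrightarrow> coeff p i = 0"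
  shows "\<exists>a. p = (\<Sum>c<N. Polynomial.smult (a c) (P c))"
  using assms
proof (induction N arbitrary: p)
  case 0
  then show ?case
    by (auto simp: poly_eq_iff)
next
  case (Suc N)
  define b where "b = coeff p N / coeff (P N) N"
  have "coeff (p - Polynomial.smult b (P N)) i = 0" if "N \<le> i" for i
  proof (cases "i = N")
    case True
    then show ?thesis
      using lead_P[of N] Suc.prems(1) by (simp add: b_def)
  next
    case False
    then show ?thesis
      using Suc.prems degree_P[of N] that by (simp add: coeff_eq_0)
  qed
  then obtain a where "p - Polynomial.smult b (P N) = (\<Sum>c<N. Polynomial.smult (a c) (P c))"
    using Suc.IH[of "p - Polynomial.smult b (P N)"] Suc.prems(1) by auto
  then have "p = (\<Sum>c<Suc N. Polynomial.smult ((a(N := b)) c) (P c))"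
    by (simp add: algebra_simps)
  then show ?case
    by blast
qed

lemma ip_lower_degree:
  assumes "b < n" "\<And>i. b \<le> i \<Longrightarrow> coeff p i = 0"
  shows "ip p (P b) = 0"
proof -
  obtain a where "p = (\<Sum>c<b. Polynomial.smult (a c) (P c))"
    using expansion[of b p] assms by auto
  then have "ip p (P b) = (\<Sum>c<b. a c * ip (P c) (P b))"
    by (simp add: ip_sum ip_smult)
  also have "\<dots> = 0"
    using assms(1) by (intro sum.neutral) (auto simp: ip_P)
  finally show ?thesis .
qed

text \<open>Row \<open>a\<close> is the polynomial \<open>P a\<close> as a unit vector on the
  points. Column \<open>c\<close> is an eigenvector of \<open>jacobi\<close> for \<open>l c\<close>,
  because multiplication by the variable acts pointwise.\<close>

definition eigenmatrix :: "nat \<Rightarrow> nat \<Rightarrow> real" where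
  "eigenmatrix a c = x c * poly (P a) (l c)"

definition jacobi :: "nat \<Rightarrow> nat \<Rightarrow> real" where
  "jacobi a b = ip (pCons 0 (P a)) (P b)"

lemma eigenmatrix_rows:
  "a < n \<Longrightarrow> b < n \<Longrightarrow> (\<Sum>c<n. eigenmatrix a c * eigenmatrix b c) = of_bool (a = b)"
  using ip_P[of a b] by (simp add: ip_def eigenmatrix_def)

lemma jacobi_eq: "jacobi a b = (\<Sum>i<n. l i * eigenmatrix a i * eigenmatrix b i)"
  by (simp add: jacobi_def ip_def eigenmatrix_def ac_simps)

lemma jacobi_sym: "jacobi a b = jacobi b a"
  by (simp add: jacobi_eq ac_simps)

text \<open>Multiplication by the variable raises the degree only to \<open>Suc a\<close>, and
  \<open>P b\<close> is orthogonal to everything of degree below \<open>b\<close>.\<close>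

lemma jacobi_zero:
  assumes "b < n" "Suc a < b"
  shows "jacobi a b = 0"
  unfolding jacobi_def
proof (rule ip_lower_degree[OF assms(1)])
  fix i assume "b \<le> i"
  then show "coeff (pCons 0 (P a)) i = 0"
    using assms degree_P[of a] by (cases i) (auto simp: coeff_eq_0)
qed

lemma jacobi_pos:
  assumes b: "Suc a < n"
  shows "0 < jacobi a (Suc a)"
proof -
  \<comment> \<open>The ratio of leading coefficients; subtracting this multiple of
    \<open>P (Suc a)\<close> leaves only lower degrees, so \<open>r\<close> is the matrix
    entry.\<close>
  define r where "r = coeff (P a) a / coeff (P (Suc a)) (Suc a)"
  have "ip (pCons 0 (P a) - Polynomial.smult r (P (Suc a))) (P (Suc a)) = 0"
  proof (rule ip_lower_degree[OF b])
    fix i assume i: "Suc a \<le> i"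
    show "coeff (pCons 0 (P a) - Polynomial.smult r (P (Suc a))) i = 0"
    proof (cases "i = Suc a")
      case True
      then show ?thesis
        using lead_P[OF b] by (simp add: r_def)
    next
      case False
      then obtain q where "i = Suc q" "a < q"
        using i by (cases i) auto
      then show ?thesis
        using degree_P[of a] degree_P[OF b] b by (simp add: coeff_eq_0)
    qed
  qed
  then have "jacobi a (Suc a) = r"
    using ip_P[OF b b] by (simp add: ip_diff ip_smult jacobi_def)
  then show ?thesis
    using lead_P[of a] lead_P[OF b] b by (simp add: r_def)
qed

sublocale jacobi_spectrum n jacobi eigenmatrix l
proof
  fix i j assume "i < n" "j < n" "Suc i < j \<or> Suc j < i"
  then show "jacobi i j = 0"
    using jacobi_zero[of j i] jacobi_zero[of i j] jacobi_sym[of i j] by auto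
next
  fix a c assume "a < n" "c < n"
  have "(\<Sum>b<n. jacobi a b * eigenmatrix b c) =
      (\<Sum>i<n. l i * eigenmatrix a i * (\<Sum>b<n. eigenmatrix b i * eigenmatrix b c))"
    unfolding jacobi_eq sum_distrib_left sum_distrib_right by (subst sum.swap) (simp add: mult.assoc)
  also have "\<dots> = (\<Sum>i<n. l i * eigenmatrix a i * of_bool (i = c))"
    using \<open>c < n\<close> orthonormal_transpose[OF eigenmatrix_rows] by (intro sum.cong) auto
  also have "\<dots> = l c * eigenmatrix a c"
    using \<open>c < n\<close> by (simp add: of_bool_def if_distrib cong: if_cong)
  finally show "(\<Sum>b<n. jacobi a b * eigenmatrix b c) = l c * eigenmatrix a c" .
qed (use jacobi_pos jacobi_sym points orthonormal_transpose[OF eigenmatrix_rows] in auto)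

end

section \<open>Twisted Vandermonde flags are eigenflags of Jacobi matrices\<close>

text \<open>As a function of the last point the determinant is a polynomial whose roots are the other
  points.\<close>

lemma generalized_vandermonde_pos:
  fixes R :: "nat \<Rightarrow> real poly" and t :: "nat \<Rightarrow> real"
  assumes deg: "\<And>j. j < c \<Longrightarrow> degree (R j) = j" and lead: "\<And>j. j < c \<Longrightarrow> 0 < (-1) ^ j * coeff (R j) j"
    and t: "\<And>i j. i < j \<Longrightarrow> j < c \<Longrightarrow> t j < t i"
  shows "0 < det (mat c c (\<lambda>(i, j). poly (R j) (t i)))"
  using assms
proof (induction c)
  case 0
  then show ?case
    by simp
next
  case (Suc c)
  let ?M = "\<lambda>s. mat (Suc c) (Suc c) (\<lambda>(i, j). poly (R j) (if i = c then s else t i))"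
  let ?D = "det (mat c c (\<lambda>(i, j). poly (R j) (t i)))"
  have D: "0 < ?D"
    using Suc by simp
  \<comment> \<open>The cofactors along the last row do not involve the last point \<open>s\<close>,
    so they are coefficients of a polynomial in it.\<close>
  define cof where "cof j = cofactor (?M 0) c j" for j
  have cof: "cofactor (?M s) c j = cof j" if "j < Suc c" for s j
    unfolding cof_def cofactor_def
    by (intro arg_cong[of _ _ "\<lambda>M. _ * det M"] eq_matI) (auto simp: mat_delete_def)
  have cof_last: "cof c = ?D"
    unfolding cof_def cofactor_def
    by (subst arg_cong[of "mat_delete (?M 0) c c" "mat c c (\<lambda>(i, j). poly (R j) (t i))" det])
      (auto intro!: eq_matI simp: mat_delete_def)
  define p where "p = (\<Sum>j<Suc c. Polynomial.smult (cof j) (R j))"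
  have poly_p: "poly p s = det (?M s)" for s
    by (subst laplace_expansion_row[of _ "Suc c" c]) (auto simp: p_def poly_sum cof mult.commute)
  have coeff_p: "coeff p i = 0" if "c < i" for i
    using that Suc.prems(1) by (auto simp: p_def coeff_sum coeff_eq_0 intro!: sum.neutral)
  have lead_p: "coeff p c = ?D * coeff (R c) c"
    using Suc.prems(1) by (simp add: p_def coeff_sum cof_last coeff_eq_0)
  define q where "q = Polynomial.smult (?D * coeff (R c) c) (\<Prod>i<c. [:- t i, 1:])"
  have root: "poly p (t i) = 0" if "i < c" for i
    unfolding poly_p using that
    by (intro det_identical_rows[of _ "Suc c" i c]) (auto intro!: eq_vecI)
  have prod: "degree (\<Prod>i<c. [:- t i, 1:]) = c" "coeff (\<Prod>i<c. [:- t i, 1:]) c = 1"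
  proof -
    show d: "degree (\<Prod>i<c. [:- t i, 1:]) = c"
      by (subst degree_prod_eq_sum_degree) auto
    have "lead_coeff (\<Prod>i<c. [:- t i, 1:]) = 1"
      by (simp add: lead_coeff_prod)
    then show "coeff (\<Prod>i<c. [:- t i, 1:]) c = 1"
      unfolding d .
  qed
  have "p - q = 0"
  proof (rule ccontr)
    assume nz: "p - q \<noteq> 0"
    have "coeff (p - q) i = 0" if "c \<le> i" for i
      using that coeff_p[of i] lead_p prod by (cases "i = c") (auto simp: q_def coeff_eq_0)
    then have "degree (p - q) < c"
      using nz by (metis leading_coeff_0_iff not_le)
    moreover have "inj_on t {..<c}"
    proof (rule inj_onI)
      fix i j assume "i \<in> {..<c}" "j \<in> {..<c}" "t i = t j"
      then show "i = j"
        using Suc.prems(3)[of i j] Suc.prems(3)[of j i] by (cases i j rule: linorder_cases) auto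
    qed
    moreover have "t ` {..<c} \<subseteq> {s. poly (p - q) s = 0}"
      using root by (auto simp: q_def poly_prod)
    ultimately show False
      using card_mono[OF poly_roots_finite[OF nz], of "t ` {..<c}"] card_poly_roots_bound[OF nz]
      by (simp add: card_image)
  qed
  then have "det (?M (t c)) = ?D * coeff (R c) c * (\<Prod>i<c. t c - t i)"
    by (simp add: poly_p[symmetric] q_def poly_prod)
  \<comment> \<open>The points decrease, so all \<open>c\<close> factors are negative; the sign is
    absorbed by the assumed alternating sign of the leading coefficient.\<close>
  also have "(\<Prod>i<c. t c - t i) = (-1) ^ c * (\<Prod>i<c. t i - t c)"
  proof -
    have "(\<Prod>i<c. t c - t i) = (\<Prod>i<c. (-1) * (t i - t c))"
      by simp
    then show ?thesis
      unfolding prod.distrib by simp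
  qed
  finally have "det (?M (t c)) = ?D * ((-1) ^ c * coeff (R c) c) * (\<Prod>i<c. t i - t c)"
    by (simp add: ac_simps)
  moreover have "0 < (\<Prod>i<c. t i - t c)"
    using Suc.prems(3) by (intro prod_pos) auto
  ultimately have "0 < det (?M (t c))"
    using D Suc.prems(2)[of c] by simp
  moreover have "?M (t c) = mat (Suc c) (Suc c) (\<lambda>(i, j). poly (R j) (t i))"
    by (intro eq_matI) auto
  ultimately show ?case
    by simp
qed

section \<open>Flags in coordinates and their orthogonal representatives\<close>

lemma in_flag_of_iff:
  assumes A: "A \<in> carrier_mat n n"
  shows "v \<in> flag_of n A j \<longleftrightarrow>
    v \<in> carrier_vec n \<and> (\<exists>a. \<forall>i<n. v $ i = (\<Sum>c<min j n. a c * A $$ (i, c)))"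
proof -
  let ?m = "min j n"
  let ?B = "mat n ?m (\<lambda>(i, c). A $$ (i, c))"
  have cols: "take j (cols A) = cols ?B"
    using A by (intro nth_equalityI) (auto intro!: eq_vecI)
  have "flag_of n A j = vec_space.col_space n ?B"
    unfolding flag_of_def cols vec_space.col_space_def ..
  then have "v \<in> flag_of n A j \<longleftrightarrow> (\<exists>w\<in>carrier_vec ?m. v = ?B *\<^sub>v w)"
    by (subst (asm) vec_space.col_space_image[of _ _ ?m]) auto
  also have "\<dots> \<longleftrightarrow> v \<in> carrier_vec n \<and> (\<exists>a. \<forall>i<n. v $ i = (\<Sum>c<?m. a c * A $$ (i, c)))"
  proof
    assume "\<exists>w\<in>carrier_vec ?m. v = ?B *\<^sub>v w"
    then obtain w where w: "w \<in> carrier_vec ?m" "v = ?B *\<^sub>v w"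
      by blast
    then have "v $ i = (\<Sum>c<?m. w $ c * A $$ (i, c))" if "i < n" for i
      using that by (simp add: scalar_prod_def atLeast0LessThan mult.commute)
    moreover have "v \<in> carrier_vec n"
      unfolding w(2) using w(1) by (intro mult_mat_vec_carrier) auto
    ultimately show "v \<in> carrier_vec n \<and> (\<exists>a. \<forall>i<n. v $ i = (\<Sum>c<?m. a c * A $$ (i, c)))"
      by blast
  next
    assume "v \<in> carrier_vec n \<and> (\<exists>a. \<forall>i<n. v $ i = (\<Sum>c<?m. a c * A $$ (i, c)))"
    then obtain a where a: "v \<in> carrier_vec n" "\<forall>i<n. v $ i = (\<Sum>c<?m. a c * A $$ (i, c))"
      by blast
    have "v = ?B *\<^sub>v vec ?m a"
      using a by (intro eq_vecI) (auto simp: scalar_prod_def atLeast0LessThan mult.commute)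
    then show "\<exists>w\<in>carrier_vec ?m. v = ?B *\<^sub>v w"
      by (intro bexI[of _ "vec ?m a"]) auto
  qed
  finally show ?thesis .
qed

lemma flag_of_mono:
  assumes A: "A \<in> carrier_mat n n" and B: "B \<in> carrier_mat n n"
    and u: "\<And>i j. i < n \<Longrightarrow> j < n \<Longrightarrow> B $$ (i, j) = (\<Sum>c<Suc j. u j c * A $$ (i, c))"
  shows "flag_of n B j \<subseteq> flag_of n A j"
proof
  fix v assume "v \<in> flag_of n B j"
  then obtain a where v: "v \<in> carrier_vec n" and a: "\<And>i. i < n \<Longrightarrow> v $ i = (\<Sum>b<min j n. a b * B $$ (i, b))"
    unfolding in_flag_of_iff[OF B] by blast
  define e where "e c = (\<Sum>b<min j n. a b * (if c < Suc b then u b c else 0))" for c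
  have "v $ i = (\<Sum>c<min j n. e c * A $$ (i, c))" if "i < n" for i
  proof -
    have "B $$ (i, b) = (\<Sum>c<min j n. (if c < Suc b then u b c else 0) * A $$ (i, c))" if b: "b < min j n" for b
    proof -
      have "B $$ (i, b) = (\<Sum>c<Suc b. (if c < Suc b then u b c else 0) * A $$ (i, c))"
        using u[OF \<open>i < n\<close>, of b] b by simp
      also have "\<dots> = (\<Sum>c<min j n. (if c < Suc b then u b c else 0) * A $$ (i, c))"
        using b by (intro sum.mono_neutral_left) auto
      finally show ?thesis .
    qed
    then have "v $ i = (\<Sum>b<min j n. \<Sum>c<min j n. a b * ((if c < Suc b then u b c else 0) * A $$ (i, c)))"
      using a[OF that] by (simp add: sum_distrib_left)
    also have "\<dots> = (\<Sum>c<min j n. e c * A $$ (i, c))"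
      unfolding e_def sum_distrib_right by (subst sum.swap) (simp add: mult.assoc)
    finally show ?thesis .
  qed
  then show "v \<in> flag_of n A j"
    using v unfolding in_flag_of_iff[OF A] by blast
qed

lemma flag_of_column:
  assumes A: "A \<in> carrier_mat n n" and j: "j < n"
  shows "col A j \<in> flag_of n A (Suc j)"
  unfolding in_flag_of_iff[OF A]
proof (intro conjI exI[of _ "\<lambda>c. of_bool (c = j)"] allI impI)
  show "col A j $ i = (\<Sum>c<min (Suc j) n. of_bool (c = j) * A $$ (i, c))" if "i < n" for i
    using A j that by (simp add: of_bool_def if_distribR if_distrib cong: if_cong)
qed (use A in auto)

lemma flag_of_inner_zero:
  fixes g :: "real mat"
  assumes g: "g \<in> carrier_mat n n" and h: "h \<in> carrier_mat n n"
    and orth: "\<And>c d. c < n \<Longrightarrow> d < n \<Longrightarrow> (\<Sum>i<n. g $$ (i, c) * g $$ (i, d)) = of_bool (c = d)"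
    and flag: "flag_of n (cmat h) = flag_of n (cmat g)" and cj: "j < c" "c < n"
  shows "(\<Sum>i<n. g $$ (i, c) * h $$ (i, j)) = 0"
proof -
  have "col (cmat h) j \<in> flag_of n (cmat g) (Suc j)"
    using flag_of_column[of "cmat h" n j] h cj unfolding flag by simp
  then obtain a where a: "\<And>i. i < n \<Longrightarrow> col (cmat h) j $ i = (\<Sum>b<min (Suc j) n. a b * cmat g $$ (i, b))"
    using in_flag_of_iff[of "cmat g" n] g by auto
  \<comment> \<open>Column \<open>j\<close> of \<open>h\<close> combines only columns of
    \<open>g\<close> up to \<open>j\<close>, all orthogonal to column \<open>c\<close>. The flag is
    complex, so the coefficients \<open>a\<close> are complex and the computation is done
    there.\<close>
  have "complex_of_real (\<Sum>i<n. g $$ (i, c) * h $$ (i, j)) =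
      (\<Sum>i<n. complex_of_real (g $$ (i, c)) * (\<Sum>b<Suc j. a b * complex_of_real (g $$ (i, b))))"
    unfolding of_real_sum of_real_mult
  proof (intro sum.cong refl)
    fix i assume "i \<in> {..<n}"
    then show "complex_of_real (g $$ (i, c)) * complex_of_real (h $$ (i, j)) =
        complex_of_real (g $$ (i, c)) * (\<Sum>b<Suc j. a b * complex_of_real (g $$ (i, b)))"
      using a[of i] g h cj by simp
  qed
  also have "\<dots> = (\<Sum>b<Suc j. a b * complex_of_real (\<Sum>i<n. g $$ (i, c) * g $$ (i, b)))"
    unfolding of_real_sum of_real_mult sum_distrib_left
    by (subst sum.swap) (simp add: ac_simps del: sum.lessThan_Suc)
  also have "\<dots> = 0"
    using cj by (intro sum.neutral) (auto simp: orth)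
  finally show ?thesis
    by (simp only: of_real_eq_0_iff)
qed

text \<open>The matrix \<open>T\<close>, the transpose of \<open>g\<close> times \<open>h\<close>,
  is triangular in both directions, so diagonal with entries 1 or -1. The leading principal minors
  then fix these signs one after the other.\<close>

lemma orthogonal_flag_representative_unique:
  fixes g h :: "real mat"
  assumes g: "g \<in> carrier_mat n n" "transpose_mat g * g = 1\<^sub>m n"
    and pos: "\<And>c. c \<le> n \<Longrightarrow> 0 < minor c (entries g) (restrict (\<lambda>i. i) {..<c})"
    and h: "h \<in> carrier_mat n n" "transpose_mat h * h = 1\<^sub>m n" "left_minors_nonneg n h"
    and flag: "flag_of n (cmat h) = flag_of n (cmat g)"
  shows "h = g"
proof -
  have orth: "(\<Sum>i<n. g' $$ (i, c) * g' $$ (i, d)) = of_bool (c = d)"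
    if "g' \<in> carrier_mat n n" "transpose_mat g' * g' = 1\<^sub>m n" "c < n" "d < n" for g' :: "real mat" and c d
    using arg_cong[OF that(2), of "\<lambda>M. M $$ (c, d)"] that(1,3,4)
    by (simp add: scalar_prod_def atLeast0LessThan)
  define T where "T c j = (\<Sum>i<n. g $$ (i, c) * h $$ (i, j))" for c j
  have T0: "T c j = 0" if "c < n" "j < n" "c \<noteq> j" for c j
  proof (cases "j < c")
    case True
    then show ?thesis
      unfolding T_def by (intro flag_of_inner_zero[OF g(1) h(1) _ flag _ that(1)] orth[OF g])
  next
    case False
    then have "c < j"
      using that by simp
    have "(\<Sum>i<n. h $$ (i, j) * g $$ (i, c)) = 0"
      by (intro flag_of_inner_zero[OF h(1) g(1) _ flag[symmetric] \<open>c < j\<close> that(2)] orth[OF h(1,2)])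
    then show ?thesis
      by (simp add: T_def mult.commute)
  qed
  have rows: "(\<Sum>c<n. g $$ (i, c) * g $$ (b, c)) = of_bool (i = b)" if "i < n" "b < n" for i b
    using orthonormal_transpose[of n "\<lambda>c i. g $$ (i, c)" i b] orth[OF g] that by simp
  have hg: "h $$ (i, j) = g $$ (i, j) * T j j" if "i < n" "j < n" for i j
  proof -
    have "h $$ (i, j) = (\<Sum>c<n. g $$ (i, c) * T c j)"
      unfolding T_def by (rule sum_mult_inverse[OF rows[OF that(1)] that(1), symmetric])
    also have "\<dots> = (\<Sum>c\<in>{j}. g $$ (i, c) * T c j)"
      using that T0 by (intro sum.mono_neutral_right) auto
    finally show ?thesis
      by simp
  qed
  have sq: "T j j * T j j = 1" if "j < n" for j
  proof -
    have "1 = (\<Sum>i<n. h $$ (i, j) * h $$ (i, j))"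
      using orth[OF h(1,2) that that] by simp
    also have "\<dots> = (\<Sum>i<n. g $$ (i, j) * g $$ (i, j)) * (T j j * T j j)"
      unfolding sum_distrib_right using that by (intro sum.cong) (simp_all add: hg ac_simps)
    finally show ?thesis
      using orth[OF g that that] by simp
  qed
  have one: "T j j = 1" if "j < n" for j
    using that
  proof (induction j rule: less_induct)
    case (less j)
    define f where "f = restrict (\<lambda>i. i) {..<Suc j}"
    have f: "f \<in> increasing (Suc j) n"
      using less.prems by (auto simp: f_def increasing_def strict_mono_on_def)
    have "{..<Suc j} \<subseteq> {..<n}"
      using less.prems by auto
    then have "0 \<le> det (submatrix h {..<Suc j} {..<card {..<Suc j}})"
      using h(3) unfolding left_minors_nonneg_def by blast
    also have "\<dots> = det (submatrix h (f ` {..<Suc j}) {..<Suc j})"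
      by (simp add: f_def)
    also have "\<dots> = minor (Suc j) (entries h) f"
      using less.prems by (intro det_submatrix_rows(1)[OF h(1) f]) simp
    also have "\<dots> = minor (Suc j) (\<lambda>a c. g $$ (a, c) * T c c) f"
      using less.prems by (intro minor_cong) (simp add: hg f_def)
    also have "\<dots> = minor (Suc j) (entries g) f * (\<Prod>c<Suc j. T c c)"
      by (rule minor_scale_columns)
    also have "(\<Prod>c<Suc j. T c c) = T j j"
      using less by simp
    finally have "0 \<le> T j j"
      using pos[of "Suc j", folded f_def] less.prems by (simp add: zero_le_mult_iff)
    then show ?case
      using square_eq_1_iff[of "T j j"] sq[OF less.prems] by auto
  qed
  show ?thesis
    using g(1) h(1) by (intro eq_matI) (auto simp: hg one)
qed

section \<open>The twist of a Vandermonde flag\<close>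

context orthonormal_polynomials begin

text \<open>Gram-Schmidt on the Vandermonde columns, with the sign that makes left-justified minors
  positive for decreasing points.\<close>

definition representative :: "real mat" where
  "representative = mat n n (\<lambda>(i, j). (-1) ^ j * eigenmatrix j i)"

lemma representative_carrier: "representative \<in> carrier_mat n n"
  by (simp add: representative_def)

lemma representative_orthogonal: "transpose_mat representative * representative = 1\<^sub>m n"
proof (rule eq_matI)
  fix a b assume "a < dim_row (1\<^sub>m n :: real mat)" "b < dim_col (1\<^sub>m n :: real mat)"
  then have ab: "a < n" "b < n"
    by auto
  have "(transpose_mat representative * representative) $$ (a, b) =
      (-1) ^ a * (-1) ^ b * (\<Sum>c<n. eigenmatrix a c * eigenmatrix b c)"
    using ab by (simp add: representative_def scalar_prod_def atLeast0LessThan sum_distrib_left ac_simps)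
  also have "\<dots> = of_bool (a = b)"
    using ab by (simp add: eigenmatrix_rows power_add[symmetric] mult_2[symmetric])
  finally show "(transpose_mat representative * representative) $$ (a, b) = 1\<^sub>m n $$ (a, b)"
    using ab by simp
qed (auto simp: representative_def)

lemma representative_minors_pos:
  assumes c: "c \<le> n" and f: "f \<in> increasing c n"
  shows "0 < minor c (entries representative) f"
proof -
  define R where "R j = Polynomial.smult ((-1) ^ j) (P j)" for j
  have range: "f i < n" if "i < c" for i
    using image_increasing(1)[OF f] that by blast
  have mono: "f i < f j" if "i < j" "j < c" for i j
    using f that by (auto simp: increasing_def strict_mono_on_def)
  have "minor c (entries representative) f = minor c (\<lambda>i j. poly (R j) (l i) * x i) f"
    using c range by (intro minor_cong) (simp add: representative_def R_def eigenmatrix_def ac_simps)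
  also have "\<dots> = det (mat c c (\<lambda>(i, j). poly (R j) (l (f i)) * x (f i)))"
    by (simp add: minor_def)
  \<comment> \<open>Transposing turns the weights \<open>x (f i)\<close> from row factors into
    column factors.\<close>
  also have "\<dots> = minor c (\<lambda>j i. poly (R j) (l (f i)) * x (f i)) (\<lambda>i. i)"
    unfolding minor_def by (subst det_transpose[of _ c, symmetric]) (auto intro!: arg_cong[of _ _ det] eq_matI)
  also have "\<dots> = minor c (\<lambda>j i. poly (R j) (l (f i))) (\<lambda>i. i) * (\<Prod>i<c. x (f i))"
    by (rule minor_scale_columns)
  also have "minor c (\<lambda>j i. poly (R j) (l (f i))) (\<lambda>i. i) = det (mat c c (\<lambda>(i, j). poly (R j) (l (f i))))"
    unfolding minor_def by (subst det_transpose[of _ c, symmetric]) (auto intro!: arg_cong[of _ _ det] eq_matI)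
  finally have eq: "minor c (entries representative) f =
      det (mat c c (\<lambda>(i, j). poly (R j) (l (f i)))) * (\<Prod>i<c. x (f i))" .
  have "0 < det (mat c c (\<lambda>(i, j). poly (R j) (l (f i))))"
  proof (rule generalized_vandermonde_pos)
    fix j assume "j < c"
    then show "degree (R j) = j" "0 < (-1) ^ j * coeff (R j) j"
      using degree_P[of j] lead_P[of j] c by (auto simp: R_def power_add[symmetric] mult.assoc[symmetric] simp flip: mult_2)
  qed (use mono points range in auto)
  moreover have "0 < (\<Prod>i<c. x (f i))"
    using weights range by (intro prod_pos) auto
  ultimately show ?thesis
    unfolding eq by simp
qed

text \<open>Monomials and orthogonal polynomials are triangular combinations of each other, so both
  matrices span the same flag.\<close>

lemma representative_flag:
  "flag_of n (cmat representative) = flag_of n (cmat (mat n n (\<lambda>(i, j). l i ^ j * x i)))"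
proof
  fix j
  let ?V = "cmat (mat n n (\<lambda>(i, j). l i ^ j * x i))"
  have V: "?V \<in> carrier_mat n n" and g: "cmat representative \<in> carrier_mat n n"
    using representative_carrier by auto
  have "\<exists>a. monom 1 b = (\<Sum>c<Suc b. Polynomial.smult (a c) (P c))" if "b < n" for b
    using that by (intro expansion) auto
  then obtain a where a: "\<And>b. b < n \<Longrightarrow> monom 1 b = (\<Sum>c<Suc b. Polynomial.smult (a b c) (P c))"
    by metis
  have "flag_of n ?V j \<subseteq> flag_of n (cmat representative) j"
  proof (rule flag_of_mono[OF g V, of "\<lambda>b c. complex_of_real (a b c * (-1) ^ c)"])
    fix i b assume ib: "i < n" "b < n"
    have "l i ^ b = (\<Sum>c<Suc b. a b c * poly (P c) (l i))"
      using arg_cong[OF a[OF ib(2)], of "\<lambda>p. poly p (l i)"] by (simp add: poly_monom poly_sum del: sum.lessThan_Suc)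
    then have "l i ^ b * x i = (\<Sum>c<Suc b. (a b c * (-1) ^ c) * ((-1) ^ c * eigenmatrix c i))"
    proof -
      have "poly (P c) (l i) * x i = (-1) ^ c * ((-1) ^ c * eigenmatrix c i)" for c
      proof -
        have "(-1) ^ c * ((-1) ^ c * eigenmatrix c i) = ((-1) ^ c * (-1) ^ c) * eigenmatrix c i"
          by (simp only: mult.assoc)
        also have "(-1) ^ c * (-1) ^ c = (1 :: real)"
          by (simp flip: power_add mult_2)
        finally show ?thesis
          by (simp add: eigenmatrix_def)
      qed
      then show ?thesis
        unfolding \<open>l i ^ b = _\<close> sum_distrib_right by (simp only: mult.assoc)
    qed
    then have "?V $$ (i, b) = complex_of_real (\<Sum>c<Suc b. (a b c * (-1) ^ c) * ((-1) ^ c * eigenmatrix c i))"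
      using ib by simp
    also have "\<dots> = (\<Sum>c<Suc b. complex_of_real (a b c * (-1) ^ c) * cmat representative $$ (i, c))"
      unfolding of_real_sum of_real_mult[of "a b _ * _"]
      using ib by (intro sum.cong refl) (simp add: representative_def)
    finally show "?V $$ (i, b) = (\<Sum>c<Suc b. complex_of_real (a b c * (-1) ^ c) * cmat representative $$ (i, c))" .
  qed
  moreover have "flag_of n (cmat representative) j \<subseteq> flag_of n ?V j"
  proof (rule flag_of_mono[OF V g, of "\<lambda>b c. complex_of_real ((-1) ^ b * coeff (P b) c)"])
    fix i b assume ib: "i < n" "b < n"
    have "poly (P b) (l i) = (\<Sum>c<Suc b. coeff (P b) c * l i ^ c)"
      by (simp add: poly_altdef degree_P[OF ib(2)] lessThan_Suc_atMost del: sum.lessThan_Suc)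
    then have "(-1) ^ b * eigenmatrix b i = (\<Sum>c<Suc b. ((-1) ^ b * coeff (P b) c) * (l i ^ c * x i))"
      by (simp add: eigenmatrix_def sum_distrib_left sum_distrib_right ac_simps del: sum.lessThan_Suc)
    then have "cmat representative $$ (i, b) = complex_of_real (\<Sum>c<Suc b. ((-1) ^ b * coeff (P b) c) * (l i ^ c * x i))"
      using ib by (simp add: representative_def del: sum.lessThan_Suc)
    also have "\<dots> = (\<Sum>c<Suc b. complex_of_real ((-1) ^ b * coeff (P b) c) * ?V $$ (i, c))"
      unfolding of_real_sum of_real_mult[of "(-1) ^ b * _"]
      using ib by (intro sum.cong refl) simp
    finally show "cmat representative $$ (i, b) = (\<Sum>c<Suc b. complex_of_real ((-1) ^ b * coeff (P b) c) * ?V $$ (i, c))" .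
  qed
  ultimately show "flag_of n (cmat representative) j = flag_of n ?V j"
    by blast
qed

lemma representative_left_minors_nonneg: "left_minors_nonneg n representative"
  unfolding left_minors_nonneg_def
proof (intro allI impI)
  fix I assume I: "I \<subseteq> {..<n}"
  define c where "c = card I"
  have c: "c \<le> n"
    using card_mono[of "{..<n}" I] I by (simp add: c_def)
  obtain f where f: "f \<in> increasing c n" "f ` {..<c} = I"
    using increasing_onto[OF I c_def[symmetric]] by blast
  have "det (submatrix representative I {..<c}) = minor c (entries representative) f"
    using det_submatrix_rows(1)[OF representative_carrier f(1) c] unfolding f(2) .
  then show "0 \<le> det (submatrix representative I {..<card I})"
    using less_imp_le[OF representative_minors_pos[OF c f(1)]] unfolding c_def[symmetric] by linarith
qed

lemma representative_unique:
  assumes h: "h \<in> carrier_mat n n" "transpose_mat h * h = 1\<^sub>m n" "left_minors_nonneg n h"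
    and flag: "flag_of n (cmat h) = flag_of n (cmat representative)"
  shows "h = representative"
proof (rule orthogonal_flag_representative_unique[OF representative_carrier representative_orthogonal _ h flag])
  fix c assume c: "c \<le> n"
  then have "restrict (\<lambda>i. i) {..<c} \<in> increasing c n"
    by (auto simp: increasing_def strict_mono_on_def)
  then show "0 < minor c (entries representative) (restrict (\<lambda>i. i) {..<c})"
    by (rule representative_minors_pos[OF c])
qed

text \<open>The inverse of the orthogonal representative is its transpose, which turns polynomials
  in columns into eigenvectors in columns. The left sign matrix cancels the signs of
  \<open>representative\<close>; the right one only scales columns, so the result is the flag of
  eigenvectors by decreasing eigenvalue.\<close>

lemma twist_vandermonde:
  "twist n (flag_of n (cmat (mat n n (\<lambda>(i, j). l i ^ j * x i)))) =
     flag_of n (cmat (mat n n (\<lambda>(i, j). (-1) ^ j * eigenmatrix i j)))"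
proof -
  let ?V = "flag_of n (cmat (mat n n (\<lambda>(i, j). l i ^ j * x i)))"
  let ?g = representative
  have "(THE g. g \<in> carrier_mat n n \<and> transpose_mat g * g = 1\<^sub>m n \<and>
      left_minors_nonneg n g \<and> flag_of n (cmat g) = ?V) = ?g"
  proof (rule the_equality)
    show "?g \<in> carrier_mat n n \<and> transpose_mat ?g * ?g = 1\<^sub>m n \<and>
        left_minors_nonneg n ?g \<and> flag_of n (cmat ?g) = ?V"
      by (intro conjI representative_carrier representative_orthogonal representative_flag
          representative_left_minors_nonneg)
  next
    fix h assume h: "h \<in> carrier_mat n n \<and> transpose_mat h * h = 1\<^sub>m n \<and>
        left_minors_nonneg n h \<and> flag_of n (cmat h) = ?V"
    then show "h = ?g"
      by (intro representative_unique) (simp_all only: representative_flag)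
  qed
  moreover have "the (mat_inverse ?g) = transpose_mat ?g"
  proof -
    have inv: "?g * transpose_mat ?g = 1\<^sub>m n"
      by (rule mat_mult_left_right_inverse[OF _ representative_carrier representative_orthogonal])
        (simp add: representative_carrier)
    have "?g \<in> Units (ring_mat TYPE(real) n ())"
      unfolding Units_def ring_mat_def mem_Collect_eq
      using inv representative_orthogonal representative_carrier
      by (intro conjI bexI[of _ "transpose_mat ?g"]) simp_all
    moreover have "?g \<notin> Units (ring_mat TYPE(real) n ())" if "mat_inverse ?g = None"
      by (rule mat_inverse(1)[OF representative_carrier that])
    ultimately obtain B where B: "mat_inverse ?g = Some B"
      by (cases "mat_inverse ?g") simp_all
    then have "?g * B = 1\<^sub>m n" and Bc: "B \<in> carrier_mat n n"
      using mat_inverse(2)[OF representative_carrier] by auto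
    have "B = (transpose_mat ?g * ?g) * B"
      using Bc representative_orthogonal by simp
    also have "\<dots> = transpose_mat ?g * (?g * B)"
      using Bc representative_carrier by (intro assoc_mult_mat) auto
    also have "\<dots> = transpose_mat ?g"
      using \<open>?g * B = 1\<^sub>m n\<close> representative_carrier by simp
    finally show ?thesis
      using B by simp
  qed
  moreover have "sign_mat n * transpose_mat ?g * sign_mat n = mat n n (\<lambda>(i, j). (-1) ^ j * eigenmatrix i j)"
  proof (rule eq_matI)
    fix i j assume "i < dim_row (mat n n (\<lambda>(i, j). (-1) ^ j * eigenmatrix i j))"
      "j < dim_col (mat n n (\<lambda>(i, j). (-1) ^ j * eigenmatrix i j))"
    then have ij: "i < n" "j < n"
      by auto
    have s: "sign_mat n \<in> carrier_mat n n"
      by (simp add: sign_mat_def mat_diag_def)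
    have 1: "(sign_mat n * transpose_mat ?g) $$ (i, a) = (-1) ^ i * ?g $$ (a, i)" if "a < n" for a
    proof -
      have "(sign_mat n * transpose_mat ?g) $$ (i, a) = (\<Sum>b<n. sign_mat n $$ (i, b) * ?g $$ (a, b))"
        using s representative_carrier ij that by (simp add: scalar_prod_def atLeast0LessThan)
      also have "\<dots> = (\<Sum>b<n. if b = i then (-1) ^ i * ?g $$ (a, i) else 0)"
        using ij by (intro sum.cong) (auto simp: sign_mat_def mat_diag_def)
      finally show ?thesis
        using ij by simp
    qed
    define M where "M = sign_mat n * transpose_mat ?g"
    have M: "M \<in> carrier_mat n n"
      using s representative_carrier by (simp add: M_def)
    have "(M * sign_mat n) $$ (i, j) = (\<Sum>a<n. M $$ (i, a) * sign_mat n $$ (a, j))"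
      using s M ij by (simp add: scalar_prod_def atLeast0LessThan)
    also have "\<dots> = (\<Sum>a<n. if a = j then (-1) ^ i * ?g $$ (j, i) * (-1) ^ j else 0)"
      using ij by (intro sum.cong) (auto simp: 1[folded M_def] sign_mat_def mat_diag_def)
    also have "\<dots> = ((-1) ^ i * (-1) ^ i) * ((-1) ^ j * eigenmatrix i j)"
      using ij by (simp add: representative_def ac_simps)
    also have "(-1) ^ i * (-1) ^ i = (1 :: real)"
      by (simp flip: power_add mult_2)
    also have "1 * ((-1) ^ j * eigenmatrix i j) = (-1) ^ j * eigenmatrix i j"
      by simp
    finally show "(sign_mat n * transpose_mat ?g * sign_mat n) $$ (i, j) =
        mat n n (\<lambda>(i, j). (-1) ^ j * eigenmatrix i j) $$ (i, j)"
      using ij by (simp add: M_def)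
  qed (auto simp: sign_mat_def mat_diag_def representative_def)
  ultimately show ?thesis
    unfolding twist_def Let_def by simp
qed

end

text \<open>The rows of Z lie in the span of the first \<open>k + m\<close> eigenvectors, so the
  remaining eigenvectors are orthogonal to them and lie in the kernel.\<close>

theorem ball_in_twisted_vandermonde:
  assumes km: "k + m \<le> n" and Z: "Z \<in> carrier_mat (k + m) n" and pos: "maximal_minors_pos (k + m) n Z"
    and tw: "twisted_vandermonde n (k + m) Z"
  shows "ball_in (Gr_real_topology k (k + m)) (k * m) (amplituhedron n k Z)"
proof -
  let ?d = "k + m"
  from tw obtain V where V: "V \<in> vandermonde_flags n" and span: "cspan n (set (rows (cmat Z))) = twist n V ?d"
    unfolding twisted_vandermonde_def by blast
  from V obtain l x :: "nat \<Rightarrow> real" where l: "\<forall>i j. i < j \<and> j < n \<longrightarrow> l j < l i" and x: "\<forall>i<n. 0 < x i"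
    and Veq: "V = flag_of n (cmat (mat n n (\<lambda>(i, j). l i ^ j * x i)))"
    unfolding vandermonde_flags_def by blast
  interpret point_measure n l x
    using l x by unfold_locales auto
  obtain P where "orthonormal_family n P"
    using ex_orthonormal_family[of n] by blast
  then interpret orthonormal_polynomials n l x P
    by unfold_locales
  interpret chart_at_top n jacobi eigenmatrix l k m
    using km by unfold_locales
  show ?thesis
  proof (rule ball_in_amplituhedron[OF Z pos])
    fix r c assume r: "r < ?d" and c: "?d \<le> c" "c < n"
    let ?T = "cmat (mat n n (\<lambda>(i, j). (-1) ^ j * eigenmatrix i j))"
    interpret vs: vec_space "TYPE(complex)" n .
    have T: "?T \<in> carrier_mat n n"
      by simp
    have "row (cmat Z) r \<in> set (rows (cmat Z))"
      using Z r by (auto simp: rows_def)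
    moreover have "set (rows (cmat Z)) \<subseteq> carrier_vec n"
      using Z by (auto simp: rows_def)
    ultimately have "row (cmat Z) r \<in> cspan n (set (rows (cmat Z)))"
      using vs.in_own_span by blast
    then have "row (cmat Z) r \<in> flag_of n ?T ?d"
      unfolding span Veq twist_vandermonde .
    then obtain a where a: "\<forall>i<n. row (cmat Z) r $ i = (\<Sum>b<min ?d n. a b * ?T $$ (i, b))"
      unfolding in_flag_of_iff[OF T] by (elim exE conjE)
    have Z_row: "complex_of_real (Z $$ (r, i)) = (\<Sum>b<?d. a b * complex_of_real ((-1) ^ b * eigenmatrix i b))"
      if i: "i < n" for i
    proof -
      have "complex_of_real (Z $$ (r, i)) = row (cmat Z) r $ i"
        using Z r i by simp
      also have "\<dots> = (\<Sum>b<?d. a b * ?T $$ (i, b))"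
        using a i km by (simp only: min_absorb1)
      also have "\<dots> = (\<Sum>b<?d. a b * complex_of_real ((-1) ^ b * eigenmatrix i b))"
        using i km by (intro sum.cong refl) simp
      finally show ?thesis .
    qed
    have "complex_of_real (\<Sum>i<n. Z $$ (r, i) * eigenmatrix i c) =
        (\<Sum>i<n. (\<Sum>b<?d. a b * complex_of_real ((-1) ^ b * eigenmatrix i b)) * complex_of_real (eigenmatrix i c))"
      unfolding of_real_sum of_real_mult[of "Z $$ _"]
      by (rule sum.cong) (simp_all only: Z_row lessThan_iff)
    also have "\<dots> = (\<Sum>b<?d. a b * complex_of_real ((-1) ^ b * (\<Sum>i<n. eigenmatrix i b * eigenmatrix i c)))"
      unfolding sum_distrib_left sum_distrib_right of_real_sum
      by (subst sum.swap) (simp add: ac_simps)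
    also have "\<dots> = 0"
      using c by (intro sum.neutral) (auto simp: orthonormal)
    finally show "(\<Sum>i<n. Z $$ (r, i) * eigenmatrix i c) = 0"
      by (simp only: of_real_eq_0_iff)
  qed
qed

section \<open>Spectra of Jacobi matrices\<close>

definition jacobi_matrix :: "(nat \<Rightarrow> real) \<Rightarrow> (nat \<Rightarrow> real) \<Rightarrow> nat \<Rightarrow> nat \<Rightarrow> real" where
  "jacobi_matrix a b i j = (if i = j then a i else if j = Suc i then b i else if i = Suc j then b j else 0)"

lemma jacobi_matrix_sym: "jacobi_matrix a b i j = jacobi_matrix a b j i"
  by (auto simp: jacobi_matrix_def)

lemma jacobi_matrix_row_sum:
  fixes v :: "nat \<Rightarrow> 'a :: real_normed_field"
  assumes "i < n"
  shows "(\<Sum>c<n. of_real (jacobi_matrix a b i c) * v c) =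
    (if 0 < i then of_real (b (i - 1)) * v (i - 1) else 0) + of_real (a i) * v i +
    (if Suc i < n then of_real (b i) * v (Suc i) else 0)"
proof -
  have "(\<Sum>c<n. of_real (jacobi_matrix a b i c) * v c) =
      (\<Sum>c<n. (if c = i - 1 then (if 0 < i then of_real (b (i - 1)) * v (i - 1) else 0) else 0) +
        (if c = i then of_real (a i) * v i else 0) + (if c = Suc i then of_real (b i) * v (Suc i) else 0))"
    by (rule sum.cong) (auto simp: jacobi_matrix_def)
  also have "\<dots> = (if 0 < i then of_real (b (i - 1)) * v (i - 1) else 0) + of_real (a i) * v i +
    (if Suc i < n then of_real (b i) * v (Suc i) else 0)"
    using assms by (auto simp: sum.distrib)
  finally show ?thesis .
qed

text \<open>The components of an eigenvector as polynomials in the eigenvalue, found by solving the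
  eigenvector equation from the first row down with first component 1. Up to constants they are the
  characteristic polynomials of the leading blocks. The type is generic to have real and complex
  versions at once.\<close>

fun jacobi_poly :: "(nat \<Rightarrow> real) \<Rightarrow> (nat \<Rightarrow> real) \<Rightarrow> nat \<Rightarrow> 'a :: real_normed_field poly" where
  "jacobi_poly a b 0 = 1"
| "jacobi_poly a b (Suc 0) = Polynomial.smult (of_real (1 / b 0)) [:- of_real (a 0), 1:]"
| "jacobi_poly a b (Suc (Suc j)) = Polynomial.smult (of_real (1 / b (Suc j)))
     ([:- of_real (a (Suc j)), 1:] * jacobi_poly a b (Suc j) - Polynomial.smult (of_real (b j)) (jacobi_poly a b j))"

lemma jacobi_poly_recurrence:
  assumes "b i \<noteq> 0"
  shows "(if 0 < i then Polynomial.smult (of_real (b (i - 1))) (jacobi_poly a b (i - 1)) else 0) +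
    Polynomial.smult (of_real (a i)) (jacobi_poly a b i) + Polynomial.smult (of_real (b i)) (jacobi_poly a b (Suc i)) =
    (pCons 0 (jacobi_poly a b i) :: 'a :: real_normed_field poly)"
proof (cases i)
  case 0
  then show ?thesis
    using assms by (simp add: one_pCons)
next
  case (Suc j)
  have "Polynomial.smult (of_real (b i)) (jacobi_poly a b (Suc i)) =
      [:- of_real (a i), 1:] * jacobi_poly a b i - Polynomial.smult (of_real (b j)) (jacobi_poly a b j :: 'a poly)"
    using assms Suc by (simp flip: of_real_mult)
  then show ?thesis
    using Suc by simp
qed

lemma jacobi_poly_degree:
  assumes "\<And>i. 0 < b i"
  shows "degree (jacobi_poly a b j :: 'a :: real_normed_field poly) = j \<and> (jacobi_poly a b j :: 'a poly) \<noteq> 0"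
proof (induction j rule: less_induct)
  case (less j)
  consider "j = 0" | "j = Suc 0" | i where "j = Suc (Suc i)"
    by (metis not0_implies_Suc)
  then show ?case
  proof cases
    case 2
    then show ?thesis
      using assms[of 0] by simp
  next
    case (3 i)
    let ?p = "[:- of_real (a (Suc i)), 1:] * jacobi_poly a b (Suc i) :: 'a poly"
    let ?q = "Polynomial.smult (of_real (b i)) (jacobi_poly a b i) :: 'a poly"
    have "degree ?p = Suc (Suc i)"
      using less.IH[of "Suc i"] 3 by (subst degree_mult_eq) auto
    moreover have "degree ?q < Suc (Suc i)"
      using less.IH[of i] 3 by simp
    ultimately have "degree (?p - ?q) = Suc (Suc i)"
      using degree_add_eq_left[of "- ?q" ?p] by simp
    moreover have "degree (jacobi_poly a b j :: 'a poly) = degree (?p - ?q)"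
      using assms[of "Suc i"] 3 by (simp only: jacobi_poly.simps degree_smult_eq) simp
    ultimately show ?thesis
      using 3 by (metis degree_0 nat.distinct(1))
  qed simp
qed

lemma jacobi_poly_of_real:
  "poly (jacobi_poly a b j) (of_real t :: 'a :: real_normed_field) = of_real (poly (jacobi_poly a b j) t)"
  by (induction a b j rule: jacobi_poly.induct) auto

text \<open>A root of the last polynomial is an eigenvalue, hence real; it is simple because otherwise
  the derivative of the eigenvector equation would make the eigenvector orthogonal to itself.\<close>

lemma jacobi_matrix_spectrum:
  assumes b: "\<And>i. 0 < b i"
  shows "\<exists>Q ev. jacobi_spectrum n (jacobi_matrix a b) Q ev"
proof -
  let ?J = "jacobi_matrix a b"
  let ?p = "jacobi_poly a b :: nat \<Rightarrow> complex poly"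
  let ?r = "jacobi_poly a b :: nat \<Rightarrow> real poly"
  have rec: "(if 0 < i then Polynomial.smult (of_real (b (i - 1))) (?p (i - 1)) else 0) +
      Polynomial.smult (of_real (a i)) (?p i) + Polynomial.smult (of_real (b i)) (?p (Suc i)) = pCons 0 (?p i)" for i
    by (rule jacobi_poly_recurrence) (use b[of i] in simp)
  have eig: "(\<Sum>c<n. of_real (?J i c) * poly (?p c) z) = z * poly (?p i) z"
    if "i < n" "poly (?p n) z = 0" for i z
  proof -
    have "(if 0 < i then of_real (b (i - 1)) * poly (?p (i - 1)) z else 0) +
        of_real (a i) * poly (?p i) z + of_real (b i) * poly (?p (Suc i)) z = z * poly (?p i) z"
      using arg_cong[OF rec[of i], of "\<lambda>q. poly q z"] by (auto split: if_splits)
    \<comment> \<open>In the last row the recurrence has one term more than the matrix; it contains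
      \<open>?p n\<close> and vanishes at the root.\<close>
    moreover have "(if Suc i < n then of_real (b i) * poly (?p (Suc i)) z else 0) = of_real (b i) * poly (?p (Suc i)) z"
      using that by (cases "Suc i = n") auto
    ultimately show ?thesis
      unfolding jacobi_matrix_row_sum[OF that(1)] by simp
  qed
  have v0: "poly (?p 0) z = 1" for z
    by simp
  have real_root: "Im z = 0" if n: "0 < n" and z: "poly (?p n) z = 0" for z
  proof -
    define v where "v i = poly (?p i) z" for i
    define S where "S = (\<Sum>i<n. cnj (v i) * (\<Sum>c<n. of_real (?J i c) * v c))"
    have "cnj S = (\<Sum>i<n. v i * (\<Sum>c<n. of_real (?J i c) * cnj (v c)))"
      by (simp add: S_def)
    also have "\<dots> = (\<Sum>i<n. \<Sum>c<n. of_real (?J i c) * (v i * cnj (v c)))"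
      by (simp add: sum_distrib_left ac_simps)
    also have "\<dots> = (\<Sum>c<n. \<Sum>i<n. of_real (?J i c) * (v i * cnj (v c)))"
      by (rule sum.swap)
    also have "\<dots> = S"
      unfolding S_def sum_distrib_left
      by (intro sum.cong refl) (simp add: jacobi_matrix_sym[of a b] ac_simps)
    finally have "cnj S = S" .
    moreover have "S = z * complex_of_real (\<Sum>i<n. (cmod (v i))\<^sup>2)"
    proof -
      have "S = (\<Sum>i<n. cnj (v i) * (z * v i))"
        unfolding S_def v_def using eig[OF _ z] by (intro sum.cong) auto
      also have "\<dots> = (\<Sum>i<n. z * complex_of_real ((cmod (v i))\<^sup>2))"
        by (intro sum.cong refl) (simp only: complex_norm_square ac_simps)
      finally show ?thesis
        by (simp add: sum_distrib_left)
    qed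
    moreover have "(\<Sum>i<n. (cmod (v i))\<^sup>2) \<noteq> 0"
    proof -
      have "(cmod (v 0))\<^sup>2 \<le> (\<Sum>i<n. (cmod (v i))\<^sup>2)"
        using n by (intro member_le_sum) auto
      then show ?thesis
        using v0 by (simp add: v_def)
    qed
    ultimately have "cnj z = z"
      by (metis complex_cnj_complex_of_real complex_cnj_mult mult_right_cancel of_real_eq_0_iff)
    then show ?thesis
      by (metis Reals_cnj_iff complex_is_Real_iff)
  qed
  have simple: "poly (pderiv (?p n)) z \<noteq> 0" if n: "0 < n" and z: "poly (?p n) z = 0" for z
  proof
    assume dz: "poly (pderiv (?p n)) z = 0"
    define v where "v i = poly (?p i) z" for i
    define w where "w i = poly (pderiv (?p i)) z" for i
    have "z = of_real (Re z)"
      using real_root[OF n z] by (simp add: complex_eq_iff)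
    then have v_real: "v i = of_real (poly (?r i) (Re z))" for i
      unfolding v_def by (metis jacobi_poly_of_real)
    \<comment> \<open>The recurrence differentiated in the variable; the last row closes up because
      the derivative of \<open>?p n\<close> is assumed to vanish as well.\<close>
    have dw: "(\<Sum>c<n. of_real (?J i c) * w c) = z * w i + v i" if "i < n" for i
    proof -
      have "(if 0 < i then of_real (b (i - 1)) * w (i - 1) else 0) +
          of_real (a i) * w i + of_real (b i) * w (Suc i) = z * w i + v i"
        using arg_cong[OF rec[of i], of "\<lambda>q. poly (pderiv q) z"]
        by (auto simp: pderiv_add pderiv_smult pderiv_pCons w_def v_def split: if_splits)
      moreover have "(if Suc i < n then of_real (b i) * w (Suc i) else 0) = of_real (b i) * w (Suc i)"
        using that dz by (cases "Suc i = n") (auto simp: w_def)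
      ultimately show ?thesis
        unfolding jacobi_matrix_row_sum[OF that] by simp
    qed
    \<comment> \<open>Evaluating the symmetric form at \<open>v\<close> and \<open>w\<close> in both
      orders leaves the sum of \<open>v i * v i\<close> equal to 0. The form is bilinear, without
      conjugation, so the contradiction uses that \<open>v\<close> is real.\<close>
    have "(\<Sum>i<n. v i * (\<Sum>c<n. of_real (?J i c) * w c)) = (\<Sum>i<n. \<Sum>c<n. of_real (?J i c) * (v i * w c))"
      by (simp add: sum_distrib_left ac_simps)
    also have "\<dots> = (\<Sum>c<n. \<Sum>i<n. of_real (?J i c) * (v i * w c))"
      by (rule sum.swap)
    also have "\<dots> = (\<Sum>c<n. w c * (\<Sum>i<n. of_real (?J c i) * v i))"
      unfolding sum_distrib_left
      by (intro sum.cong refl) (simp add: jacobi_matrix_sym[of a b] ac_simps)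
    also have "\<dots> = (\<Sum>c<n. w c * (z * v c))"
      using eig[OF _ z] by (intro sum.cong) (auto simp: v_def)
    finally have "(\<Sum>i<n. v i * (z * w i + v i)) = (\<Sum>c<n. w c * (z * v c))"
      by (simp add: dw)
    then have "(\<Sum>i<n. v i * v i) = 0"
      by (simp add: algebra_simps sum.distrib)
    then have "(\<Sum>i<n. (poly (?r i) (Re z))\<^sup>2) = 0"
      unfolding v_real power2_eq_square by (simp only: of_real_mult[symmetric] of_real_sum[symmetric] of_real_eq_0_iff)
    moreover have "(poly (?r 0) (Re z))\<^sup>2 \<le> (\<Sum>i<n. (poly (?r i) (Re z))\<^sup>2)"
      using n by (intro member_le_sum) auto
    ultimately show False
      by simp
  qed
  define S where "S = {t :: real. poly (?r n) t = 0}"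
  have finS: "finite S" and cardS: "card S = n"
  proof -
    have pn: "degree (?p n) = n" "?p n \<noteq> 0"
      using jacobi_poly_degree[OF b, where 'a = complex] by auto
    have rn: "degree (?r n) = n" "?r n \<noteq> 0"
      using jacobi_poly_degree[OF b, where 'a = real] by auto
    show "finite S"
      unfolding S_def by (rule poly_roots_finite[OF rn(2)])
    show "card S = n"
    proof (cases "n = 0")
      case True
      then show ?thesis
        by (simp add: S_def)
    next
      case False
      then have "rsquarefree (?p n)"
        using simple by (auto simp: rsquarefree_roots)
      \<comment> \<open>Splitting a squarefree polynomial of degree \<open>n\<close> gives
        \<open>n\<close> distinct roots, all of them real.\<close>
      then have "?p n = Polynomial.smult (lead_coeff (?p n)) (\<Prod>z | poly (?p n) z = 0. [:- z, 1:])"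
        by (rule complex_poly_decompose_rsquarefree[symmetric])
      then have "degree (?p n) = degree (Polynomial.smult (lead_coeff (?p n)) (\<Prod>z | poly (?p n) z = 0. [:- z, 1:]))"
        by simp
      also have "\<dots> = degree (\<Prod>z | poly (?p n) z = 0. [:- z, 1:])"
        using pn(2) by simp
      also have "\<dots> = card {z. poly (?p n) z = 0}"
        by (subst degree_prod_eq_sum_degree) auto
      finally have "card {z. poly (?p n) z = 0} = n"
        using pn(1) by simp
      moreover have "{z. poly (?p n) z = 0} = complex_of_real ` S"
      proof (intro equalityI subsetI)
        fix z assume "z \<in> {z. poly (?p n) z = 0}"
        then have z: "poly (?p n) z = 0"
          by simp
        then have "z = of_real (Re z)"
          using real_root False by (simp add: complex_eq_iff)
        then have "Re z \<in> S"
          using z jacobi_poly_of_real[of a b n "Re z", where 'a = complex] by (simp add: S_def)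
        then show "z \<in> complex_of_real ` S"
          using \<open>z = of_real (Re z)\<close> by blast
      next
        fix z assume "z \<in> complex_of_real ` S"
        then show "z \<in> {z. poly (?p n) z = 0}"
          by (auto simp: S_def jacobi_poly_of_real)
      qed
      ultimately show ?thesis
        by (simp add: card_image inj_on_def)
    qed
  qed
  define xs where "xs = rev (sorted_list_of_set S)"
  have xs: "length xs = n" "set xs = S" "sorted_wrt (\<lambda>x y. y < x) xs"
    using finS cardS by (auto simp: xs_def length_sorted_list_of_set sorted_wrt_rev)
  define ev where "ev i = xs ! i" for i
  have ev_root: "poly (?r n) (ev c) = 0" if "c < n" for c
    using that xs nth_mem[of c xs] by (auto simp: ev_def S_def)
  have ev_dec: "ev j < ev i" if "i < j" "j < n" for i j
    using that xs sorted_wrt_nth_less[OF xs(3)] by (simp add: ev_def)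
  define V where "V i c = poly (?r i) (ev c)" for i c
  have eigV: "(\<Sum>j<n. ?J i j * V j c) = ev c * V i c" if "i < n" "c < n" for i c
  proof -
    have "poly (?p n) (of_real (ev c)) = 0"
      using ev_root[OF that(2)] by (simp add: jacobi_poly_of_real)
    from eig[OF that(1) this] have "complex_of_real (\<Sum>j<n. ?J i j * V j c) = complex_of_real (ev c * V i c)"
      by (simp add: jacobi_poly_of_real V_def)
    then show ?thesis
      by (simp only: of_real_eq_iff)
  qed
  have orthV: "(\<Sum>i<n. V i c * V i e) = 0" if "c < n" "e < n" "c \<noteq> e" for c e
  proof -
    have "ev c * (\<Sum>i<n. V i c * V i e) = (\<Sum>i<n. (\<Sum>j<n. ?J i j * V j c) * V i e)"
      using that by (simp add: eigV sum_distrib_left mult.assoc)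
    also have "\<dots> = (\<Sum>i<n. \<Sum>j<n. ?J i j * V j c * V i e)"
      by (simp add: sum_distrib_right)
    also have "\<dots> = (\<Sum>j<n. \<Sum>i<n. ?J i j * V j c * V i e)"
      by (rule sum.swap)
    also have "\<dots> = (\<Sum>j<n. V j c * (\<Sum>i<n. ?J j i * V i e))"
      unfolding sum_distrib_left by (intro sum.cong refl) (simp add: jacobi_matrix_sym[of a b])
    also have "\<dots> = (\<Sum>j<n. V j c * (ev e * V j e))"
      using that by (intro sum.cong refl) (simp add: eigV)
    also have "\<dots> = ev e * (\<Sum>i<n. V i c * V i e)"
      by (simp add: sum_distrib_left ac_simps)
    finally have "(ev c - ev e) * (\<Sum>i<n. V i c * V i e) = 0"
      by (simp add: left_diff_distrib)
    moreover have "ev c \<noteq> ev e"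
      using that ev_dec[of c e] ev_dec[of e c] by (cases c e rule: linorder_cases) auto
    ultimately show ?thesis
      by simp
  qed
  define N where "N c = (\<Sum>i<n. V i c * V i c)" for c
  have N: "0 < N c" if "c < n" for c
  proof -
    have "V 0 c * V 0 c \<le> N c"
      unfolding N_def using that by (intro member_le_sum) auto
    then show ?thesis
      by (simp add: V_def)
  qed
  define Q where "Q i c = V i c / sqrt (N c)" for i c
  have "jacobi_spectrum n ?J Q ev"
  proof
    show "?J i j = 0" if "Suc i < j \<or> Suc j < i" for i j
      using that by (auto simp: jacobi_matrix_def)
    show "0 < ?J i (Suc i)" "0 < ?J (Suc i) i" for i
      using b by (auto simp: jacobi_matrix_def)
    show "(\<Sum>i<n. Q i c * Q i e) = of_bool (c = e)" if "c < n" "e < n" for c e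
    proof -
      have "(\<Sum>i<n. Q i c * Q i e) = (\<Sum>i<n. V i c * V i e) / (sqrt (N c) * sqrt (N e))"
        by (simp add: Q_def sum_divide_distrib)
      then show ?thesis
        using orthV[OF that] N[OF that(1)] by (cases "c = e") (auto simp: N_def[symmetric])
    qed
    show "(\<Sum>j<n. ?J i j * Q j c) = ev c * Q i c" if "i < n" "c < n" for i c
      using eigV[OF that] by (simp add: Q_def sum_divide_distrib[symmetric])
  qed (rule ev_dec)
  then show ?thesis
    by blast
qed

context jacobi_spectrum begin

text \<open>Eigenvectors with positive maximal minors must belong to the top: their span lies in the
  chart, so its projection \<open>G\<close> to the top eigenspace is invertible. Each top
  eigenvector thus overlaps some column of \<open>Y\<close>, and as eigenvalues are simple the two
  are proportional.\<close>

lemma top_eigenvectors: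
  assumes k: "k \<le> n" and sym: "\<And>a b. J a b = J b a"
    and eigY: "\<And>a j. a < n \<Longrightarrow> j < k \<Longrightarrow> (\<Sum>b<n. J a b * Y b j) = \<mu> j * Y a j"
    and pos: "\<And>f. f \<in> increasing k n \<Longrightarrow> 0 < minor k Y f"
    and i: "i < k"
  shows "\<exists>j<k. \<exists>\<kappa>. \<forall>a<n. Q a i = \<kappa> * Y a j"
proof -
  \<comment> \<open>Only the chart itself is used, so \<open>m\<close> is set to 0.\<close>
  interpret c: chart_at_top n J Q ev k 0
    using k by unfold_locales simp
  have "\<exists>x\<in>c.nonneg_coords. \<exists>G. det (mat k k (\<lambda>(i, j). G i j)) \<noteq> 0 \<and>
      (\<forall>a<n. \<forall>j<k. Y a j = (\<Sum>r<k. frame k (c.coords x) a r * G r j))"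
  proof (rule c.nonneg_matrix_in_chart)
    show "\<exists>f\<in>increasing k n. minor k Y f \<noteq> 0"
      using pos[OF c.base_increasing] c.base_increasing by (intro bexI[of _ c.base]) auto
  qed (rule less_imp_le[OF pos])
  then obtain x G where G: "det (mat k k (\<lambda>(i, j). G i j)) \<noteq> 0"
    and Y: "\<forall>a<n. \<forall>j<k. Y a j = (\<Sum>r<k. frame k (c.coords x) a r * G r j)"
    by (elim bexE exE conjE)
  define w where "w l j = (\<Sum>a<n. Q a l * Y a j)" for l j
  have w_top: "w i j = G i j" if "j < k" for j
  proof -
    have "w i j = (\<Sum>a<n. Q a i * (\<Sum>r<k. frame k (c.coords x) a r * G r j))"
      unfolding w_def using Y that by (intro sum.cong) auto
    also have "\<dots> = G i j"
      using i k by (intro sum_mult_inverse) (simp_all add: c.gram_chart chart_def)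
    finally show ?thesis .
  qed
  have "\<exists>j<k. G i j \<noteq> 0"
  proof (rule ccontr)
    assume none: "\<not> (\<exists>j<k. G i j \<noteq> 0)"
    have "(\<Prod>r<k. G r (p r)) = 0" if "p permutes {..<k}" for p
      using none i permutes_in_image[OF that, of i] by (intro prod_zero) auto
    then have "det (mat k k (\<lambda>(i, j). G i j)) = 0"
      unfolding det_mat_leibniz by (intro sum.neutral ballI) (simp del: prod_zero_iff)
    then show False
      using G by simp
  qed
  then obtain j where j: "j < k" "w i j \<noteq> 0"
    using w_top by auto
  \<comment> \<open>By symmetry of \<open>J\<close>, an eigenvector \<open>Y\<close> can have a
    component along \<open>Q l\<close> only if the eigenvalues agree.\<close>
  have wl: "ev l * w l j = \<mu> j * w l j" if "l < n" for l
  proof -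
    have "\<mu> j * w l j = (\<Sum>a<n. Q a l * (\<Sum>b<n. J a b * Y b j))"
      unfolding w_def sum_distrib_left[of "\<mu> j"] using j by (intro sum.cong) (simp_all add: eigY)
    also have "\<dots> = (\<Sum>b<n. (\<Sum>a<n. J a b * Q a l) * Y b j)"
      unfolding sum_distrib_left sum_distrib_right by (subst sum.swap) (simp add: ac_simps)
    also have "\<dots> = (\<Sum>b<n. (\<Sum>a<n. J b a * Q a l) * Y b j)"
      by (intro sum.cong refl) (subst sym, rule refl)
    also have "\<dots> = ev l * w l j"
      unfolding w_def sum_distrib_left using that by (intro sum.cong) (simp_all add: eigen)
    finally show ?thesis ..
  qed
  have ik: "i < n"
    using i k by simp
  have w0: "w l j = 0" if "l < n" "l \<noteq> i" for l
  proof -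
    have "\<mu> j = ev i"
      using wl[OF ik] j by simp
    moreover have "ev l \<noteq> ev i"
      using that ik ev_decreasing[of l i] ev_decreasing[of i l] by (cases l i rule: linorder_cases) auto
    ultimately show ?thesis
      using wl[OF that(1)] by simp
  qed
  have "Y a j = Q a i * w i j" if "a < n" for a
  proof -
    have "Y a j = (\<Sum>l<n. Q a l * w l j)"
      unfolding w_def by (rule sum_mult_inverse[OF orthonormal_rows[OF that] that, symmetric])
    also have "\<dots> = (\<Sum>l<n. if l = i then Q a i * w i j else 0)"
      using w0 by (intro sum.cong) auto
    also have "\<dots> = Q a i * w i j"
      using ik by simp
    finally show ?thesis .
  qed
  then have "\<forall>a<n. Q a i = (1 / w i j) * Y a j"
    using j(2) by simp
  with j(1) show ?thesis
    by (intro exI[of _ j] exI[of _ "1 / w i j"] conjI)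
qed

end

text \<open>Conjugating \<open>- J\<close> by \<open>Diag(1, -1, 1, \<dots>)\<close> again gives a Jacobi matrix, with the order
  of the eigenvalues reversed.\<close>

lemma reversed_spectrum:
  assumes "jacobi_spectrum n J Q ev"
  shows "jacobi_spectrum n (\<lambda>a b. - ((-1) ^ a * (-1) ^ b * J a b))
    (\<lambda>a c. (-1) ^ a * Q a (n - 1 - c)) (\<lambda>c. - ev (n - 1 - c))"
proof -
  interpret jacobi_spectrum n J Q ev
    by (rule assms)
  have sq: "(-1) ^ a * (-1) ^ a = (1 :: real)" for a :: nat
    by (simp flip: power_add mult_2)
  show ?thesis
  proof
    fix i j assume "i < n" "j < n" "Suc i < j \<or> Suc j < i"
    then show "- ((-1) ^ i * (-1) ^ j * J i j) = 0"
      using tridiagonal by simp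
  next
    fix i assume "Suc i < n"
    then show "0 < - ((-1) ^ i * (-1) ^ Suc i * J i (Suc i))" "0 < - ((-1) ^ Suc i * (-1) ^ i * J (Suc i) i)"
      using super_pos sub_pos by (simp_all add: sq)
  next
    fix i j assume ij: "i < n" "j < n"
    have "(-1) ^ a * Q a (n - 1 - i) * ((-1) ^ a * Q a (n - 1 - j)) = Q a (n - 1 - i) * Q a (n - 1 - j)" for a
    proof -
      have "(-1) ^ a * Q a (n - 1 - i) * ((-1) ^ a * Q a (n - 1 - j)) =
          ((-1) ^ a * (-1) ^ a) * (Q a (n - 1 - i) * Q a (n - 1 - j))"
        by (simp only: ac_simps)
      then show ?thesis
        by (simp only: sq mult_1)
    qed
    then have "(\<Sum>a<n. (-1) ^ a * Q a (n - 1 - i) * ((-1) ^ a * Q a (n - 1 - j))) = of_bool (n - 1 - i = n - 1 - j)"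
      using orthonormal[of "n - 1 - i" "n - 1 - j"] ij by (simp only:)
    also have "n - 1 - i = n - 1 - j \<longleftrightarrow> i = j"
      using ij by auto
    finally show "(\<Sum>a<n. (-1) ^ a * Q a (n - 1 - i) * ((-1) ^ a * Q a (n - 1 - j))) = of_bool (i = j)" .
  next
    fix a c assume ac: "a < n" "c < n"
    have "(\<Sum>b<n. - ((-1) ^ a * (-1) ^ b * J a b) * ((-1) ^ b * Q b (n - 1 - c))) =
        (\<Sum>b<n. - ((-1) ^ a) * (J a b * Q b (n - 1 - c)))"
    proof (rule sum.cong[OF refl])
      fix b
      have "- ((-1) ^ a * (-1) ^ b * J a b) * ((-1) ^ b * Q b (n - 1 - c)) =
          - ((-1) ^ a) * (((-1) ^ b * (-1) ^ b) * (J a b * Q b (n - 1 - c)))"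
        by (simp add: ac_simps)
      then show "- ((-1) ^ a * (-1) ^ b * J a b) * ((-1) ^ b * Q b (n - 1 - c)) =
          - ((-1) ^ a) * (J a b * Q b (n - 1 - c))"
        by (simp only: sq mult_1)
    qed
    also have "\<dots> = - ((-1) ^ a) * (ev (n - 1 - c) * Q a (n - 1 - c))"
      using eigen[of a "n - 1 - c"] ac unfolding sum_distrib_left[symmetric] by simp
    finally show "(\<Sum>b<n. - ((-1) ^ a * (-1) ^ b * J a b) * ((-1) ^ b * Q b (n - 1 - c))) =
        - ev (n - 1 - c) * ((-1) ^ a * Q a (n - 1 - c))"
      by simp
  next
    fix i j assume "i < j" "j < n"
    then show "- ev (n - 1 - j) < - ev (n - 1 - i)"
      using ev_decreasing[of "n - 1 - j" "n - 1 - i"] by auto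
  qed
qed

text \<open>\<open>Y\<close> is the kernel after alternating signs. Positive minors force it to be
  the top eigenspace of the Jacobi matrix; \<open>reversed_spectrum\<close> moves it to the last
  \<open>c\<close> columns and restores the signs.\<close>

lemma codimension_spectrum:
  assumes b: "\<And>i. 0 < b i" and c: "c \<le> n"
    and eigY: "\<And>a' j. a' < n \<Longrightarrow> j < c \<Longrightarrow> (\<Sum>e<n. jacobi_matrix a b a' e * Y e j) = \<mu> j * Y a' j"
    and pos: "\<And>f. f \<in> increasing c n \<Longrightarrow> 0 < minor c Y f"
    and ker: "\<And>r j. r < d \<Longrightarrow> j < c \<Longrightarrow> (\<Sum>e<n. Z $$ (r, e) * ((-1) ^ e * Y e j)) = 0"
  shows "\<exists>J Q ev. jacobi_spectrum n J Q ev \<and>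
    (\<forall>r<d. \<forall>e. n - c \<le> e \<longrightarrow> e < n \<longrightarrow> (\<Sum>i<n. Z $$ (r, i) * Q i e) = 0)"
proof -
  obtain Q ev where spec: "jacobi_spectrum n (jacobi_matrix a b) Q ev"
    using jacobi_matrix_spectrum[of b n a] b by blast
  interpret jacobi_spectrum n "jacobi_matrix a b" Q ev
    by (rule spec)
  have "(\<Sum>i<n. Z $$ (r, i) * ((-1) ^ i * Q i (n - 1 - e))) = 0" if "r < d" "n - c \<le> e" "e < n" for r e
  proof -
    have "n - 1 - e < c"
      using that by simp
    from top_eigenvectors[OF c jacobi_matrix_sym eigY pos this]
    obtain j \<kappa> where j: "j < c" "\<And>i. i < n \<Longrightarrow> Q i (n - 1 - e) = \<kappa> * Y i j"
      by blast
    have "(\<Sum>i<n. Z $$ (r, i) * ((-1) ^ i * Q i (n - 1 - e))) =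
        \<kappa> * (\<Sum>i<n. Z $$ (r, i) * ((-1) ^ i * Y i j))"
      unfolding sum_distrib_left by (intro sum.cong refl) (simp only: j(2) lessThan_iff ac_simps)
    then show ?thesis
      using ker[OF that(1) j(1)] by simp
  qed
  then show ?thesis
    using reversed_spectrum[OF spec] by blast
qed

section \<open>Kernels of codimension at most two\<close>

definition skip :: "nat \<Rightarrow> nat \<Rightarrow> nat" where
  "skip j r = (if r < j then r else Suc r)"

text \<open>Laplace expansion of a determinant whose last column repeats column \<open>r\<close>:
  the signed maximal minors are a linear relation among \<open>d + 1\<close> rows.\<close>

lemma alternating_kernel_vector:
  fixes Y :: "nat \<Rightarrow> nat \<Rightarrow> 'a :: comm_ring_1"
  assumes r: "r < d"
  shows "(\<Sum>j<Suc d. Y (f j) r * ((-1) ^ j * minor d Y (\<lambda>i. f (skip j i)))) = 0"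
proof -
  let ?M = "mat (Suc d) (Suc d) (\<lambda>(i, c). Y (f i) (if c = d then r else c))"
  have "det ?M = 0"
    using r by (intro det_identical_columns[of _ "Suc d" r d]) (auto intro!: eq_vecI)
  moreover have "det ?M = (\<Sum>j<Suc d. ?M $$ (j, d) * cofactor ?M j d)"
    by (rule laplace_expansion_column) auto
  moreover have "?M $$ (j, d) * cofactor ?M j d = (-1) ^ d * (Y (f j) r * ((-1) ^ j * minor d Y (\<lambda>i. f (skip j i))))"
    if "j < Suc d" for j
  proof -
    have "mat_delete ?M j d = mat d d (\<lambda>(i, c). Y (f (skip j i)) c)"
      using that by (intro eq_matI) (auto simp: mat_delete_def skip_def)
    then show ?thesis
      using that by (simp add: cofactor_def minor_def power_add ac_simps)
  qed
  ultimately have "(-1) ^ d * (\<Sum>j<Suc d. Y (f j) r * ((-1) ^ j * minor d Y (\<lambda>i. f (skip j i)))) = 0"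
    by (simp add: sum_distrib_left del: sum.lessThan_Suc)
  then have "(-1) ^ d * ((-1) ^ d * (\<Sum>j<Suc d. Y (f j) r * ((-1) ^ j * minor d Y (\<lambda>i. f (skip j i))))) = 0"
    by simp
  then show ?thesis
    by (simp add: mult.assoc[symmetric] del: sum.lessThan_Suc flip: power_add mult_2)
qed

locale positive_matrix =
  fixes d n :: nat and Z :: "real mat"
  assumes Z: "Z \<in> carrier_mat d n" and pos: "maximal_minors_pos d n Z"
begin

text \<open>Transposed, because \<open>minor\<close> selects rows while Z has positive minors on
  sets of columns.\<close>

definition Y :: "nat \<Rightarrow> nat \<Rightarrow> real" where
  "Y a i = Z $$ (i, a)"

lemma minor_pos:
  assumes "\<And>i j. i < j \<Longrightarrow> j < d \<Longrightarrow> f i < f j" "\<And>i. i < d \<Longrightarrow> f i < n"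
  shows "0 < minor d Y f"
proof -
  have "restrict f {..<d} \<in> increasing d n"
    using assms by (auto simp: increasing_def strict_mono_on_def)
  from maximal_minors_posD[OF Z pos this]
  have "0 < minor d Y (restrict f {..<d})"
    by (simp add: Y_def[abs_def])
  also have "minor d Y (restrict f {..<d}) = minor d Y f"
    by (rule minor_cong) simp
  finally show ?thesis .
qed

text \<open>Any \<open>d\<close> columns of \<open>Z\<close> are independent, so a kernel vector
  supported on \<open>d\<close> indices vanishes.\<close>

lemma kernel_two_zeros:
  assumes n: "n = Suc (Suc d)" and e: "e < n" "e' < n" "e \<noteq> e'"
    and ker: "\<And>r. r < d \<Longrightarrow> (\<Sum>a<n. Z $$ (r, a) * t a) = 0" and t: "t e = 0" "t e' = 0"
    and a: "a < n"
  shows "t a = 0"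
proof (cases "a \<in> {e, e'}")
  case False
  let ?I = "{..<n} - {e, e'}"
  have "card ?I = d"
    using e n by (simp add: card_Diff_subset)
  then obtain g where g: "g \<in> increasing d n" "g ` {..<d} = ?I"
    using increasing_onto[of ?I n d] by auto
  have inj: "inj_on g {..<d}"
    using g(1) by (auto simp: increasing_def strict_mono_on_imp_inj_on)
  let ?M = "mat d d (\<lambda>(i, j). Y (g j) i)"
  have "det ?M = det (transpose_mat (mat d d (\<lambda>(i, j). Y (g i) j)))"
    by (rule arg_cong[of _ _ det]) (auto intro!: eq_matI)
  also have "\<dots> = minor d Y g"
    by (subst det_transpose[of _ d]) (auto simp: minor_def)
  finally have det: "det ?M \<noteq> 0"
    using maximal_minors_posD[OF Z pos g(1)] by (simp add: Y_def[abs_def])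
  let ?v = "vec d (\<lambda>i. t (g i))"
  have "?M *\<^sub>v ?v = 0\<^sub>v d"
  proof (rule eq_vecI)
    fix r assume "r < dim_vec (0\<^sub>v d :: real vec)"
    then have r: "r < d"
      by simp
    have "(?M *\<^sub>v ?v) $ r = (\<Sum>i<d. Z $$ (r, g i) * t (g i))"
      using r by (simp add: scalar_prod_def atLeast0LessThan Y_def)
    also have "\<dots> = (\<Sum>a\<in>?I. Z $$ (r, a) * t a)"
      unfolding g(2)[symmetric] by (rule sum.reindex_cong[OF inj refl, symmetric]) simp
    also have "\<dots> = (\<Sum>a<n. Z $$ (r, a) * t a)"
      using t by (intro sum.mono_neutral_left) auto
    finally show "(?M *\<^sub>v ?v) $ r = 0\<^sub>v d $ r"
      using ker[OF r] r by simp
  qed simp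
  moreover have "?M \<in> carrier_mat d d" "?v \<in> carrier_vec d"
    by auto
  ultimately have "?v = 0\<^sub>v d"
    using det det_0_iff_vec_prod_zero_field[of ?M d] by blast
  obtain i where "i < d" "a = g i"
    using False a g(2) by (metis (no_types, lifting) DiffI imageE lessThan_iff)
  then have "t a = ?v $ i"
    by simp
  then show ?thesis
    using \<open>?v = 0\<^sub>v d\<close> \<open>i < d\<close> by simp
qed (use t in auto)

lemma codimension_one:
  assumes n: "n = Suc d"
  shows "\<exists>v. (\<forall>a<n. 0 < v a) \<and> (\<forall>r<d. (\<Sum>a<n. Z $$ (r, a) * ((-1) ^ a * v a)) = 0)"
proof (intro exI[of _ "\<lambda>j. minor d Y (skip j)"] conjI allI impI)
  show "0 < minor d Y (skip a)" if "a < n" for a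
    using n by (intro minor_pos) (auto simp: skip_def)
  show "(\<Sum>a<n. Z $$ (r, a) * ((-1) ^ a * minor d Y (skip a))) = 0" if "r < d" for r
    using alternating_kernel_vector[OF that, of Y "\<lambda>j. j"] n by (simp add: Y_def del: sum.lessThan_Suc)
qed

text \<open>Delete column \<open>e\<close> and take the alternating vector of maximal minors of the
  rest. Reinserting \<open>e\<close> shifts the later indices by one, so relative to the full
  alternating signs the vector changes sign exactly at \<open>e\<close>.\<close>

lemma one_zero_kernel_vector:
  assumes n: "n = Suc (Suc d)" and e: "e < n"
  shows "\<exists>v. v e = 0 \<and> (\<forall>a<n. (a < e \<longrightarrow> v a < 0) \<and> (e < a \<longrightarrow> 0 < v a)) \<and>
    (\<forall>r<d. (\<Sum>a<n. Z $$ (r, a) * ((-1) ^ a * v a)) = 0)"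
proof -
  define w where "w j = minor d Y (\<lambda>i. skip e (skip j i))" for j
  have w: "0 < w j" for j
    unfolding w_def using n by (intro minor_pos) (auto simp: skip_def)
  define v where "v a = (if a < e then - w a else if a = e then 0 else w (a - 1))" for a
  have "(\<Sum>a<n. Z $$ (r, a) * ((-1) ^ a * v a)) = 0" if r: "r < d" for r
  proof -
    have inj: "inj_on (skip e) {..<Suc d}"
      by (auto simp: inj_on_def skip_def split: if_splits)
    have im: "skip e ` {..<Suc d} = {..<n} - {e}"
    proof (rule card_subset_eq)
      show "skip e ` {..<Suc d} \<subseteq> {..<n} - {e}"
        using n by (auto simp: skip_def)
      show "card (skip e ` {..<Suc d}) = card ({..<n} - {e})"
        using e n by (simp add: card_image[OF inj])
    qed simp
    have "(\<Sum>a<n. Z $$ (r, a) * ((-1) ^ a * v a)) = (\<Sum>a\<in>{..<n} - {e}. Z $$ (r, a) * ((-1) ^ a * v a))"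
      by (rule sum.mono_neutral_right) (auto simp: v_def)
    also have "\<dots> = (\<Sum>j<Suc d. Z $$ (r, skip e j) * ((-1) ^ skip e j * v (skip e j)))"
      unfolding im[symmetric] by (rule sum.reindex_cong[OF inj refl]) simp
    also have "\<dots> = (\<Sum>j<Suc d. - (Y (skip e j) r * ((-1) ^ j * w j)))"
      by (rule sum.cong) (auto simp: skip_def v_def Y_def)
    also have "\<dots> = 0"
      using alternating_kernel_vector[OF r, of Y "skip e"] by (simp add: sum_negf w_def del: sum.lessThan_Suc)
    finally show ?thesis .
  qed
  then show ?thesis
    using w by (intro exI[of _ v]) (auto simp: v_def)
qed

text \<open>The ratio of the two kernel vectors vanishing at the first and at the last index is
  monotone; orthogonalising one of them against their sum keeps the two-by-two minors.\<close>

lemma codimension_two: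
  assumes n: "n = Suc (Suc d)"
  shows "\<exists>x y. (\<forall>a<n. 0 < x a) \<and> (\<forall>i j. i < j \<longrightarrow> j < n \<longrightarrow> 0 < x i * y j - x j * y i) \<and>
    (\<Sum>a<n. x a * y a) = 0 \<and>
    (\<forall>r<d. (\<Sum>a<n. Z $$ (r, a) * ((-1) ^ a * x a)) = 0 \<and> (\<Sum>a<n. Z $$ (r, a) * ((-1) ^ a * y a)) = 0)"
proof -
  have "\<forall>e. \<exists>v. e < n \<longrightarrow> v e = 0 \<and> (\<forall>a<n. (a < e \<longrightarrow> v a < 0) \<and> (e < a \<longrightarrow> 0 < v a)) \<and>
      (\<forall>r<d. (\<Sum>a<n. Z $$ (r, a) * ((-1) ^ a * v a)) = 0)"
  proof
    fix e
    show "\<exists>v. e < n \<longrightarrow> v e = 0 \<and> (\<forall>a<n. (a < e \<longrightarrow> v a < 0) \<and> (e < a \<longrightarrow> 0 < v a)) \<and>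
        (\<forall>r<d. (\<Sum>a<n. Z $$ (r, a) * ((-1) ^ a * v a)) = 0)"
    proof (cases "e < n")
      case True
      from one_zero_kernel_vector[OF n this] show ?thesis
        by (rule ex_forward) simp
    qed simp
  qed
  from choice[OF this]
  obtain V where V': "\<forall>e. e < n \<longrightarrow> V e e = 0 \<and> (\<forall>a<n. (a < e \<longrightarrow> V e a < 0) \<and> (e < a \<longrightarrow> 0 < V e a)) \<and>
      (\<forall>r<d. (\<Sum>a<n. Z $$ (r, a) * ((-1) ^ a * V e a)) = 0)"
    by (elim exE)
  have V: "V e e = 0" "\<And>a. a < e \<Longrightarrow> V e a < 0" "\<And>a. e < a \<Longrightarrow> a < n \<Longrightarrow> 0 < V e a"
      "\<And>r. r < d \<Longrightarrow> (\<Sum>a<n. Z $$ (r, a) * ((-1) ^ a * V e a)) = 0" if "e < n" for e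
    using V' that by simp_all
  \<comment> \<open>Kernel vectors, up to alternating signs, vanishing at the first and at the last
    index and positive elsewhere.\<close>
  define p q where "p = V 0" and "q a = - V (n - 1) a" for a
  have p: "p 0 = 0" "\<And>a. 0 < a \<Longrightarrow> a < n \<Longrightarrow> 0 < p a"
    using V(1,3)[of 0] n by (auto simp: p_def)
  have q: "q (n - 1) = 0" "\<And>a. a < n - 1 \<Longrightarrow> 0 < q a"
    using V(1,2)[of "n - 1"] n by (auto simp: q_def)
  have kerp: "(\<Sum>a<n. Z $$ (r, a) * ((-1) ^ a * p a)) = 0" if "r < d" for r
    using V(4)[of 0 r] n that by (simp add: p_def)
  have kerq: "(\<Sum>a<n. Z $$ (r, a) * ((-1) ^ a * q a)) = 0" if "r < d" for r
    using V(4)[of "n - 1" r] n that by (simp add: q_def sum_negf)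
  have lin: "(\<Sum>a<n. Z $$ (r, a) * ((-1) ^ a * (s * u a + t * v a))) =
      s * (\<Sum>a<n. Z $$ (r, a) * ((-1) ^ a * u a)) + t * (\<Sum>a<n. Z $$ (r, a) * ((-1) ^ a * v a))" for r s t u v
    by (simp add: algebra_simps sum.distrib sum_distrib_left)
  have D: "0 < q i * p j - q j * p i" if ij: "i < j" "j < n" for i j
  proof (cases "i = 0")
    case True
    then show ?thesis
      using p(1) p(2)[of j] q(2)[of 0] ij n by simp
  next
    case False
    have qi: "0 < q i" and pi: "0 < p i" and q0: "0 < q 0" and i: "i < n"
      using q(2)[of i] q(2)[of 0] p(2)[of i] ij n False by auto
    \<comment> \<open>A combination of \<open>p\<close> and \<open>q\<close> vanishing at
      \<open>i\<close>, hence a multiple of \<open>V i\<close>. Both are negative at index 0, so the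
      factor is positive and the sign of \<open>T j\<close> is that of \<open>V i j\<close>.\<close>
    define T where "T a = q i * p a + (- p i) * q a" for a
    have Vi0: "V i 0 < 0"
      using V(2)[OF i, of 0] False by simp
    define \<rho> where "\<rho> = T 0 / V i 0"
    have T0: "T 0 < 0"
      using p(1) pi q0 by (simp add: T_def)
    have rho: "0 < \<rho>"
      unfolding \<rho>_def using T0 Vi0 by (rule divide_neg_neg)
    have "(-1) ^ j * (T j + (- \<rho>) * V i j) = 0"
    proof (rule kernel_two_zeros[OF n, of 0 i "\<lambda>a. (-1) ^ a * (T a + (- \<rho>) * V i a)"])
      fix r assume r: "r < d"
      have "(\<Sum>a<n. Z $$ (r, a) * ((-1) ^ a * T a)) = 0"
        unfolding T_def lin using kerp[OF r] kerq[OF r] by simp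
      then show "(\<Sum>a<n. Z $$ (r, a) * ((-1) ^ a * (T a + (- \<rho>) * V i a))) = 0"
        using lin[of r 1 T "- \<rho>" "V i"] V(4)[OF i r] by simp
    qed (use False i ij Vi0 V(1)[OF i] in \<open>auto simp: \<rho>_def T_def\<close>)
    then have "T j = \<rho> * V i j"
      by simp
    then have "0 < T j"
      using rho V(3)[OF i ij] by simp
    then show ?thesis
      by (simp add: T_def mult.commute)
  qed
  define x where "x a = p a + q a" for a
  have x: "0 < x a" if "a < n" for a
    using p(1) p(2)[of a] q(1) q(2)[of a] that n by (cases "a = 0"; cases "a = n - 1") (auto simp: x_def intro: add_pos_pos)
  define \<kappa> where "\<kappa> = (\<Sum>a<n. x a * p a) / (\<Sum>a<n. x a * x a)"
  define y where "y a = p a - \<kappa> * x a" for a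
  have "x 0 * x 0 \<le> (\<Sum>a<n. x a * x a)"
    using n by (intro member_le_sum) auto
  then have xx: "0 < (\<Sum>a<n. x a * x a)"
    using mult_pos_pos[OF x[of 0] x[of 0]] n by linarith
  have "(\<Sum>a<n. x a * y a) = (\<Sum>a<n. x a * p a) - \<kappa> * (\<Sum>a<n. x a * x a)"
    by (simp add: y_def algebra_simps sum_subtractf sum_distrib_left)
  also have "\<dots> = 0"
    using xx by (simp add: \<kappa>_def)
  finally have orth: "(\<Sum>a<n. x a * y a) = 0" .
  \<comment> \<open>Passing from \<open>q\<close>, \<open>p\<close> to \<open>x = p + q\<close>,
    \<open>y = p - \<kappa> * x\<close> has determinant 1, so these are the minors of
    \<open>D\<close>.\<close>
  have minors: "0 < x i * y j - x j * y i" if "i < j" "j < n" for i j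
    using D[OF that] by (simp add: x_def y_def algebra_simps)
  have kerx: "(\<Sum>a<n. Z $$ (r, a) * ((-1) ^ a * x a)) = 0" if "r < d" for r
    using lin[of r 1 p 1 q] kerp[OF that] kerq[OF that] by (simp add: x_def)
  have kery: "(\<Sum>a<n. Z $$ (r, a) * ((-1) ^ a * y a)) = 0" if "r < d" for r
    using lin[of r 1 p "- \<kappa>" x] kerp[OF that] kerx[OF that] by (simp add: y_def)
  show ?thesis
    by (intro exI[of _ x] exI[of _ y] conjI allI impI x minors orth kerx kery)
qed

text \<open>In each case the kernel is realised as an eigenspace of an explicit Jacobi matrix; in
  codimension two \<open>x\<close> and \<open>y\<close> get the eigenvalues \<open>0\<close> and \<open>- 1\<close>.\<close>

lemma small_codimension_spectrum:
  assumes "d \<le> n" "n - d \<le> 2"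
  shows "\<exists>J Q ev. jacobi_spectrum n J Q ev \<and>
    (\<forall>r<d. \<forall>e. d \<le> e \<longrightarrow> e < n \<longrightarrow> (\<Sum>i<n. Z $$ (r, i) * Q i e) = 0)"
proof -
  consider "n = d" | "n = Suc d" | "n = Suc (Suc d)"
    using assms by linarith
  then show ?thesis
  proof cases
    case 1
    \<comment> \<open>The kernel is trivial, so any Jacobi matrix serves.\<close>
    have "\<exists>J Q ev. jacobi_spectrum n J Q ev \<and>
        (\<forall>r<d. \<forall>e. n - 0 \<le> e \<longrightarrow> e < n \<longrightarrow> (\<Sum>i<n. Z $$ (r, i) * Q i e) = 0)"
      by (rule codimension_spectrum[where b = "\<lambda>_. 1" and Y = "\<lambda>_ _. 0" and \<mu> = "\<lambda>_. 0"])
        (auto simp: minor_leibniz)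
    then show ?thesis
      using 1 by simp
  next
    case 2
    obtain v where v: "\<forall>a<n. 0 < v a" "\<forall>r<d. (\<Sum>a<n. Z $$ (r, a) * ((-1) ^ a * v a)) = 0"
      using codimension_one[OF 2] by blast
    \<comment> \<open>With all off-diagonal entries 1, this diagonal makes \<open>v\<close> an
      eigenvector for eigenvalue 0.\<close>
    define a where "a i = - ((if 0 < i then v (i - 1) else 0) + (if Suc i < n then v (Suc i) else 0)) / v i" for i
    have "\<exists>J Q ev. jacobi_spectrum n J Q ev \<and>
        (\<forall>r<d. \<forall>e. n - 1 \<le> e \<longrightarrow> e < n \<longrightarrow> (\<Sum>i<n. Z $$ (r, i) * Q i e) = 0)"
    proof (rule codimension_spectrum[where a = a and b = "\<lambda>_. 1" and Y = "\<lambda>i _. v i" and \<mu> = "\<lambda>_. 0"])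
      fix i j assume i: "i < n"
      then have "v i \<noteq> 0"
        using v(1) by (metis less_irrefl)
      then have "a i * v i = - ((if 0 < i then v (i - 1) else 0) + (if Suc i < n then v (Suc i) else 0))"
        by (simp add: a_def)
      then show "(\<Sum>e<n. jacobi_matrix a (\<lambda>_. 1) i e * v e) = 0 * v i"
        using jacobi_matrix_row_sum[OF i, of a "\<lambda>_. 1" v] by (simp split: if_splits)
    next
      fix f assume "f \<in> increasing 1 n"
      then have "f 0 < n"
        by (auto simp: increasing_def)
      moreover have "minor 1 (\<lambda>i _. v i) f = v (f 0)"
        by (simp add: minor_def det_single)
      ultimately show "0 < minor 1 (\<lambda>i _. v i) f"
        using v(1) by simp
    qed (use 2 v in auto)
    then show ?thesis
      using 2 by simp
  next
    case 3
    obtain x y where x: "\<And>a. a < n \<Longrightarrow> 0 < x a" and xy: "\<And>i j. i < j \<Longrightarrow> j < n \<Longrightarrow> 0 < x i * y j - x j * y i"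
      and orth: "(\<Sum>a<n. x a * y a) = 0"
      and ker: "\<And>r. r < d \<Longrightarrow> (\<Sum>a<n. Z $$ (r, a) * ((-1) ^ a * x a)) = 0"
        "\<And>r. r < d \<Longrightarrow> (\<Sum>a<n. Z $$ (r, a) * ((-1) ^ a * y a)) = 0"
      using codimension_two[OF 3] by blast
    \<comment> \<open>Discrete Wronskian. If the diagonal is chosen so that \<open>x\<close> has
      eigenvalue 0, then row \<open>i\<close> of the matrix applied to \<open>y\<close>, times
      \<open>x i\<close>, is \<open>b i * D i - b (i - 1) * D (i - 1)\<close>. Eigenvalue -1
      requires this to be \<open>- (x i * y i)\<close>, so \<open>b i * D i\<close> must be the
      negative partial sum \<open>s i\<close>.\<close>
    define D where "D i = x i * y (Suc i) - x (Suc i) * y i" for i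
    define s where "s i = - (\<Sum>j<Suc i. x j * y j)" for i
    have D: "0 < D i" if "Suc i < n" for i
      unfolding D_def by (rule xy[OF _ that]) simp
    \<comment> \<open>The ratio of \<open>y\<close> to \<open>x\<close> increases, so the terms
      \<open>x j * y j\<close> change sign at most once, from negative to positive. Their total is
      0, hence proper partial sums are negative.\<close>
    have s: "0 < s i" if i: "Suc i < n" for i
    proof (rule ccontr)
      assume "\<not> 0 < s i"
      then have ge: "0 \<le> (\<Sum>j<Suc i. x j * y j)"
        by (simp add: s_def)
      have yi: "0 \<le> y i"
      proof (rule ccontr)
        assume neg: "\<not> 0 \<le> y i"
        have "x j * y j < 0" if "j < Suc i" for j
        proof (cases "j = i")
          case True
          then show ?thesis
            using neg x[of i] i by (simp add: mult_pos_neg)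
        next
          case False
          then have "x i * y j < x j * y i"
            using xy[of j i] that i by (simp add: mult.commute)
          also have "x j * y i < 0"
            using x[of j] that i neg by (simp add: mult_pos_neg)
          finally have "y j < 0"
            using x[of i] i by (simp add: mult_less_0_iff)
          then show ?thesis
            using x[of j] that i by (simp add: mult_pos_neg)
        qed
        then have "(\<Sum>j<Suc i. x j * y j) < (\<Sum>j<Suc i. 0)"
          by (intro sum_strict_mono) auto
        then show False
          using ge by simp
      qed
      have "0 < x j * y j" if "i < j" "j < n" for j
      proof -
        have "0 \<le> x j * y i"
          using yi x[OF that(2)] by simp
        then have "0 < x i * y j"
          using xy[OF that] by linarith
        then show ?thesis
          using x[of i] x[of j] that i by (simp add: zero_less_mult_iff)
      qed
      then have "0 < (\<Sum>j\<in>{Suc i..<n}. x j * y j)"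
        using i by (intro sum_pos) auto
      moreover have "(\<Sum>j<n. x j * y j) = (\<Sum>j<Suc i. x j * y j) + (\<Sum>j\<in>{Suc i..<n}. x j * y j)"
        using i by (subst sum.union_disjoint[symmetric]) (auto intro!: sum.cong)
      ultimately show False
        using ge orth by linarith
    qed
    \<comment> \<open>The value 1 lies outside the matrix and only keeps \<open>b\<close> positive
      at every index.\<close>
    define b where "b i = (if Suc i < n then s i / D i else 1)" for i
    define a where "a i = - ((if 0 < i then b (i - 1) * x (i - 1) else 0) +
        (if Suc i < n then b i * x (Suc i) else 0)) / x i" for i
    have b: "0 < b i" for i
      using s[of i] D[of i] by (simp add: b_def)
    define W where "W i j = (if j = (0::nat) then x i else y i)" for i :: nat and j
    have "\<exists>J Q ev. jacobi_spectrum n J Q ev \<and>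
        (\<forall>r<d. \<forall>e. n - 2 \<le> e \<longrightarrow> e < n \<longrightarrow> (\<Sum>i<n. Z $$ (r, i) * Q i e) = 0)"
    proof (rule codimension_spectrum[where a = a and Y = W and \<mu> = "\<lambda>j. if j = 0 then 0 else - 1", OF b])
      show "2 \<le> n"
        using 3 by simp
    next
      fix i j :: nat assume i: "i < n" and j: "j < 2"
      have a_eq: "a i * x i = - ((if 0 < i then b (i - 1) * x (i - 1) else 0) + (if Suc i < n then b i * x (Suc i) else 0))"
        using x[OF i] by (simp add: a_def)
      have rowx: "(\<Sum>e<n. jacobi_matrix a b i e * x e) = 0"
        using jacobi_matrix_row_sum[OF i, of a b x] a_eq by simp
      have bD: "(if 0 < i then b (i - 1) * (x (i - 1) * y i - x i * y (i - 1)) else 0) =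
          (if 0 < i then s (i - 1) else 0)"
        using D[of "i - 1"] i by (auto simp: b_def D_def)
      have bD': "(if Suc i < n then b i * (x i * y (Suc i) - x (Suc i) * y i) else 0) = (if Suc i < n then s i else 0)"
        using D[of i] by (auto simp: b_def D_def)
      \<comment> \<open>In the last row the partial sum is the whole sum, which is 0 by
        orthogonality; this is why \<open>y\<close> was made orthogonal to \<open>x\<close>.\<close>
      have "(if Suc i < n then s i else 0) = s i"
      proof (cases "Suc i < n")
        case False
        then have "n = Suc i"
          using i by simp
        then show ?thesis
          using orth by (simp add: s_def)
      qed simp
      moreover have "(if 0 < i then s (i - 1) else 0) = s i + x i * y i"
        by (cases i) (simp_all add: s_def)
      ultimately have step: "(if Suc i < n then b i * (x i * y (Suc i) - x (Suc i) * y i) else 0) -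
          (if 0 < i then b (i - 1) * (x (i - 1) * y i - x i * y (i - 1)) else 0) = - (x i * y i)"
        using bD bD' by simp
      have "x i * (\<Sum>e<n. jacobi_matrix a b i e * y e) =
          x i * ((if 0 < i then b (i - 1) * y (i - 1) else 0) + (if Suc i < n then b i * y (Suc i) else 0)) +
          (a i * x i) * y i"
        using jacobi_matrix_row_sum[OF i, of a b y] by (simp add: algebra_simps)
      also have "\<dots> = (if Suc i < n then b i * (x i * y (Suc i) - x (Suc i) * y i) else 0) -
          (if 0 < i then b (i - 1) * (x (i - 1) * y i - x i * y (i - 1)) else 0)"
        unfolding a_eq by (simp add: algebra_simps)
      finally have "x i * (\<Sum>e<n. jacobi_matrix a b i e * y e) = x i * (- y i)"
        using step by simp
      then have rowy: "(\<Sum>e<n. jacobi_matrix a b i e * y e) = - y i"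
        using x[OF i] by (metis less_irrefl mult_left_cancel)
      show "(\<Sum>e<n. jacobi_matrix a b i e * W e j) = (if j = 0 then 0 else - 1) * W i j"
        using rowx rowy by (simp add: W_def)
    next
      fix f assume f: "f \<in> increasing 2 n"
      then have "f 0 < f 1" "f 1 < n"
        by (auto simp: increasing_def strict_mono_on_def)
      moreover have "minor 2 W f = x (f 0) * y (f 1) - x (f 1) * y (f 0)"
      proof -
        let ?M = "mat 2 2 (\<lambda>(i, j). W (f i) j)"
        have del: "mat_delete ?M 0 0 = mat 1 1 (\<lambda>_. y (f 1))" "mat_delete ?M 0 1 = mat 1 1 (\<lambda>_. x (f 1))"
          by (auto intro!: eq_matI simp: mat_delete_def W_def)
        have "det ?M = (\<Sum>j<2. ?M $$ (0, j) * cofactor ?M 0 j)"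
          by (rule laplace_expansion_row) auto
        also have "\<dots> = x (f 0) * y (f 1) - x (f 1) * y (f 0)"
          unfolding numeral_2_eq_2 using del
          by (simp add: cofactor_def det_single W_def numeral_2_eq_2 mult.commute)
        finally show ?thesis
          by (simp add: minor_def)
      qed
      ultimately show "0 < minor 2 W f"
        using xy by simp
    next
      fix r j :: nat assume "r < d" "j < 2"
      then show "(\<Sum>e<n. Z $$ (r, e) * ((-1) ^ e * W e j)) = 0"
        using ker by (cases "j = 0") (simp_all add: W_def)
    qed
    then show ?thesis
      using 3 by simp
  qed
qed

end

theorem ball_in_small_codimension:
  assumes km: "k + m \<le> n" and Z: "Z \<in> carrier_mat (k + m) n" and pos: "maximal_minors_pos (k + m) n Z"
    and codim: "n - (k + m) \<le> 2"
  shows "ball_in (Gr_real_topology k (k + m)) (k * m) (amplituhedron n k Z)"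
proof -
  interpret positive_matrix "k + m" n Z
    using Z pos by unfold_locales
  obtain J Q ev where spec: "jacobi_spectrum n J Q ev"
    and ker: "\<forall>r<k + m. \<forall>e. k + m \<le> e \<longrightarrow> e < n \<longrightarrow> (\<Sum>i<n. Z $$ (r, i) * Q i e) = 0"
    using small_codimension_spectrum[OF km codim] by blast
  interpret jacobi_spectrum n J Q ev
    by (rule spec)
  interpret chart_at_top n J Q ev k m
    using km by unfold_locales
  show ?thesis
    by (rule ball_in_amplituhedron[OF Z pos]) (use ker in blast)
qed

theorem theorem1p7:
  fixes n k m :: nat and Z :: "real mat"
  assumes "1 \<le> n" and "k + m \<le> n"
    and "Z \<in> carrier_mat (k + m) n" and "maximal_minors_pos (k + m) n Z"
  shows "(twisted_vandermonde n (k + m) Z \<longrightarrow>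
            ball_in (Gr_real_topology k (k + m)) (k * m) (amplituhedron n k Z)) \<and>
         (n - (k + m) \<le> 2 \<longrightarrow>
            ball_in (Gr_real_topology k (k + m)) (k * m) (amplituhedron n k Z))"
  using ball_in_twisted_vandermonde[OF assms(2,3,4)] ball_in_small_codimension[OF assms(2,3,4)] by blast

end
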